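(* Fix $\epsilon\in(0,1/100)$ and suppose $B\ge C\frac{m^2}{\epsilon^2}\ln\frac{m}{\epsilon}$ for a sufficiently large absolute constant $C$. Then algorithm Robust DPA returns a feasible solution to the online packing LP with expected value at least $(1-50\epsilon)\,\mathrm{OPT}$.
   Context: Online packing LP: positive integers $m,n$, $B>0$, rewards $\pi_1,\dots,\pi_n\ge0$, columns $a^1,\dots,a^n\in[0,1]^m\setminus\{0\}$; the LP maximizes $\sum_t\pi_tx_t$ s.t. $\sum_ta^t_ix_t\le B$ ($i\in[m]$), $x\in[0,1]^n$, optimal value $\mathrm{OPT}$. General position: for every $p\in\mathbb{R}^m$ at most $m$ indices $t$ satisfy $\pi_t=p\cdot a^t$. Columns arrive in uniformly random order $\sigma(1),\dots,\sigma(n)$; $n$ is known; variables are set irrevocably on arrival. Assume $\log_2(1/\epsilon)$, $\epsilon n$ and $(m+1)/\epsilon$ are integers. For $p\in\mathbb{R}^m$ and columns $\hat a^t$, $x(p)_t=1$ iff $\pi_t>p\cdot\hat a^t$. For an LP with columns $(\pi_t,\hat a^t)$ and right-hand side $\hat B$, algorithm $(s,\gamma)$-OTP computes an optimal solution $(p,\alpha)$ of the dual: minimize $\frac{s}{n}(1-\gamma)\hat B\sum_ip_i+\sum_{t=1}^s\alpha_{\sigma(t)}$ s.t. $p\cdot\hat a^{\sigma(t)}+\alpha_{\sigma(t)}\ge\pi_{\sigma(t)}$, $p,\alpha\ge0$, and sets $x_{\sigma(t)}=x(p)_{\sigma(t)}$ for $t=s+1,\dots,t'$ where $t'\le2s$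 is the largest index with $\sum_{t=s+1}^{t'}\hat a^{\sigma(t)}x_{\sigma(t)}\le\frac{s}{n}\hat B$, all other variables being $0$. Robust DPA: let $\delta=\frac{\epsilon}{m+1}$, $Q$ the set of vectors in $\{0,\delta,\dots,1\}^m$ of $\ell_\infty$-norm $1$, and $\tilde a^t=\|a^t\|_\infty q^t$ with $q^t$ an $\ell_\infty$-closest vector of $Q$ to $a^t/\|a^t\|_\infty$; for $i=0,\dots,\log_2(1/\epsilon)-1$ run $(\epsilon2^in,\sqrt{\epsilon/2^i})$-OTP on the LP with columns $(\pi_t,\tilde a^t)$ and right-hand side $(1-\epsilon)B$, obtaining $x^i$; output $x=\sum_ix^i$.
   Formalization: General position is assumed also for the rounded columns: for every p at most m indices t satisfy π_t = p·ã^t; with general position of the original columns alone the claim fails, as p may be the only optimal price with x(p)=0. *)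

theory Defs
  imports "HOL-Probability.Probability" "HOL-Combinatorics.Permutations"
begin

text \<open>
  Vectors in m-dimensional space are functions \<open>nat \<Rightarrow> real\<close> of which only the coordinates in
  \<open>{1..m}\<close> matter; \<open>a t\<close> is the t-th column, for \<open>t \<in> {1..n}\<close>. Dimensions are ordinary variables
  and not types because the constant in the theorem has to be uniform in \<open>m\<close> and \<open>n\<close>.
\<close>

definition dotp :: "nat \<Rightarrow> (nat \<Rightarrow> real) \<Rightarrow> (nat \<Rightarrow> real) \<Rightarrow> real" where
  "dotp m u v = (\<Sum>i=1..m. u i * v i)"

definition linf :: "nat \<Rightarrow> (nat \<Rightarrow> real) \<Rightarrow> real" where
  "linf m v = Max ((\<lambda>i. \<bar>v i\<bar>) ` {1..m})"

definition lp_feasible ::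
  "nat \<Rightarrow> nat \<Rightarrow> real \<Rightarrow> (nat \<Rightarrow> nat \<Rightarrow> real) \<Rightarrow> (nat \<Rightarrow> real) \<Rightarrow> bool" where
  "lp_feasible m n B a x \<longleftrightarrow>
     (\<forall>t\<in>{1..n}. 0 \<le> x t \<and> x t \<le> 1) \<and>
     (\<forall>i\<in>{1..m}. (\<Sum>t=1..n. a t i * x t) \<le> B)"

definition lp_value :: "nat \<Rightarrow> (nat \<Rightarrow> real) \<Rightarrow> (nat \<Rightarrow> real) \<Rightarrow> real" where
  "lp_value n \<pi> x = (\<Sum>t=1..n. \<pi> t * x t)"

definition lp_opt ::
  "nat \<Rightarrow> nat \<Rightarrow> real \<Rightarrow> (nat \<Rightarrow> real) \<Rightarrow> (nat \<Rightarrow> nat \<Rightarrow> real) \<Rightarrow> real" where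
  "lp_opt m n B \<pi> a = Sup {lp_value n \<pi> x | x. lp_feasible m n B a x}"

definition packing_lp ::
  "nat \<Rightarrow> nat \<Rightarrow> real \<Rightarrow> (nat \<Rightarrow> real) \<Rightarrow> (nat \<Rightarrow> nat \<Rightarrow> real) \<Rightarrow> bool" where
  "packing_lp m n B \<pi> a \<longleftrightarrow>
     0 < m \<and> 0 < n \<and> 0 < B \<and>
     (\<forall>t\<in>{1..n}. 0 \<le> \<pi> t) \<and>
     (\<forall>t\<in>{1..n}. \<forall>i\<in>{1..m}. 0 \<le> a t i \<and> a t i \<le> 1) \<and>
     (\<forall>t\<in>{1..n}. \<exists>i\<in>{1..m}. a t i \<noteq> 0)"

text \<open>
  General position is a standing assumption on every LP that is solved by dual prices. The theorem
  therefore has it for the LP with rounded columns as well, where it does not follow from general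
  position of the original LP: if \<open>\<pi> t = dotp m p (rounded m a q t)\<close> for one \<open>p\<close> and all \<open>t\<close>,
  then \<open>p\<close> can be the only optimal price vector, and at \<open>p\<close> no column is ever selected.
\<close>

definition general_position ::
  "nat \<Rightarrow> nat \<Rightarrow> (nat \<Rightarrow> real) \<Rightarrow> (nat \<Rightarrow> nat \<Rightarrow> real) \<Rightarrow> bool" where
  "general_position m n \<pi> a \<longleftrightarrow>
     (\<forall>p. card {t\<in>{1..n}. \<pi> t = dotp m p (a t)} \<le> m)"

definition primal_of ::
  "nat \<Rightarrow> (nat \<Rightarrow> real) \<Rightarrow> (nat \<Rightarrow> nat \<Rightarrow> real) \<Rightarrow> (nat \<Rightarrow> real) \<Rightarrow> nat \<Rightarrow> real" where
  "primal_of m \<pi> a p t = (if \<pi> t > dotp m p (a t) then 1 else 0)"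

text \<open>
  An arrival order is a permutation \<open>\<sigma>\<close> of \<open>{1..n}\<close>; column \<open>\<sigma> t\<close> arrives at time \<open>t\<close>. The dual
  variables \<open>\<alpha>\<close> are indexed by columns and not by arrival times.
\<close>

definition otp_dual_feasible ::
  "nat \<Rightarrow> (nat \<Rightarrow> real) \<Rightarrow> (nat \<Rightarrow> nat \<Rightarrow> real) \<Rightarrow> nat \<Rightarrow> (nat \<Rightarrow> nat)
    \<Rightarrow> (nat \<Rightarrow> real) \<times> (nat \<Rightarrow> real) \<Rightarrow> bool" where
  "otp_dual_feasible m \<pi> a s \<sigma> = (\<lambda>(p, \<alpha>).
     (\<forall>t\<in>{1..s}. dotp m p (a (\<sigma> t)) + \<alpha> (\<sigma> t) \<ge> \<pi> (\<sigma> t)) \<and>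
     (\<forall>i\<in>{1..m}. 0 \<le> p i) \<and> (\<forall>t\<in>{1..s}. 0 \<le> \<alpha> (\<sigma> t)))"

definition otp_dual_value ::
  "nat \<Rightarrow> nat \<Rightarrow> real \<Rightarrow> nat \<Rightarrow> real \<Rightarrow> (nat \<Rightarrow> nat)
    \<Rightarrow> (nat \<Rightarrow> real) \<times> (nat \<Rightarrow> real) \<Rightarrow> real" where
  "otp_dual_value m n B s \<gamma> \<sigma> = (\<lambda>(p, \<alpha>).
     real s / real n * (1 - \<gamma>) * B * (\<Sum>i=1..m. p i) + (\<Sum>t=1..s. \<alpha> (\<sigma> t)))"

definition otp_dual_optimal ::
  "nat \<Rightarrow> nat \<Rightarrow> real \<Rightarrow> (nat \<Rightarrow> real) \<Rightarrow> (nat \<Rightarrow> nat \<Rightarrow> real) \<Rightarrow> nat \<Rightarrow> real \<Rightarrow> (nat \<Rightarrow> nat)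
    \<Rightarrow> (nat \<Rightarrow> real) \<times> (nat \<Rightarrow> real) \<Rightarrow> bool" where
  "otp_dual_optimal m n B \<pi> a s \<gamma> \<sigma> y \<longleftrightarrow>
     otp_dual_feasible m \<pi> a s \<sigma> y \<and>
     (\<forall>y'. otp_dual_feasible m \<pi> a s \<sigma> y' \<longrightarrow>
        otp_dual_value m n B s \<gamma> \<sigma> y \<le> otp_dual_value m n B s \<gamma> \<sigma> y')"

definition otp_stop ::
  "nat \<Rightarrow> nat \<Rightarrow> real \<Rightarrow> (nat \<Rightarrow> real) \<Rightarrow> (nat \<Rightarrow> nat \<Rightarrow> real) \<Rightarrow> nat \<Rightarrow> (nat \<Rightarrow> real)
    \<Rightarrow> (nat \<Rightarrow> nat) \<Rightarrow> nat" where
  "otp_stop m n B \<pi> a s p \<sigma> =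
     Max {t'\<in>{s..2 * s}. \<forall>i\<in>{1..m}.
       (\<Sum>t=s+1..t'. a (\<sigma> t) i * primal_of m \<pi> a p (\<sigma> t)) \<le> real s / real n * B}"

text \<open>
  An optimal dual solution need not be unique, so the algorithms take a rule \<open>D\<close> that maps the list
  of the columns seen so far, in their order of arrival, to a dual solution \<open>(p, \<alpha>)\<close>. That the rule
  returns optimal solutions is \<open>robust_dpa_rule\<close> below; this is where \<open>\<gamma>\<close> enters. The argument of
  \<open>otp\<close> after \<open>\<sigma>\<close> is a column \<open>j\<close>, which arrives at time \<open>inv \<sigma> j\<close>.
\<close>

definition otp ::
  "nat \<Rightarrow> nat \<Rightarrow> real \<Rightarrow> (nat \<Rightarrow> real) \<Rightarrow> (nat \<Rightarrow> nat \<Rightarrow> real)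
    \<Rightarrow> (nat list \<Rightarrow> (nat \<Rightarrow> real) \<times> (nat \<Rightarrow> real)) \<Rightarrow> nat \<Rightarrow> (nat \<Rightarrow> nat) \<Rightarrow> nat \<Rightarrow> real" where
  "otp m n B \<pi> a D s \<sigma> j =
     (let p = fst (D (map \<sigma> [1..<s+1]))
      in if inv \<sigma> j \<in> {s+1..otp_stop m n B \<pi> a s p \<sigma>} then primal_of m \<pi> a p j else 0)"

definition grid :: "nat \<Rightarrow> real \<Rightarrow> (nat \<Rightarrow> real) set" where
  "grid m \<delta> = {v \<in> {1..m} \<rightarrow>\<^sub>E {real k * \<delta> | k. real k * \<delta> \<le> 1}. linf m v = 1}"

definition closest_in_grid :: "nat \<Rightarrow> real \<Rightarrow> (nat \<Rightarrow> real) \<Rightarrow> (nat \<Rightarrow> real) \<Rightarrow> bool" where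
  "closest_in_grid m \<delta> u v \<longleftrightarrow>
     v \<in> grid m \<delta> \<and> (\<forall>w\<in>grid m \<delta>. linf m (\<lambda>i. v i - u i) \<le> linf m (\<lambda>i. w i - u i))"

definition rounding ::
  "nat \<Rightarrow> nat \<Rightarrow> real \<Rightarrow> (nat \<Rightarrow> nat \<Rightarrow> real) \<Rightarrow> (nat \<Rightarrow> nat \<Rightarrow> real) \<Rightarrow> bool" where
  "rounding m n \<epsilon> a q \<longleftrightarrow>
     (\<forall>t\<in>{1..n}. closest_in_grid m (\<epsilon> / (real m + 1)) (\<lambda>i. a t i / linf m (a t)) (q t))"

definition rounded ::
  "nat \<Rightarrow> (nat \<Rightarrow> nat \<Rightarrow> real) \<Rightarrow> (nat \<Rightarrow> nat \<Rightarrow> real) \<Rightarrow> nat \<Rightarrow> nat \<Rightarrow> real" where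
  "rounded m a q t i = linf m (a t) * q t i"

text \<open>The two floors below are exact under the integrality assumptions of the theorem.\<close>

definition dpa_rounds :: "real \<Rightarrow> nat" where
  "dpa_rounds \<epsilon> = nat \<lfloor>log 2 (1 / \<epsilon>)\<rfloor>"

definition dpa_sample :: "nat \<Rightarrow> real \<Rightarrow> nat \<Rightarrow> nat" where
  "dpa_sample n \<epsilon> i = nat \<lfloor>\<epsilon> * 2 ^ i * real n\<rfloor>"

definition robust_dpa_rule ::
  "nat \<Rightarrow> nat \<Rightarrow> real \<Rightarrow> real \<Rightarrow> (nat \<Rightarrow> real) \<Rightarrow> (nat \<Rightarrow> nat \<Rightarrow> real) \<Rightarrow> (nat \<Rightarrow> nat \<Rightarrow> real)
    \<Rightarrow> (nat list \<Rightarrow> (nat \<Rightarrow> real) \<times> (nat \<Rightarrow> real)) \<Rightarrow> bool" where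
  "robust_dpa_rule m n B \<epsilon> \<pi> a q D \<longleftrightarrow>
     (\<forall>\<sigma>. \<sigma> permutes {1..n} \<longrightarrow> (\<forall>i<dpa_rounds \<epsilon>.
        otp_dual_optimal m n ((1 - \<epsilon>) * B) \<pi> (rounded m a q)
          (dpa_sample n \<epsilon> i) (sqrt (\<epsilon> / 2 ^ i)) \<sigma>
          (D (map \<sigma> [1..<dpa_sample n \<epsilon> i + 1]))))"

definition robust_dpa ::
  "nat \<Rightarrow> nat \<Rightarrow> real \<Rightarrow> real \<Rightarrow> (nat \<Rightarrow> real) \<Rightarrow> (nat \<Rightarrow> nat \<Rightarrow> real) \<Rightarrow> (nat \<Rightarrow> nat \<Rightarrow> real)
    \<Rightarrow> (nat list \<Rightarrow> (nat \<Rightarrow> real) \<times> (nat \<Rightarrow> real)) \<Rightarrow> (nat \<Rightarrow> nat) \<Rightarrow> nat \<Rightarrow> real" where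
  "robust_dpa m n B \<epsilon> \<pi> a q D \<sigma> j =
     (\<Sum>i<dpa_rounds \<epsilon>.
        otp m n ((1 - \<epsilon>) * B) \<pi> (rounded m a q) D (dpa_sample n \<epsilon> i) \<sigma> j)"

end

theory Submission imports Defs begin

text \<open>
  For a single round with sample size \<open>s\<close> and optimal dual prices \<open>p\<close> of the sample, one-sided
  derivatives of the dual objective show that the selection induced by \<open>p\<close> consumes at most
  \<open>(1 - \<gamma>) s/n B\<close> of every resource on the sample, and almost as much of every resource with a
  positive price. If the consumption on a random set of \<open>s\<close> columns is uniformly close to its mean over
  all prices, the selection is feasible for the whole LP and satisfies approximate complementary
  slackness, so its value is at least \<open>(1 - 3\<gamma>) OPT\<close>. The value collected on the sample itself is at
  most \<open>s/n OPT\<close> in expectation, and the columns after the sample are exchangeable, so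
  columns \<open>s+1\<close> to \<open>2s\<close> contribute almost \<open>s/n OPT\<close>. The losses \<open>\<gamma> s/n\<close> form a geometric series
  over the rounds with sum \<open>O(\<epsilon>)\<close>.

  Uniformity over all prices is where rounding enters. The columns of one direction \<open>q\<close> are selected
  in order of density, up to a threshold \<open>p \<bullet> q\<close>. Discretizing the weight selected in each direction
  leaves at most \<open>(M + 1)^m\<close> patterns, where \<open>M\<close> is the number of directions times the number of
  weight levels, by the Sauer-Shelah lemma. Each pattern class is bracketed by two fixed sets of
  columns, to which Chernoff bounds for sampling without replacement apply; \<open>M\<close> does not depend
  on \<open>n\<close>, and \<open>ln ((M + 1)^m)\<close> is of order \<open>m^2 ln (m / \<epsilon>)\<close>.
\<close>

section \<open>Random permutations\<close>

text \<open>The price is computed from the same sample on which its selection is judged, so no tail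
  bound applies to that selection directly; it applies to sets fixed before the order is drawn.
  Deviations are measured in units of the budget b and not relative to the consumption of a set.
  Hence a selection that overloads a resource needs no tight bracket: it only has to be detected by
  the lower tail, and load levels can stop at b. The tolerances are \<gamma> / 8 for a bracket and
  \<gamma> / 4 for sampling; their sum 3 \<gamma> / 8 stays below the slack \<gamma> / 2 left by a
  good price. Whether a price is good depends on the first s arrivals only, so the later arrivals
  remain exchangeable on that event.

  The choice \<gamma> = sqrt (\<epsilon> / 2^i) makes s/n * \<gamma>^2 equal to \<epsilon>^2 in
  every round. All rounds thus share one failure exponent of order \<epsilon>^2 B, which has to beat
  the logarithm of the number of brackets. Feasibility, unlike value, holds for every order: the
  rounds decide disjoint blocks, each block stops within its own budget, and the budgets sum to less
  than b.\<close>

definition perm_mean :: "'a set \<Rightarrow> (('a \<Rightarrow> 'a) \<Rightarrow> real) \<Rightarrow> real" where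
  "perm_mean A f = (\<Sum>\<sigma> | \<sigma> permutes A. f \<sigma>) / fact (card A)"

lemma perm_mean_pmf:
  assumes "finite A"
  shows "measure_pmf.expectation (pmf_of_set {\<sigma>. \<sigma> permutes A}) f = perm_mean A f"
proof -
  have "{\<sigma>. \<sigma> permutes A} \<noteq> {}" using permutes_id by blast
  then show ?thesis
    unfolding perm_mean_def using assms
    by (subst integral_pmf_of_set) (auto simp: finite_permutations card_permutations)
qed

lemma perm_mean_mono:
  assumes "\<And>\<sigma>. \<sigma> permutes A \<Longrightarrow> f \<sigma> \<le> g \<sigma>"
  shows "perm_mean A f \<le> perm_mean A g"
  unfolding perm_mean_def using assms by (intro divide_right_mono sum_mono) auto

lemma perm_mean_cong:
  assumes "\<And>\<sigma>. \<sigma> permutes A \<Longrightarrow> f \<sigma> = g \<sigma>"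
  shows "perm_mean A f = perm_mean A g"
  unfolding perm_mean_def using assms by (intro arg_cong2[where f="(/)"] sum.cong) auto

lemma perm_mean_const:
  assumes "finite A"
  shows "perm_mean A (\<lambda>\<sigma>. c) = c"
  unfolding perm_mean_def using assms by (simp add: card_permutations)

lemma perm_mean_add: "perm_mean A (\<lambda>\<sigma>. f \<sigma> + g \<sigma>) = perm_mean A f + perm_mean A g"
  unfolding perm_mean_def by (simp add: sum.distrib add_divide_distrib)

lemma perm_mean_diff: "perm_mean A (\<lambda>\<sigma>. f \<sigma> - g \<sigma>) = perm_mean A f - perm_mean A g"
  unfolding perm_mean_def by (simp add: sum_subtractf diff_divide_distrib)

lemma perm_mean_cmult: "perm_mean A (\<lambda>\<sigma>. c * f \<sigma>) = c * perm_mean A f"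
  unfolding perm_mean_def by (simp add: sum_distrib_left)

lemma perm_mean_sum: "perm_mean A (\<lambda>\<sigma>. \<Sum>i\<in>I. f i \<sigma>) = (\<Sum>i\<in>I. perm_mean A (f i))"
  unfolding perm_mean_def sum_divide_distrib[symmetric] by (subst sum.swap) simp

lemma perm_mean_nonneg:
  assumes "\<And>\<sigma>. \<sigma> permutes A \<Longrightarrow> 0 \<le> f \<sigma>"
  shows "0 \<le> perm_mean A f"
  unfolding perm_mean_def using assms by (intro divide_nonneg_nonneg sum_nonneg) auto

lemma perm_mean_compose_left:
  assumes "\<tau> permutes A"
  shows "perm_mean A (\<lambda>\<sigma>. f (\<tau> \<circ> \<sigma>)) = perm_mean A f"
  unfolding perm_mean_def
  using setum_permutations_compose_left[OF assms, of f] by (simp add: o_def)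

lemma perm_mean_compose_right:
  assumes "\<tau> permutes A"
  shows "perm_mean A (\<lambda>\<sigma>. f (\<sigma> \<circ> \<tau>)) = perm_mean A f"
  unfolding perm_mean_def
  using sum_permutations_compose_right[OF assms, of f] by (simp add: o_def)

text \<open>Sampling without replacement is negatively dependent: the probability that the sample
  contains \<open>S\<close> is a product of ratios (s - j) / (n - j), none of which exceeds s /
  n.\<close>

lemma perm_mean_subset_image:
  assumes A: "finite A" "A \<noteq> {}" and J: "J \<subseteq> A" and S: "S \<subseteq> A"
  shows "perm_mean A (\<lambda>\<sigma>. of_bool (S \<subseteq> \<sigma> ` J)) \<le> (real (card J) / real (card A)) ^ card S"
proof -
  have "finite S" using A S finite_subset by blast
  then show ?thesis using S
  proof (induction S rule: finite_induct)
    case empty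
    then show ?case using A by (simp add: perm_mean_const)
  next
    case (insert b S)
    let ?E = "\<lambda>T. perm_mean A (\<lambda>\<sigma>. of_bool (T \<subseteq> \<sigma> ` J))"
    let ?k = "card S" and ?n = "card A" and ?s = "card J"
    have fJ: "finite J" using A J finite_subset by blast
    have IH: "?E S \<le> (real ?s / real ?n) ^ ?k" using insert by auto
    have bA: "b \<in> A" and SA: "S \<subseteq> A" using insert by auto
    have sn: "?s \<le> ?n" using J A by (simp add: card_mono)
    have kn: "?k < ?n"
      using A insert by (intro psubset_card_mono) auto
    \<comment> \<open>Swapping \<open>b\<close> and \<open>c\<close> fixes \<open>S\<close> and
      preserves the uniform distribution, so all extensions of \<open>S\<close> by one element are
      equally likely.\<close>
    have sym: "?E (insert c S) = ?E (insert b S)" if c: "c \<in> A - S" for c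
    proof -
      let ?t = "Transposition.transpose b c"
      have t: "?t permutes A" using bA c by (simp add: permutes_swap_id)
      have fixS: "?t ` S = S" using c insert.hyps by (auto simp: transpose_def image_iff)
      have "?E (insert c S) = perm_mean A (\<lambda>\<sigma>. of_bool (insert c S \<subseteq> (?t \<circ> \<sigma>) ` J))"
        using perm_mean_compose_left[OF t, of "\<lambda>\<sigma>. of_bool (insert c S \<subseteq> \<sigma> ` J)"] by simp
      also have "\<dots> = ?E (insert b S)"
      proof (rule perm_mean_cong)
        fix \<sigma> assume "\<sigma> permutes A"
        have "insert c S = ?t ` (insert b S)" using fixS by simp
        then have "insert c S \<subseteq> (?t \<circ> \<sigma>) ` J \<longleftrightarrow> ?t ` insert b S \<subseteq> ?t ` (\<sigma> ` J)"
          by (simp add: image_comp)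
        also have "\<dots> \<longleftrightarrow> insert b S \<subseteq> \<sigma> ` J"
          by (rule inj_image_subset_iff) (meson inj_transpose bij_is_inj)
        finally show "of_bool (insert c S \<subseteq> (?t \<circ> \<sigma>) ` J) = (of_bool (insert b S \<subseteq> \<sigma> ` J) :: real)" by simp
      qed
      finally show ?thesis .
    qed
    \<comment> \<open>Summing over all extensions turns the event into a count: a sample that
      contains \<open>S\<close> has exactly \<open>?s - ?k\<close> further elements.\<close>
    have "real (?n - ?k) * ?E (insert b S) = (\<Sum>c\<in>A-S. ?E (insert c S))"
      using sym A SA by (simp add: card_Diff_subset finite_subset)
    also have "\<dots> = perm_mean A (\<lambda>\<sigma>. \<Sum>c\<in>A-S. of_bool (insert c S \<subseteq> \<sigma> ` J))"
      by (simp add: perm_mean_sum)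
    also have "\<dots> = perm_mean A (\<lambda>\<sigma>. real (?s - ?k) * of_bool (S \<subseteq> \<sigma> ` J))"
    proof (rule perm_mean_cong)
      fix \<sigma> assume s: "\<sigma> permutes A"
      show "(\<Sum>c\<in>A-S. of_bool (insert c S \<subseteq> \<sigma> ` J)) = real (?s - ?k) * (of_bool (S \<subseteq> \<sigma> ` J))"
      proof (cases "S \<subseteq> \<sigma> ` J")
        case True
        have sub: "\<sigma> ` J \<subseteq> A" using s J permutes_image by blast
        have "(\<Sum>c\<in>A-S. of_bool (insert c S \<subseteq> \<sigma> ` J)) = (\<Sum>c\<in>A-S. (of_bool (c \<in> \<sigma> ` J) :: real))"
          using True by (intro sum.cong) auto
        also have "\<dots> = real (card ((A - S) \<inter> {c. c \<in> \<sigma> ` J}))"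
          using A by (simp add: sum_of_bool_eq)
        also have "(A - S) \<inter> {c. c \<in> \<sigma> ` J} = \<sigma> ` J - S" using sub by auto
        also have "card (\<sigma> ` J - S) = ?s - ?k"
          using True insert.hyps permutes_inj_on[OF s] fJ
          by (simp add: card_Diff_subset card_image)
        finally show ?thesis using True by simp
      qed auto
    qed
    also have "\<dots> = real (?s - ?k) * ?E S" by (simp add: perm_mean_cmult)
    finally have e: "?E (insert b S) = real (?s - ?k) / real (?n - ?k) * ?E S"
      using kn by (simp add: field_simps)
    have "real (?s - ?k) / real (?n - ?k) \<le> real ?s / real ?n"
    proof (cases "?k \<le> ?s")
      case True
      have "?k * ?s \<le> ?k * ?n" using sn by simp
      then have "real ?k * real ?s \<le> real ?k * real ?n" by (metis of_nat_le_iff of_nat_mult)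
      then have "(real ?s - real ?k) * real ?n \<le> real ?s * (real ?n - real ?k)"
        by (simp add: algebra_simps)
      then show ?thesis using True kn by (simp add: of_nat_diff frac_le_eq divide_simps)
    qed auto
    then have "?E (insert b S) \<le> real ?s / real ?n * (real ?s / real ?n) ^ ?k"
      unfolding e using IH by (intro mult_mono) (auto intro: perm_mean_nonneg)
    then show ?case using insert by simp
  qed
qed

text \<open>Multiplied out, the product has nonnegative coefficients, so each monomial may be
  replaced by its bound for independent draws. The result is the moment for independent draws, which
  stands in for independence in the Chernoff bounds.\<close>

lemma perm_mean_prod_le:
  assumes A: "finite A" "A \<noteq> {}" and J: "J \<subseteq> A" and u: "\<And>t. t \<in> A \<Longrightarrow> 0 \<le> u t"
  shows "perm_mean A (\<lambda>\<sigma>. \<Prod>k\<in>J. 1 + u (\<sigma> k))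
           \<le> (\<Prod>t\<in>A. 1 + real (card J) / real (card A) * u t)"
proof -
  let ?\<rho> = "real (card J) / real (card A)"
  have fJ: "finite J" using A J finite_subset by blast
  have "perm_mean A (\<lambda>\<sigma>. \<Prod>k\<in>J. 1 + u (\<sigma> k))
      = perm_mean A (\<lambda>\<sigma>. \<Sum>S\<in>Pow A. prod u S * of_bool (S \<subseteq> \<sigma> ` J))"
  proof (rule perm_mean_cong)
    fix \<sigma> assume s: "\<sigma> permutes A"
    have sub: "\<sigma> ` J \<subseteq> A" using s J permutes_image by blast
    have "(\<Prod>k\<in>J. 1 + u (\<sigma> k)) = (\<Prod>t\<in>\<sigma> ` J. u t + 1)"
      using permutes_inj_on[OF s] by (simp add: prod.reindex add.commute)
    also have "\<dots> = (\<Sum>S\<in>Pow (\<sigma> ` J). prod u S)"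
      using fJ by (simp add: prod_add)
    also have "\<dots> = (\<Sum>S\<in>Pow A. prod u S * of_bool (S \<subseteq> \<sigma> ` J))"
      using A sub by (intro sum.mono_neutral_cong_left) (auto intro: subsetD)
    finally show "(\<Prod>k\<in>J. 1 + u (\<sigma> k)) = (\<Sum>S\<in>Pow A. prod u S * of_bool (S \<subseteq> \<sigma> ` J))" .
  qed
  also have "\<dots> = (\<Sum>S\<in>Pow A. prod u S * perm_mean A (\<lambda>\<sigma>. of_bool (S \<subseteq> \<sigma> ` J)))"
    by (simp add: perm_mean_sum perm_mean_cmult)
  also have "\<dots> \<le> (\<Sum>S\<in>Pow A. prod u S * ?\<rho> ^ card S)"
    using perm_mean_subset_image[OF A J] u
    by (intro sum_mono mult_left_mono prod_nonneg) auto
  also have "\<dots> = (\<Sum>S\<in>Pow A. (\<Prod>t\<in>S. ?\<rho> * u t))"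
    by (intro sum.cong refl) (simp add: prod.distrib del: times_divide_eq_left)
  also have "\<dots> = (\<Prod>t\<in>A. ?\<rho> * u t + 1)"
    using A by (simp add: prod_add)
  finally show ?thesis by (simp add: add.commute)
qed

section \<open>Exponential moments and tail bounds\<close>

lemma exp_le_chord:
  fixes c l :: real
  assumes "0 \<le> c" "c \<le> 1"
  shows "exp (l * c) \<le> 1 + c * (exp l - 1)"
proof -
  have "exp ((1 - c) *\<^sub>R 0 + c *\<^sub>R l) \<le> (1 - c) * exp 0 + c * exp l"
    by (rule convex_onD[OF exp_convex]) (use assms in auto)
  then show ?thesis by (simp add: algebra_simps)
qed

text \<open>The chord makes each factor linear in \<open>c t\<close>, and 1 + x \<le> exp x then
  merges the factors, so that only the total of \<open>c\<close> remains.\<close>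

lemma perm_mean_exp_upper:
  assumes A: "finite A" "A \<noteq> {}" and J: "J \<subseteq> A" and c: "\<And>t. t \<in> A \<Longrightarrow> 0 \<le> c t \<and> c t \<le> 1"
    and l: "0 \<le> l"
  shows "perm_mean A (\<lambda>\<sigma>. exp (l * (\<Sum>k\<in>J. c (\<sigma> k))))
           \<le> exp (real (card J) / real (card A) * (exp l - 1) * (\<Sum>t\<in>A. c t))"
proof -
  let ?\<rho> = "real (card J) / real (card A)"
  have fJ: "finite J" using A J finite_subset by blast
  have "perm_mean A (\<lambda>\<sigma>. exp (l * (\<Sum>k\<in>J. c (\<sigma> k))))
      = perm_mean A (\<lambda>\<sigma>. \<Prod>k\<in>J. 1 + (exp (l * c (\<sigma> k)) - 1))"
    using fJ by (simp add: exp_sum sum_distrib_left)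
  also have "\<dots> \<le> (\<Prod>t\<in>A. 1 + ?\<rho> * (exp (l * c t) - 1))"
    using c l by (intro perm_mean_prod_le[OF A J, of "\<lambda>t. exp (l * c t) - 1"]) auto
  also have "\<dots> \<le> (\<Prod>t\<in>A. exp (?\<rho> * (exp l - 1) * c t))"
  proof (rule prod_mono)
    fix t assume t: "t \<in> A"
    have "?\<rho> * (exp (l * c t) - 1) \<le> ?\<rho> * (c t * (exp l - 1))"
      using exp_le_chord[of "c t" l] c[OF t] by (intro mult_left_mono) auto
    then have "1 + ?\<rho> * (exp (l * c t) - 1) \<le> 1 + ?\<rho> * (exp l - 1) * c t"
      by (simp only: mult.assoc mult.commute mult.left_commute add_left_mono)
    also have "\<dots> \<le> exp (?\<rho> * (exp l - 1) * c t)" by (rule exp_ge_add_one_self)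
    finally show "0 \<le> 1 + ?\<rho> * (exp (l * c t) - 1) \<and>
        1 + ?\<rho> * (exp (l * c t) - 1) \<le> exp (?\<rho> * (exp l - 1) * c t)"
      using c[OF t] l by simp
  qed
  also have "\<dots> = exp (?\<rho> * (exp l - 1) * (\<Sum>t\<in>A. c t))"
    using A by (simp add: exp_sum sum_distrib_left)
  finally show ?thesis .
qed

text \<open>The product bound needs factors at least 1, so it is applied to the positions outside \<open>J\<close>;
  the total over all of \<open>A\<close> is deterministic.\<close>

lemma perm_mean_exp_lower:
  assumes A: "finite A" "A \<noteq> {}" and J: "J \<subseteq> A" and c: "\<And>t. t \<in> A \<Longrightarrow> 0 \<le> c t \<and> c t \<le> 1"
    and l: "0 \<le> l"
  shows "perm_mean A (\<lambda>\<sigma>. exp (- (l * (\<Sum>k\<in>J. c (\<sigma> k)))))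
           \<le> exp (- (real (card J) / real (card A) * (1 - exp (- l)) * (\<Sum>t\<in>A. c t)))"
proof -
  let ?\<rho> = "real (card J) / real (card A)"
  have fJ: "finite J" using A J finite_subset by blast
  have cA: "card A > 0" using A by (simp add: card_gt_0_iff)
  have r1: "?\<rho> \<le> 1" using card_mono[OF A(1) J] cA by (simp add: divide_simps)
  have co: "real (card (A - J)) / real (card A) = 1 - ?\<rho>"
    using A J fJ cA card_mono[OF A(1) J] by (simp add: card_Diff_subset of_nat_diff field_simps)
  have "perm_mean A (\<lambda>\<sigma>. exp (- (l * (\<Sum>k\<in>J. c (\<sigma> k)))))
      = perm_mean A (\<lambda>\<sigma>. (\<Prod>t\<in>A. exp (- l * c t)) * (\<Prod>k\<in>A-J. 1 + (exp (l * c (\<sigma> k)) - 1)))"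
  proof (rule perm_mean_cong)
    fix \<sigma> assume s: "\<sigma> permutes A"
    have "(\<Sum>t\<in>A. c t) = (\<Sum>k\<in>A. c (\<sigma> k))"
      using sum.permute[OF s, of c] by (simp add: o_def)
    also have "\<dots> = (\<Sum>k\<in>A-J. c (\<sigma> k)) + (\<Sum>k\<in>J. c (\<sigma> k))"
      using A J by (simp add: sum.subset_diff)
    finally have "- (l * (\<Sum>k\<in>J. c (\<sigma> k))) = (- l * (\<Sum>t\<in>A. c t)) + l * (\<Sum>k\<in>A-J. c (\<sigma> k))"
      by (simp add: algebra_simps)
    then have "exp (- (l * (\<Sum>k\<in>J. c (\<sigma> k))))
        = exp (- l * (\<Sum>t\<in>A. c t)) * exp (l * (\<Sum>k\<in>A-J. c (\<sigma> k)))"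
      by (simp only: exp_add)
    then show "exp (- (l * (\<Sum>k\<in>J. c (\<sigma> k))))
        = (\<Prod>t\<in>A. exp (- l * c t)) * (\<Prod>k\<in>A-J. 1 + (exp (l * c (\<sigma> k)) - 1))"
      using A by (simp add: exp_sum[symmetric] sum_distrib_left)
  qed
  also have "\<dots> = (\<Prod>t\<in>A. exp (- l * c t)) * perm_mean A (\<lambda>\<sigma>. \<Prod>k\<in>A-J. 1 + (exp (l * c (\<sigma> k)) - 1))"
    by (rule perm_mean_cmult)
  also have "\<dots> \<le> (\<Prod>t\<in>A. exp (- l * c t)) * (\<Prod>t\<in>A. 1 + (1 - ?\<rho>) * (exp (l * c t) - 1))"
    using perm_mean_prod_le[OF A, of "A - J" "\<lambda>t. exp (l * c t) - 1"] c l unfolding co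
    by (intro mult_left_mono prod_nonneg) auto
  \<comment> \<open>After complementation each factor is exactly the moment of one element drawn
    with probability \<open>?\<rho>\<close>.\<close>
  also have "\<dots> = (\<Prod>t\<in>A. 1 - ?\<rho> * (1 - exp (- l * c t)))"
    unfolding prod.distrib[symmetric]
  proof (intro prod.cong refl)
    fix t
    have e: "exp (- l * c t) * exp (l * c t) = 1" by (simp flip: exp_add)
    have g: "exp (- l * c t) * (1 + (1 - r) * (exp (l * c t) - 1))
        = exp (- l * c t) + (1 - r) * (exp (- l * c t) * exp (l * c t)) - (1 - r) * exp (- l * c t)" for r
      by (simp add: algebra_simps)
    show "exp (- l * c t) * (1 + (1 - ?\<rho>) * (exp (l * c t) - 1)) = 1 - ?\<rho> * (1 - exp (- l * c t))"
      unfolding g e by (simp add: ring_distribs del: times_divide_eq_left)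
  qed
  also have "\<dots> \<le> (\<Prod>t\<in>A. exp (- (?\<rho> * (1 - exp (- l)) * c t)))"
  proof (rule prod_mono)
    fix t assume t: "t \<in> A"
    have "c t * (1 - exp (- l)) \<le> 1 - exp (- l * c t)"
      using exp_le_chord[of "c t" "- l"] c[OF t] by (simp add: algebra_simps)
    then have "?\<rho> * (c t * (1 - exp (- l))) \<le> ?\<rho> * (1 - exp (- l * c t))"
      by (intro mult_left_mono) auto
    then have "1 - ?\<rho> * (1 - exp (- l * c t)) \<le> 1 + - (?\<rho> * (1 - exp (- l)) * c t)"
      by (simp only: mult.assoc mult.commute mult.left_commute)
    also have "\<dots> \<le> exp (- (?\<rho> * (1 - exp (- l)) * c t))" by (rule exp_ge_add_one_self)
    finally have up: "1 - ?\<rho> * (1 - exp (- l * c t)) \<le> exp (- (?\<rho> * (1 - exp (- l)) * c t))" .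
    have "?\<rho> * (1 - exp (- l * c t)) \<le> 1 * 1"
      using r1 c[OF t] l by (intro mult_mono) auto
    then show "0 \<le> 1 - ?\<rho> * (1 - exp (- l * c t)) \<and>
        1 - ?\<rho> * (1 - exp (- l * c t)) \<le> exp (- (?\<rho> * (1 - exp (- l)) * c t))"
      using up by simp
  qed
  also have "\<dots> = exp (- (?\<rho> * (1 - exp (- l)) * (\<Sum>t\<in>A. c t)))"
    using A by (simp add: exp_sum[symmetric] sum_distrib_left sum_negf)
  finally show ?thesis .
qed

text \<open>Markov's inequality for the exponential with parameter h / 2, the minimizer of l^2 b - l
  h b. Here \<open>b\<close> is only an upper bound on the total, so sets with a small total get the
  same absolute tolerance.\<close>

lemma perm_tail_upper:
  assumes A: "finite A" "A \<noteq> {}" and J: "J \<subseteq> A" and c: "\<And>t. t \<in> A \<Longrightarrow> 0 \<le> c t \<and> c t \<le> 1"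
    and h: "0 \<le> h" "h \<le> 1" and F: "(\<Sum>t\<in>A. c t) \<le> b"
    and \<rho>: "\<rho> = real (card J) / real (card A)"
  shows "perm_mean A (\<lambda>\<sigma>. of_bool ((\<Sum>k\<in>J. c (\<sigma> k)) \<ge> \<rho> * ((\<Sum>t\<in>A. c t) + h * b)))
           \<le> exp (- (\<rho> * b * h\<^sup>2 / 4))"
proof -
  let ?F = "\<Sum>t\<in>A. c t" and ?l = "h / 2"
  have F0: "0 \<le> ?F" using c by (intro sum_nonneg) auto
  have \<rho>0: "0 \<le> \<rho>" by (simp add: \<rho>)
  have "exp ?l \<le> 1 + ?l + ?l\<^sup>2" using h by (intro exp_bound) auto
  then have "(exp ?l - 1) * ?F \<le> (?l + ?l\<^sup>2) * ?F" using F0 by (intro mult_right_mono) auto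
  also have "\<dots> \<le> ?l * ?F + ?l\<^sup>2 * b"
    using mult_left_mono[OF F zero_le_power2[of ?l]] by (simp add: algebra_simps)
  finally have "\<rho> * ((exp ?l - 1) * ?F - ?l * (?F + h * b)) \<le> \<rho> * (?l\<^sup>2 * b - ?l * h * b)"
    using \<rho>0 by (intro mult_left_mono) (auto simp: algebra_simps)
  then have key: "\<rho> * (exp ?l - 1) * ?F + (- (?l * (\<rho> * (?F + h * b)))) \<le> - (\<rho> * b * h\<^sup>2 / 4)"
    by (simp add: algebra_simps power2_eq_square)
  have "perm_mean A (\<lambda>\<sigma>. of_bool ((\<Sum>k\<in>J. c (\<sigma> k)) \<ge> \<rho> * (?F + h * b)))
      \<le> perm_mean A (\<lambda>\<sigma>. exp (- (?l * (\<rho> * (?F + h * b)))) * exp (?l * (\<Sum>k\<in>J. c (\<sigma> k))))"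
    using h by (intro perm_mean_mono) (auto simp: mult_left_mono simp flip: exp_add)
  also have "\<dots> \<le> exp (- (?l * (\<rho> * (?F + h * b)))) * exp (\<rho> * (exp ?l - 1) * ?F)"
    unfolding perm_mean_cmult using perm_mean_exp_upper[OF A J c, where l = ?l] h
    by (intro mult_left_mono) (auto simp: \<rho>)
  also have "\<dots> \<le> exp (- (\<rho> * b * h\<^sup>2 / 4))"
    using key by (simp flip: exp_add add: add.commute)
  finally show ?thesis .
qed

lemma exp_neg_bound:
  fixes l :: real
  assumes "0 \<le> l" "l \<le> 1"
  shows "l - l\<^sup>2 \<le> 1 - exp (- l)"
proof -
  have "exp (- l) * (1 + l) \<le> exp (-l) * exp l" by (intro mult_left_mono) auto
  then have "exp (- l) * (1 + l) \<le> 1" by (simp flip: exp_add)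
  moreover have "1 \<le> (1 - l + l\<^sup>2) * (1 + l)" using assms by (simp add: algebra_simps power2_eq_square)
  ultimately have "exp (- l) * (1 + l) \<le> (1 - l + l\<^sup>2) * (1 + l)" by linarith
  then show ?thesis using assms by (simp add: mult_le_cancel_right)
qed

text \<open>The minimum admits totals beyond \<open>b\<close>: an overloaded set has to show up in
  the sample only as if its total were \<open>b\<close>. The total enters the exponent with
  coefficient -(l - l^2) \<le> 0, so it may be lowered to the minimum.\<close>

lemma perm_tail_lower:
  assumes A: "finite A" "A \<noteq> {}" and J: "J \<subseteq> A" and c: "\<And>t. t \<in> A \<Longrightarrow> 0 \<le> c t \<and> c t \<le> 1"
    and h: "0 \<le> h" "h \<le> 1" and \<rho>: "\<rho> = real (card J) / real (card A)"
  shows "perm_mean A (\<lambda>\<sigma>. of_bool ((\<Sum>k\<in>J. c (\<sigma> k)) \<le> \<rho> * (min (\<Sum>t\<in>A. c t) b - h * b)))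
           \<le> exp (- (\<rho> * b * h\<^sup>2 / 4))"
proof -
  let ?F = "\<Sum>t\<in>A. c t" and ?l = "h / 2"
  have F0: "0 \<le> ?F" using c by (intro sum_nonneg) auto
  have \<rho>0: "0 \<le> \<rho>" by (simp add: \<rho>)
  have l2: "?l\<^sup>2 \<le> ?l" using h by (simp add: power2_eq_square mult_mono)
  have "?l * (min ?F b - h * b) - (1 - exp (- ?l)) * ?F
      \<le> ?l * (min ?F b - h * b) - (?l - ?l\<^sup>2) * ?F"
    using exp_neg_bound[of ?l] h F0 mult_right_mono[of "?l - ?l\<^sup>2" "1 - exp (- ?l)" ?F] by simp
  also have "\<dots> \<le> ?l * (min ?F b - h * b) - (?l - ?l\<^sup>2) * min ?F b"
    using l2 h by (intro diff_mono mult_left_mono) auto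
  also have "\<dots> \<le> ?l\<^sup>2 * b - ?l * h * b"
    using mult_left_mono[of "min ?F b" b "?l * ?l"] by (simp add: algebra_simps power2_eq_square)
  finally have "\<rho> * (?l * (min ?F b - h * b) - (1 - exp (- ?l)) * ?F) \<le> \<rho> * (?l\<^sup>2 * b - ?l * h * b)"
    using \<rho>0 by (intro mult_left_mono)
  then have key: "?l * (\<rho> * (min ?F b - h * b)) + - (\<rho> * (1 - exp (- ?l)) * ?F) \<le> - (\<rho> * b * h\<^sup>2 / 4)"
    by (simp add: algebra_simps power2_eq_square)
  have "perm_mean A (\<lambda>\<sigma>. of_bool ((\<Sum>k\<in>J. c (\<sigma> k)) \<le> \<rho> * (min ?F b - h * b)))
      \<le> perm_mean A (\<lambda>\<sigma>. exp (?l * (\<rho> * (min ?F b - h * b))) * exp (- (?l * (\<Sum>k\<in>J. c (\<sigma> k)))))"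
    using h by (intro perm_mean_mono) (auto simp: mult_left_mono simp flip: exp_add)
  also have "\<dots> \<le> exp (?l * (\<rho> * (min ?F b - h * b))) * exp (- (\<rho> * (1 - exp (- ?l)) * ?F))"
    unfolding perm_mean_cmult using perm_mean_exp_lower[OF A J c, where l = ?l] h
    by (intro mult_left_mono) (auto simp: \<rho>)
  also have "\<dots> \<le> exp (- (\<rho> * b * h\<^sup>2 / 4))"
    using key by (simp flip: exp_add)
  finally show ?thesis .
qed

section \<open>Counting sign patterns of linear functionals\<close>

definition shattered :: "'a set set \<Rightarrow> 'a set \<Rightarrow> bool" where
  "shattered \<F> S \<longleftrightarrow> (\<forall>T\<subseteq>S. \<exists>X\<in>\<F>. X \<inter> S = T)"

lemma shattered_subset_ground:
  assumes "shattered \<F> S" "\<And>X. X \<in> \<F> \<Longrightarrow> X \<subseteq> G"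
  shows "S \<subseteq> G"
  using assms unfolding shattered_def by blast

text \<open>Pajor's induction for the Sauer-Shelah lemma. Deleting \<open>g\<close> maps the family
  onto \<open>A\<close>, and exactly the members of \<open>B\<close> are hit twice. A set shattered
  by \<open>B\<close> remains shattered when \<open>g\<close> is added, and these sets differ from
  those shattered by \<open>A\<close>, which do not contain \<open>g\<close>.\<close>

lemma card_le_card_shattered:
  assumes "finite G" "\<And>X. X \<in> \<F> \<Longrightarrow> X \<subseteq> G"
  shows "card \<F> \<le> card {S. shattered \<F> S}"
  using assms
proof (induction G arbitrary: \<F> rule: finite_induct)
  case empty
  then have "\<F> \<subseteq> {{}}" by auto
  then have "\<F> = {} \<or> \<F> = {{}}" by blast
  then show ?case
  proof
    assume F: "\<F> = {{}}"
    have "shattered \<F> S \<longleftrightarrow> S = {}" for S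
    proof
      assume "shattered \<F> S"
      then show "S = {}" unfolding F shattered_def by (auto dest: spec[of _ S])
    qed (simp add: F shattered_def)
    then have "{S. shattered \<F> S} = {{}}" by auto
    then show ?thesis using F by simp
  qed simp
next
  case (insert g G)
  define A where "A = (\<lambda>X. X - {g}) ` \<F>"
  define B where "B = {X \<in> \<F>. g \<notin> X \<and> insert g X \<in> \<F>}"
  have fF: "finite \<F>" using insert by (meson finite_Pow_iff finite_insert finite_subset Pow_iff subsetI)
  have AG: "\<And>X. X \<in> A \<Longrightarrow> X \<subseteq> G" using insert.prems by (force simp: A_def)
  have BG: "\<And>X. X \<in> B \<Longrightarrow> X \<subseteq> G" using insert.prems by (force simp: B_def)
  have "card \<F> = card A + card B"
  proof -
    define P where "P = {X \<in> \<F>. g \<in> X}"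
    define N where "N = {X \<in> \<F>. g \<notin> X}"
    define P' where "P' = (\<lambda>X. X - {g}) ` P"
    have fin: "finite P" "finite N" using fF by (auto simp: P_def N_def)
    have PN: "\<F> = P \<union> N" "P \<inter> N = {}" by (auto simp: P_def N_def)
    have N: "(\<lambda>X. X - {g}) ` N = id ` N" by (rule image_cong) (auto simp: N_def)
    from PN have "card \<F> = card P + card N" using fin by (simp add: card_Un_disjoint)
    also have "card P = card P'"
      unfolding P'_def by (rule card_image[symmetric]) (auto simp: inj_on_def P_def)
    also have "card P' + card N = card (P' \<union> N) + card (P' \<inter> N)"
      using fin by (intro card_Un_Int) (auto simp: P'_def)
    also have "P' \<union> N = A" unfolding A_def P'_def PN(1) image_Un N by simp
    also have "P' \<inter> N = B"
    proof
      show "P' \<inter> N \<subseteq> B"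
      proof
        fix X assume "X \<in> P' \<inter> N"
        then obtain Y where "Y \<in> \<F>" "g \<in> Y" "X = Y - {g}" "X \<in> \<F>"
          unfolding P'_def P_def N_def by auto
        then show "X \<in> B" by (simp add: B_def insert_absorb)
      qed
      show "B \<subseteq> P' \<inter> N"
      proof
        fix X assume X: "X \<in> B"
        then have "X = insert g X - {g}" "insert g X \<in> P" by (auto simp: B_def P_def)
        then have "X \<in> P'" unfolding P'_def by (rule image_eqI)
        then show "X \<in> P' \<inter> N" using X by (simp add: N_def B_def)
      qed
    qed
    finally show ?thesis .
  qed
  also have "\<dots> \<le> card {S. shattered A S} + card {S. shattered B S}"
    using insert.IH[of A] insert.IH[of B] AG BG by (intro add_mono) auto
  also have "card {S. shattered B S} = card (insert g ` {S. shattered B S})"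
  proof (rule card_image[symmetric])
    have gS: "g \<notin> S" if "shattered B S" for S
      using shattered_subset_ground[OF that BG] insert.hyps by blast
    show "inj_on (insert g) {S. shattered B S}"
    proof (rule inj_onI)
      fix S T assume "S \<in> {S. shattered B S}" "T \<in> {S. shattered B S}" "insert g S = insert g T"
      then show "S = T" using gS[of S] gS[of T] insert_ident[of g S T] by simp
    qed
  qed
  also have "card {S. shattered A S} + card (insert g ` {S. shattered B S})
      = card ({S. shattered A S} \<union> insert g ` {S. shattered B S})"
  proof (rule card_Un_disjoint[symmetric])
    have "{S. shattered A S} \<subseteq> Pow G" "{S. shattered B S} \<subseteq> Pow G"
      using shattered_subset_ground AG BG by blast+
    then show "finite {S. shattered A S}" "finite (insert g ` {S. shattered B S})"
      using insert.hyps finite_subset by blast+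
    show "{S. shattered A S} \<inter> insert g ` {S. shattered B S} = {}"
      using shattered_subset_ground[OF _ AG] insert.hyps by blast
  qed
  also have "\<dots> \<le> card {S. shattered \<F> S}"
  proof (rule card_mono)
    have "{S. shattered \<F> S} \<subseteq> Pow (insert g G)"
      using shattered_subset_ground insert.prems by blast
    then show "finite {S. shattered \<F> S}"
      using insert.hyps by (meson finite_Pow_iff finite_insert finite_subset)
    show "{S. shattered A S} \<union> insert g ` {S. shattered B S} \<subseteq> {S. shattered \<F> S}"
    proof safe
      fix S assume S: "shattered A S"
      then have "g \<notin> S" using shattered_subset_ground[OF S AG] insert.hyps by blast
      show "shattered \<F> S"
        unfolding shattered_def
      proof (intro allI impI)
        fix T assume "T \<subseteq> S"
        then obtain X where "X \<in> A" "X \<inter> S = T" using S unfolding shattered_def by blast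
        then obtain Y where "Y \<in> \<F>" "X = Y - {g}" by (auto simp: A_def)
        then show "\<exists>X\<in>\<F>. X \<inter> S = T" using \<open>g \<notin> S\<close> \<open>X \<inter> S = T\<close> by (intro bexI[of _ Y]) auto
      qed
    next
      fix S assume S: "shattered B S"
      then have gS: "g \<notin> S" using shattered_subset_ground[OF S BG] insert.hyps by blast
      show "shattered \<F> (insert g S)"
        unfolding shattered_def
      proof (intro allI impI)
        fix T assume T: "T \<subseteq> insert g S"
        then have "T - {g} \<subseteq> S" by blast
        then obtain X where X: "X \<in> B" "X \<inter> S = T - {g}" using S unfolding shattered_def by meson
        show "\<exists>X\<in>\<F>. X \<inter> insert g S = T"
        proof (cases "g \<in> T")
          case True
          then show ?thesis using X by (intro bexI[of _ "insert g X"]) (auto simp: B_def)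
        next
          case False
          then show ?thesis using X by (intro bexI[of _ X]) (auto simp: B_def)
        qed
      qed
    qed
  qed
  finally show ?case .
qed

text \<open>A subset with at most \<open>d\<close> elements is encoded by a list of length
  \<open>d\<close> in which \<open>None\<close> is padding.\<close>

lemma card_subsets_le:
  assumes "finite G"
  shows "card {S. S \<subseteq> G \<and> card S \<le> d} \<le> (card G + 1) ^ d"
proof -
  let ?L = "{xs. set xs \<subseteq> insert None (Some ` G) \<and> length xs = d}"
  have fL: "finite ?L" using assms by (intro finite_lists_length_eq) auto
  have "{S. S \<subseteq> G \<and> card S \<le> d} \<subseteq> (\<lambda>xs. {x. Some x \<in> set xs}) ` ?L"
  proof
    fix S assume "S \<in> {S. S \<subseteq> G \<and> card S \<le> d}"
    then have S: "S \<subseteq> G" "card S \<le> d" by auto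
    then obtain ys where ys: "set ys = S" "distinct ys"
      using assms finite_subset finite_distinct_list by metis
    then have "length ys \<le> d" using S distinct_card by fastforce
    then show "S \<in> (\<lambda>xs. {x. Some x \<in> set xs}) ` ?L"
      using ys S by (intro image_eqI[of _ _ "map Some ys @ replicate (d - length ys) None"]) auto
  qed
  then have "card {S. S \<subseteq> G \<and> card S \<le> d} \<le> card ?L"
    using fL by (meson surj_card_le)
  also have "\<dots> = card (insert None (Some ` G)) ^ d"
    using assms by (intro card_lists_length_eq) auto
  also have "card (insert None (Some ` G)) = card G + 1"
    using assms by (simp add: card_insert_if card_image)
  finally show ?thesis .
qed

lemma sauer_shelah:
  assumes "finite G" "\<And>X. X \<in> \<F> \<Longrightarrow> X \<subseteq> G" "\<And>S. shattered \<F> S \<Longrightarrow> card S \<le> d"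
  shows "card \<F> \<le> (card G + 1) ^ d"
proof -
  have "card \<F> \<le> card {S. shattered \<F> S}" by (rule card_le_card_shattered[OF assms(1,2)])
  also have "\<dots> \<le> card {S. S \<subseteq> G \<and> card S \<le> d}"
    using assms shattered_subset_ground[of \<F> _ G] by (intro card_mono) auto
  also have "\<dots> \<le> (card G + 1) ^ d" by (rule card_subsets_le[OF assms(1)])
  finally show ?thesis .
qed

text \<open>The vectors are indexed instead of being collected in a set, because distinct ground
  elements may carry the same vector, as the levels of one direction do later.\<close>

lemma ex_linear_dependence:
  fixes f :: "'a \<Rightarrow> nat \<Rightarrow> real"
  assumes "finite A" "card A > m"
  shows "\<exists>l. (\<exists>x\<in>A. l x \<noteq> 0) \<and> (\<forall>i\<in>{1..m}. (\<Sum>x\<in>A. l x * f x i) = 0)"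
  using assms
proof (induction m arbitrary: A f)
  case 0
  then have "A \<noteq> {}" by auto
  then show ?case by (intro exI[of _ "\<lambda>_. 1"]) auto
next
  case (Suc m)
  show ?case
  proof (cases "\<forall>x\<in>A. f x (Suc m) = 0")
    case True
    obtain l where l: "\<exists>x\<in>A. l x \<noteq> 0" "\<forall>i\<in>{1..m}. (\<Sum>x\<in>A. l x * f x i) = 0"
      using Suc.IH[of A f] Suc.prems by auto
    have "(\<Sum>x\<in>A. l x * f x i) = 0" if "i \<in> {1..Suc m}" for i
      using that l True by (cases "i = Suc m") auto
    then show ?thesis using l by blast
  next
    case False
    then obtain z where z: "z \<in> A" "f z (Suc m) \<noteq> 0" by blast
    \<comment> \<open>Gaussian elimination with pivot \<open>z\<close>: coordinate
      \<open>Suc m\<close> of \<open>g\<close> vanishes, and the induction hypothesis handles the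
      other coordinates.\<close>
    define r where "r x = f x (Suc m) / f z (Suc m)" for x
    define g where "g x i = f x i - r x * f z i" for x i
    have fA: "finite (A - {z})" using Suc.prems by simp
    have "card (A - {z}) > m" using Suc.prems z by simp
    then obtain l where l: "\<exists>x\<in>A-{z}. l x \<noteq> 0" "\<forall>i\<in>{1..m}. (\<Sum>x\<in>A-{z}. l x * g x i) = 0"
      using Suc.IH[OF fA] by metis
    define l' where "l' = l(z := - (\<Sum>x\<in>A-{z}. l x * r x))"
    have "(\<Sum>x\<in>A. l' x * f x i) = (\<Sum>x\<in>A-{z}. l x * g x i)" for i
    proof -
      have "(\<Sum>x\<in>A. l' x * f x i) = l' z * f z i + (\<Sum>x\<in>A-{z}. l' x * f x i)"
        by (rule sum.remove[OF Suc.prems(1) z(1)])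
      also have "(\<Sum>x\<in>A-{z}. l' x * f x i) = (\<Sum>x\<in>A-{z}. l x * f x i)"
        by (intro sum.cong) (auto simp: l'_def)
      also have "\<dots> = (\<Sum>x\<in>A-{z}. l x * g x i) + (\<Sum>x\<in>A-{z}. l x * r x) * f z i"
        unfolding g_def sum_distrib_right sum.distrib[symmetric]
        by (intro sum.cong refl) (simp add: algebra_simps)
      finally show ?thesis by (simp add: l'_def)
    qed
    moreover have "g x (Suc m) = 0" for x using z by (simp add: g_def r_def)
    ultimately have "(\<Sum>x\<in>A. l' x * f x i) = 0" if "i \<in> {1..Suc m}" for i
      using that l(2) by (cases "i = Suc m") simp_all
    moreover have "\<exists>x\<in>A. l' x \<noteq> 0" using l(1) by (auto simp: l'_def)
    ultimately show ?thesis by blast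
  qed
qed

text \<open>Each ground element \<open>x\<close> carries a linear functional and a set of prices that is a lower half
  line in this functional. If more than \<open>m\<close> of them were shattered, then prices realizing opposite
  sign patterns of a linear dependence would contradict each other.\<close>

lemma card_halfline_patterns_le:
  fixes f :: "'a \<Rightarrow> nat \<Rightarrow> real" and R :: "'a \<Rightarrow> real \<Rightarrow> bool"
  assumes G: "finite G" and R: "\<And>x y z. x \<in> G \<Longrightarrow> R x z \<Longrightarrow> y \<le> z \<Longrightarrow> R x y"
  shows "card (range (\<lambda>p. {x\<in>G. R x (dotp m p (f x))})) \<le> (card G + 1) ^ m"
proof (rule sauer_shelah[OF G])
  let ?P = "\<lambda>p. {x\<in>G. R x (dotp m p (f x))}"
  fix S assume S: "shattered (range ?P) S"
  show "card S \<le> m"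
  proof (rule ccontr)
    assume "\<not> card S \<le> m"
    then have "card S > m" by simp
    moreover have SG: "S \<subseteq> G" by (rule shattered_subset_ground[OF S]) auto
    ultimately obtain l where l: "\<exists>x\<in>S. l x \<noteq> 0" "\<forall>i\<in>{1..m}. (\<Sum>x\<in>S. l x * f x i) = 0"
      using ex_linear_dependence[of S m f] G finite_subset by blast
    have ex: "\<exists>p. ?P p \<inter> S = T" if "T \<subseteq> S" for T
      using S that unfolding shattered_def by blast
    \<comment> \<open>One price realizes the positive coefficients and another the negative ones.
      Between the two, the functional moves against the sign of its coefficient, so every nonzero
      term of the dependence becomes negative.\<close>
    obtain p1 where p1: "?P p1 \<inter> S = {x\<in>S. l x > 0}" using ex[of "{x\<in>S. l x > 0}"] by blast
    obtain p2 where p2: "?P p2 \<inter> S = {x\<in>S. l x < 0}" using ex[of "{x\<in>S. l x < 0}"] by blast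
    let ?d = "\<lambda>x. dotp m p1 (f x) - dotp m p2 (f x)"
    have pos: "?d x < 0" if "x \<in> S" "l x > 0" for x
    proof -
      have "x \<in> ?P p1 \<inter> S" "x \<notin> ?P p2 \<inter> S" unfolding p1 p2 using that by simp_all
      then have "R x (dotp m p1 (f x))" "\<not> R x (dotp m p2 (f x))" using that SG by auto
      then show ?thesis using R[of x "dotp m p1 (f x)" "dotp m p2 (f x)"] that SG by fastforce
    qed
    have neg: "?d x > 0" if "x \<in> S" "l x < 0" for x
    proof -
      have "x \<in> ?P p2 \<inter> S" "x \<notin> ?P p1 \<inter> S" unfolding p1 p2 using that by simp_all
      then have "R x (dotp m p2 (f x))" "\<not> R x (dotp m p1 (f x))" using that SG by auto
      then show ?thesis using R[of x "dotp m p2 (f x)" "dotp m p1 (f x)"] that SG by fastforce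
    qed
    have lt: "l x * ?d x < 0" if "x \<in> S" "l x \<noteq> 0" for x
      using pos[of x] neg[of x] that by (cases "l x > 0") (auto simp: mult_pos_neg mult_neg_pos)
    have "(\<Sum>x\<in>S. l x * ?d x) < (\<Sum>x\<in>S. 0)"
    proof (rule sum_strict_mono_ex1)
      show "finite S" using SG G finite_subset by blast
      show "\<forall>x\<in>S. l x * ?d x \<le> 0"
      proof
        fix x assume "x \<in> S"
        then show "l x * ?d x \<le> 0" using lt[of x] by (cases "l x = 0") auto
      qed
      show "\<exists>x\<in>S. l x * ?d x < 0" using l(1) lt by blast
    qed
    moreover have "(\<Sum>x\<in>S. l x * ?d x) = (\<Sum>x\<in>S. \<Sum>i=1..m. (p1 i - p2 i) * (l x * f x i))"
      unfolding dotp_def by (simp add: sum_subtractf[symmetric] sum_distrib_left algebra_simps)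
    moreover have "\<dots> = (\<Sum>i=1..m. (p1 i - p2 i) * (\<Sum>x\<in>S. l x * f x i))"
      by (subst sum.swap) (simp add: sum_distrib_left)
    moreover have "\<dots> = 0" using l(2) by simp
    ultimately show False by simp
  qed
qed auto

section \<open>Prices and linear programs\<close>

lemma lp_value_bounded:
  assumes "\<And>t. t \<in> {1..n} \<Longrightarrow> 0 \<le> \<pi> t" "lp_feasible m n B a x"
  shows "lp_value n \<pi> x \<le> (\<Sum>t=1..n. \<pi> t)"
  unfolding lp_value_def using assms
  by (intro sum_mono mult_left_le) (auto simp: lp_feasible_def)

lemma lp_value_le_opt:
  assumes "\<And>t. t \<in> {1..n} \<Longrightarrow> 0 \<le> \<pi> t" "lp_feasible m n B a x"
  shows "lp_value n \<pi> x \<le> lp_opt m n B \<pi> a"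
  unfolding lp_opt_def
proof (rule cSup_upper)
  show "lp_value n \<pi> x \<in> {lp_value n \<pi> x |x. lp_feasible m n B a x}" using assms by blast
  show "bdd_above {lp_value n \<pi> x |x. lp_feasible m n B a x}"
    using lp_value_bounded[where \<pi> = \<pi> and n = n, OF assms(1)] by (intro bdd_aboveI) blast
qed

lemma lp_opt_le:
  assumes "0 \<le> B" "\<And>x. lp_feasible m n B a x \<Longrightarrow> lp_value n \<pi> x \<le> M"
  shows "lp_opt m n B \<pi> a \<le> M"
  unfolding lp_opt_def
proof (rule cSup_least)
  have "lp_feasible m n B a (\<lambda>_. 0)" using assms by (simp add: lp_feasible_def)
  then show "{lp_value n \<pi> x |x. lp_feasible m n B a x} \<noteq> {}" by blast
qed (use assms in blast)

lemma lp_opt_nonneg: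
  assumes "0 \<le> B" "\<And>t. t \<in> {1..n} \<Longrightarrow> 0 \<le> \<pi> t"
  shows "0 \<le> lp_opt m n B \<pi> a"
proof -
  have "lp_feasible m n B a (\<lambda>_. 0)" using assms by (simp add: lp_feasible_def)
  then show ?thesis using lp_value_le_opt[where \<pi> = \<pi>, OF assms(2)] by (fastforce simp: lp_value_def)
qed

lemma primal_of_bounds: "0 \<le> primal_of m \<pi> a p t" "primal_of m \<pi> a p t \<le> 1"
  by (simp_all add: primal_of_def)

lemma sum_dotp_swap:
  "(\<Sum>t\<in>T. dotp m p (a t) * x t) = (\<Sum>i=1..m. p i * (\<Sum>t\<in>T. a t i * x t))"
  unfolding dotp_def by (simp add: sum_distrib_right sum_distrib_left sum.swap[of _ T] mult.assoc)

text \<open>Weak duality with approximate complementary slackness. The dual bound consists of the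
  surplus of the columns and the price of the budget. The selection collects all of the surplus and
  at least the fraction 1 - \<kappa> of the price, since resources of price zero add nothing to
  it.\<close>

lemma price_value_ge_opt:
  assumes b: "0 \<le> b" and p: "\<And>i. i \<in> {1..m} \<Longrightarrow> 0 \<le> p i" and k: "0 \<le> \<kappa>" "\<kappa> \<le> 1"
    and use: "\<And>i. i \<in> {1..m} \<Longrightarrow> 0 < p i \<Longrightarrow>
        (1 - \<kappa>) * b \<le> (\<Sum>t=1..n. a t i * primal_of m \<pi> a p t)"
  shows "(1 - \<kappa>) * lp_opt m n b \<pi> a \<le> lp_value n \<pi> (primal_of m \<pi> a p)"
proof (cases "\<kappa> = 1")
  \<comment> \<open>Division by 1 - \<kappa> is impossible here, and only nonnegativity of the value
    is claimed.\<close>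
  case True
  have "0 \<le> (\<Sum>t=1..n. \<pi> t * primal_of m \<pi> a p t) - (\<Sum>t=1..n. dotp m p (a t) * primal_of m \<pi> a p t)"
    unfolding sum_subtractf[symmetric] by (intro sum_nonneg) (auto simp: primal_of_def)
  moreover have "0 \<le> (\<Sum>t=1..n. dotp m p (a t) * primal_of m \<pi> a p t)"
    unfolding sum_dotp_swap
  proof (intro sum_nonneg)
    fix i assume i: "i \<in> {1..m}"
    show "0 \<le> p i * (\<Sum>t=1..n. a t i * primal_of m \<pi> a p t)"
      using p[OF i] use[OF i] True by (cases "p i = 0") auto
  qed
  ultimately show ?thesis using True by (simp add: lp_value_def)
next
  case False
  let ?x = "primal_of m \<pi> a p"
  let ?F = "\<lambda>i. \<Sum>t=1..n. a t i * ?x t"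
  let ?pF = "\<Sum>i=1..m. p i * ?F i"
  define V where "V = lp_value n \<pi> ?x"
  have k1: "0 < 1 - \<kappa>" using k False by simp
  have excess: "V - ?pF = (\<Sum>t=1..n. max 0 (\<pi> t - dotp m p (a t)))"
  proof -
    have "V - ?pF = (\<Sum>t=1..n. \<pi> t * ?x t - dotp m p (a t) * ?x t)"
      unfolding V_def lp_value_def sum_subtractf sum_dotp_swap ..
    also have "\<dots> = (\<Sum>t=1..n. max 0 (\<pi> t - dotp m p (a t)))"
      by (intro sum.cong refl) (auto simp: primal_of_def)
    finally show ?thesis .
  qed
  have "lp_opt m n b \<pi> a \<le> V / (1 - \<kappa>)"
  proof (rule lp_opt_le[OF b])
    fix y assume y: "lp_feasible m n b a y"
    have "lp_value n \<pi> y \<le> (\<Sum>t=1..n. max 0 (\<pi> t - dotp m p (a t)) + dotp m p (a t) * y t)"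
      unfolding lp_value_def
    proof (rule sum_mono)
      fix t assume "t \<in> {1..n}"
      then have y1: "0 \<le> y t" "y t \<le> 1" using y by (auto simp: lp_feasible_def)
      have "(\<pi> t - dotp m p (a t)) * y t \<le> max 0 (\<pi> t - dotp m p (a t)) * y t"
        using y1 by (intro mult_right_mono) auto
      also have "\<dots> \<le> max 0 (\<pi> t - dotp m p (a t))" using y1 by (intro mult_left_le) auto
      finally show "\<pi> t * y t \<le> max 0 (\<pi> t - dotp m p (a t)) + dotp m p (a t) * y t"
        by (simp add: algebra_simps)
    qed
    also have "\<dots> = (V - ?pF) + (\<Sum>i=1..m. p i * (\<Sum>t=1..n. a t i * y t))"
      unfolding sum.distrib excess[symmetric] sum_dotp_swap ..
    also have "\<dots> \<le> (V - ?pF) + (\<Sum>i=1..m. p i * b)"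
      using y p by (intro add_left_mono sum_mono mult_left_mono) (auto simp: lp_feasible_def)
    finally have "(1 - \<kappa>) * lp_value n \<pi> y \<le> (1 - \<kappa>) * ((V - ?pF) + (\<Sum>i=1..m. p i * b))"
      using k1 by (intro mult_left_mono) auto
    also have "\<dots> = (1 - \<kappa>) * (V - ?pF) + (\<Sum>i=1..m. p i * ((1 - \<kappa>) * b))"
      by (simp add: distrib_left sum_distrib_left mult_ac)
    also have "\<dots> \<le> 1 * (V - ?pF) + ?pF"
    proof (rule add_mono)
      show "(1 - \<kappa>) * (V - ?pF) \<le> 1 * (V - ?pF)"
        unfolding excess using k by (intro mult_right_mono sum_nonneg) auto
      show "(\<Sum>i=1..m. p i * ((1 - \<kappa>) * b)) \<le> ?pF"
      proof (rule sum_mono)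
        fix i assume i: "i \<in> {1..m}"
        show "p i * ((1 - \<kappa>) * b) \<le> p i * ?F i"
          using p[OF i] use[OF i] by (cases "p i = 0") (auto intro: mult_left_mono)
      qed
    qed
    finally show "lp_value n \<pi> y \<le> V / (1 - \<kappa>)"
      using k1 by (simp add: pos_le_divide_eq mult.commute)
  qed
  then show ?thesis using k1 by (simp add: V_def pos_le_divide_eq mult.commute)
qed

section \<open>One-sided derivatives of the dual objective\<close>

lemma ex_pos_lower_bound:
  fixes g :: "'a \<Rightarrow> real"
  assumes "finite T" "\<And>t. t \<in> T \<Longrightarrow> 0 < g t"
  shows "\<exists>h>0. \<forall>t\<in>T. h \<le> g t"
proof (intro exI conjI ballI)
  \<comment> \<open>The 1 supplies a step when \<open>T\<close> is empty.\<close>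
  show "0 < Min (insert 1 (g ` T))" using assms by simp
  show "Min (insert 1 (g ` T)) \<le> g t" if "t \<in> T" for t using assms that by (intro Min_le) auto
qed

lemma dotp_fun_upd:
  assumes "i \<in> {1..m}"
  shows "dotp m (p(i := p i + h)) v = dotp m p v + h * v i"
proof -
  have "dotp m (p(i := p i + h)) v = (\<Sum>k=1..m. p k * v k + (if k = i then h * v k else 0))"
    unfolding dotp_def by (intro sum.cong) (auto simp: algebra_simps)
  then show ?thesis using assms by (simp add: dotp_def sum.distrib)
qed

lemma sum_fun_upd_add:
  fixes p :: "nat \<Rightarrow> real"
  assumes "i \<in> {1..m}"
  shows "(\<Sum>k=1..m. (p(i := p i + h)) k) = (\<Sum>k=1..m. p k) + h"
  using dotp_fun_upd[OF assms, of p h "\<lambda>_. 1"] by (simp add: dotp_def)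

text \<open>For fixed prices the cheapest feasible \<open>\<alpha>\<close> is the positive part of
  the surplus. Eliminating it leaves a minimization over nonnegative prices alone.\<close>

lemma otp_dual_optimal_price:
  assumes opt: "otp_dual_optimal m n b \<pi> a s \<gamma> \<sigma> (p, \<alpha>)"
    and p': "\<And>i. i \<in> {1..m} \<Longrightarrow> 0 \<le> p' i"
  shows "real s / real n * (1 - \<gamma>) * b * (\<Sum>i=1..m. p i) + (\<Sum>t=1..s. max 0 (\<pi> (\<sigma> t) - dotp m p (a (\<sigma> t))))
       \<le> real s / real n * (1 - \<gamma>) * b * (\<Sum>i=1..m. p' i) + (\<Sum>t=1..s. max 0 (\<pi> (\<sigma> t) - dotp m p' (a (\<sigma> t))))"
proof -
  have "otp_dual_feasible m \<pi> a s \<sigma> (p', \<lambda>j. max 0 (\<pi> j - dotp m p' (a j)))"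
    using p' by (auto simp: otp_dual_feasible_def)
  then have le: "otp_dual_value m n b s \<gamma> \<sigma> (p, \<alpha>)
      \<le> otp_dual_value m n b s \<gamma> \<sigma> (p', \<lambda>j. max 0 (\<pi> j - dotp m p' (a j)))"
    using opt unfolding otp_dual_optimal_def by blast
  have "otp_dual_feasible m \<pi> a s \<sigma> (p, \<alpha>)" using opt unfolding otp_dual_optimal_def by blast
  then have "(\<Sum>t=1..s. max 0 (\<pi> (\<sigma> t) - dotp m p (a (\<sigma> t)))) \<le> (\<Sum>t=1..s. \<alpha> (\<sigma> t))"
    by (intro sum_mono) (auto simp: otp_dual_feasible_def algebra_simps)
  then show ?thesis using le by (simp add: otp_dual_value_def)
qed

text \<open>The dual objective is piecewise linear in \<open>p\<close>. Its one-sided derivatives in direction \<open>i\<close> at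
  an optimal \<open>p\<close> give the two bounds on the consumption of the sample; the columns with
  \<open>\<pi> t = dotp m p (a t)\<close> enter the left derivative only, whence the loss of \<open>m\<close>.\<close>

lemma otp_sample_consumption_le:
  assumes opt: "otp_dual_optimal m n b \<pi> a s \<gamma> \<sigma> (p, \<alpha>)"
    and a: "\<And>t. t \<in> {1..s} \<Longrightarrow> 0 \<le> a (\<sigma> t) i \<and> a (\<sigma> t) i \<le> 1" and i: "i \<in> {1..m}"
  shows "(\<Sum>t=1..s. a (\<sigma> t) i * primal_of m \<pi> a p (\<sigma> t)) \<le> real s / real n * (1 - \<gamma>) * b"
proof -
  let ?d = "\<lambda>t. \<pi> (\<sigma> t) - dotp m p (a (\<sigma> t))" and ?B = "real s / real n * (1 - \<gamma>) * b"
  have p: "\<And>k. k \<in> {1..m} \<Longrightarrow> 0 \<le> p k"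
    using opt by (auto simp: otp_dual_optimal_def otp_dual_feasible_def)
  have "\<exists>h>0. \<forall>t\<in>{t\<in>{1..s}. ?d t > 0}. h \<le> ?d t" by (rule ex_pos_lower_bound) auto
  \<comment> \<open>Since entries are at most 1, raising the price by \<open>h\<close> leaves every
    positive surplus nonnegative, and the objective is linear along this step.\<close>
  then obtain h where h: "0 < h" "\<forall>t\<in>{t\<in>{1..s}. ?d t > 0}. h \<le> ?d t" by blast
  have "max 0 (\<pi> (\<sigma> t) - dotp m (p(i := p i + h)) (a (\<sigma> t)))
      = max 0 (?d t) - h * (a (\<sigma> t) i * primal_of m \<pi> a p (\<sigma> t))" if t: "t \<in> {1..s}" for t
  proof (cases "?d t > 0")
    case True
    then have "h \<le> ?d t" using h t by auto
    moreover have "h * a (\<sigma> t) i \<le> h" using h a[OF t] by (intro mult_left_le) auto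
    ultimately show ?thesis using True by (simp add: dotp_fun_upd[OF i] primal_of_def)
  next
    case False
    have "0 \<le> h * a (\<sigma> t) i" using h a[OF t] by simp
    then show ?thesis using False by (simp add: dotp_fun_upd[OF i] primal_of_def)
  qed
  then have "(\<Sum>t=1..s. max 0 (\<pi> (\<sigma> t) - dotp m (p(i := p i + h)) (a (\<sigma> t))))
      = (\<Sum>t=1..s. max 0 (?d t)) - h * (\<Sum>t=1..s. a (\<sigma> t) i * primal_of m \<pi> a p (\<sigma> t))"
    by (simp add: sum_subtractf sum_distrib_left)
  moreover have "?B * (\<Sum>k=1..m. p k) + (\<Sum>t=1..s. max 0 (?d t)) \<le> ?B * ((\<Sum>k=1..m. p k) + h)
      + (\<Sum>t=1..s. max 0 (\<pi> (\<sigma> t) - dotp m (p(i := p i + h)) (a (\<sigma> t))))"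
    using otp_dual_optimal_price[OF opt, of "p(i := p i + h)"] p h
    unfolding sum_fun_upd_add[OF i] by fastforce
  ultimately have "h * (\<Sum>t=1..s. a (\<sigma> t) i * primal_of m \<pi> a p (\<sigma> t)) \<le> h * ?B"
    by (simp only: distrib_left mult.commute[of h ?B])
  then show ?thesis using h(1) by (simp only: mult_le_cancel_left_pos)
qed

lemma otp_sample_consumption_ge:
  assumes opt: "otp_dual_optimal m n b \<pi> a s \<gamma> \<sigma> (p, \<alpha>)" and inj: "inj_on \<sigma> {1..s}"
    and range: "\<sigma> ` {1..s} \<subseteq> {1..n}" and gp: "general_position m n \<pi> a"
    and a: "\<And>t. t \<in> {1..s} \<Longrightarrow> 0 \<le> a (\<sigma> t) i \<and> a (\<sigma> t) i \<le> 1" and i: "i \<in> {1..m}" "0 < p i"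
  shows "real s / real n * (1 - \<gamma>) * b - real m \<le> (\<Sum>t=1..s. a (\<sigma> t) i * primal_of m \<pi> a p (\<sigma> t))"
proof -
  let ?d = "\<lambda>t. \<pi> (\<sigma> t) - dotp m p (a (\<sigma> t))" and ?B = "real s / real n * (1 - \<gamma>) * b"
  \<comment> \<open>Ties count here, because a lower price can make a surplus of zero
    positive.\<close>
  let ?c = "\<lambda>t. a (\<sigma> t) i * of_bool (?d t \<ge> 0)"
  have p: "\<And>k. k \<in> {1..m} \<Longrightarrow> 0 \<le> p k"
    using opt by (auto simp: otp_dual_optimal_def otp_dual_feasible_def)
  have "\<exists>h>0. \<forall>t\<in>{t\<in>{1..s}. ?d t < 0}. h \<le> - ?d t" by (rule ex_pos_lower_bound) auto
  then obtain h' where h': "0 < h'" "\<forall>t\<in>{t\<in>{1..s}. ?d t < 0}. h' \<le> - ?d t" by blast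
  \<comment> \<open>The cap at \<open>p i\<close> keeps the lowered price nonnegative; this is where
    a positive price is needed.\<close>
  define h where "h = min h' (p i)"
  have h: "0 < h" "h \<le> p i" "\<forall>t\<in>{t\<in>{1..s}. ?d t < 0}. h \<le> - ?d t" using h' i by (auto simp: h_def)
  let ?p' = "p(i := p i + - h)"
  have "max 0 (\<pi> (\<sigma> t) - dotp m ?p' (a (\<sigma> t))) = max 0 (?d t) + h * ?c t" if t: "t \<in> {1..s}" for t
  proof (cases "?d t \<ge> 0")
    case True
    moreover have "0 \<le> h * a (\<sigma> t) i" using h a[OF t] by simp
    ultimately show ?thesis unfolding dotp_fun_upd[OF i(1)] by simp
  next
    case False
    then have "h \<le> - ?d t" using h t by auto
    moreover have "h * a (\<sigma> t) i \<le> h" using h a[OF t] by (intro mult_left_le) auto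
    ultimately show ?thesis using False unfolding dotp_fun_upd[OF i(1)] by simp
  qed
  then have "(\<Sum>t=1..s. max 0 (\<pi> (\<sigma> t) - dotp m ?p' (a (\<sigma> t))))
      = (\<Sum>t=1..s. max 0 (?d t)) + h * (\<Sum>t=1..s. ?c t)"
    unfolding sum_distrib_left sum.distrib[symmetric] by (intro sum.cong refl)
  moreover have "0 \<le> ?p' k" if "k \<in> {1..m}" for k using p[OF that] h by auto
  then have "?B * (\<Sum>k=1..m. p k) + (\<Sum>t=1..s. max 0 (?d t)) \<le> ?B * ((\<Sum>k=1..m. p k) + - h)
      + (\<Sum>t=1..s. max 0 (\<pi> (\<sigma> t) - dotp m ?p' (a (\<sigma> t))))"
    using otp_dual_optimal_price[OF opt, of ?p'] unfolding sum_fun_upd_add[OF i(1)] by fastforce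
  ultimately have "h * ?B \<le> h * (\<Sum>t=1..s. ?c t)"
    by (simp only: distrib_left mult.commute[of h ?B] mult_minus_right)
  then have "?B \<le> (\<Sum>t=1..s. ?c t)" using h(1) by (simp only: mult_le_cancel_left_pos)
  also have "\<dots> \<le> (\<Sum>t=1..s. a (\<sigma> t) i * primal_of m \<pi> a p (\<sigma> t) + of_bool (\<pi> (\<sigma> t) = dotp m p (a (\<sigma> t))))"
    using a by (intro sum_mono) (auto simp: primal_of_def)
  also have "\<dots> = (\<Sum>t=1..s. a (\<sigma> t) i * primal_of m \<pi> a p (\<sigma> t))
      + real (card {t\<in>{1..s}. \<pi> (\<sigma> t) = dotp m p (a (\<sigma> t))})"
    by (simp add: sum.distrib sum_of_bool_eq Int_def)
  also have "card {t\<in>{1..s}. \<pi> (\<sigma> t) = dotp m p (a (\<sigma> t))} \<le> m"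
  proof -
    have "card {t\<in>{1..s}. \<pi> (\<sigma> t) = dotp m p (a (\<sigma> t))}
        = card (\<sigma> ` {t\<in>{1..s}. \<pi> (\<sigma> t) = dotp m p (a (\<sigma> t))})"
      by (rule card_image[symmetric]) (auto intro: inj_on_subset[OF inj])
    also have "\<dots> \<le> card {t\<in>{1..n}. \<pi> t = dotp m p (a t)}"
    proof (rule card_mono)
      show "\<sigma> ` {t\<in>{1..s}. \<pi> (\<sigma> t) = dotp m p (a (\<sigma> t))} \<subseteq> {t\<in>{1..n}. \<pi> t = dotp m p (a t)}"
        using range by blast
    qed simp
    also have "\<dots> \<le> m" using gp by (simp add: general_position_def)
    finally show ?thesis .
  qed
  finally show ?thesis by simp
qed

section \<open>Rounding the columns\<close>

lemma abs_le_linf: "i \<in> {1..m} \<Longrightarrow> \<bar>v i\<bar> \<le> linf m v"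
  unfolding linf_def by (intro Max_ge) auto

lemma linf_le: "0 < m \<Longrightarrow> (\<And>i. i \<in> {1..m} \<Longrightarrow> \<bar>v i\<bar> \<le> c) \<Longrightarrow> linf m v \<le> c"
  unfolding linf_def by (subst Max_le_iff) auto

lemma linf_attained: "0 < m \<Longrightarrow> \<exists>i\<in>{1..m}. \<bar>v i\<bar> = linf m v"
proof -
  assume "0 < m"
  then have "linf m v \<in> (\<lambda>i. \<bar>v i\<bar>) ` {1..m}" unfolding linf_def by (intro Max_in) auto
  then show ?thesis by auto
qed

lemma gridD:
  assumes "v \<in> grid m \<delta>" "0 < \<delta>" "0 < m"
  shows "i \<in> {1..m} \<Longrightarrow> 0 \<le> v i" "i \<in> {1..m} \<Longrightarrow> v i \<le> 1" "\<exists>i\<in>{1..m}. v i = 1"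
proof -
  have v: "v i \<in> {real k * \<delta> |k. real k * \<delta> \<le> 1}" if "i \<in> {1..m}" for i
    using assms(1) that unfolding grid_def by (blast dest: PiE_mem)
  show 0: "0 \<le> v i" if "i \<in> {1..m}" for i
    using v[OF that] assms(2) by auto
  show "v i \<le> 1" if "i \<in> {1..m}" for i
    using v[OF that] by auto
  obtain i where "i \<in> {1..m}" "\<bar>v i\<bar> = linf m v" using linf_attained assms(3) by blast
  then show "\<exists>i\<in>{1..m}. v i = 1" using assms(1) 0 by (auto simp: grid_def)
qed

lemma finite_card_grid:
  assumes "0 < \<delta>" "1 / \<delta> = real N"
  shows "finite (grid m \<delta>)" "card (grid m \<delta>) \<le> (N + 1) ^ m"
proof -
  let ?S = "{real k * \<delta> | k. real k * \<delta> \<le> 1}"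
  have "?S \<subseteq> (\<lambda>k. real k * \<delta>) ` {0..N}"
  proof
    fix x assume "x \<in> ?S"
    then obtain k where k: "x = real k * \<delta>" "real k * \<delta> \<le> 1" by blast
    then have "real k \<le> real N" using assms by (simp add: field_simps flip: assms(2))
    then show "x \<in> (\<lambda>k. real k * \<delta>) ` {0..N}" using k by auto
  qed
  then have S: "finite ?S" "card ?S \<le> N + 1"
    using finite_subset[of ?S] surj_card_le[of "{0..N}" ?S "\<lambda>k. real k * \<delta>"] by auto
  have sub: "grid m \<delta> \<subseteq> {1..m} \<rightarrow>\<^sub>E ?S" by (auto simp: grid_def)
  have fin: "finite ({1..m} \<rightarrow>\<^sub>E ?S)" by (rule finite_PiE) (use S in auto)
  show "finite (grid m \<delta>)" using sub fin by (rule finite_subset)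
  have "card (grid m \<delta>) \<le> card ({1..m} \<rightarrow>\<^sub>E ?S)" using fin sub by (rule card_mono)
  also have "\<dots> = card ?S ^ m" by (simp add: card_PiE)
  also have "\<dots> \<le> (N + 1) ^ m" using S(2) by (rule power_mono) simp
  finally show "card (grid m \<delta>) \<le> (N + 1) ^ m" .
qed

text \<open>Rounding every coordinate of \<open>u\<close> down to a multiple of \<delta> gives a
  competitor \<open>w\<close> in the grid within distance \<delta>, and the closest grid vector is
  no farther away.\<close>

lemma closest_in_grid_dist:
  assumes d: "0 < \<delta>" "1 / \<delta> = real N" and m: "0 < m" and v: "closest_in_grid m \<delta> u v"
    and u: "\<And>i. i \<in> {1..m} \<Longrightarrow> 0 \<le> u i \<and> u i \<le> 1" "\<exists>i\<in>{1..m}. u i = 1" and i: "i \<in> {1..m}"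
  shows "\<bar>v i - u i\<bar> \<le> \<delta>"
proof -
  have dN: "real N * \<delta> = 1" using d by (simp add: field_simps flip: d(2))
  define w where "w = (\<lambda>i\<in>{1..m}. real (nat \<lfloor>u i / \<delta>\<rfloor>) * \<delta>)"
  have wu: "w i \<le> u i" "u i - \<delta> \<le> w i" "0 \<le> w i" if "i \<in> {1..m}" for i
  proof -
    have "0 \<le> u i / \<delta>" using u(1)[OF that] d by simp
    then have "real (nat \<lfloor>u i / \<delta>\<rfloor>) \<le> u i / \<delta>" "u i / \<delta> - 1 \<le> real (nat \<lfloor>u i / \<delta>\<rfloor>)"
      by linarith+
    then have "real (nat \<lfloor>u i / \<delta>\<rfloor>) * \<delta> \<le> u i / \<delta> * \<delta>"
      "(u i / \<delta> - 1) * \<delta> \<le> real (nat \<lfloor>u i / \<delta>\<rfloor>) * \<delta>"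
      using d by (intro mult_right_mono; simp)+
    then show "w i \<le> u i" "u i - \<delta> \<le> w i" "0 \<le> w i"
      using d that by (auto simp: w_def algebra_simps)
  qed
  have "w \<in> grid m \<delta>"
    unfolding grid_def
  proof (intro CollectI conjI)
    have "w i \<in> {real k * \<delta> |k. real k * \<delta> \<le> 1}" if i: "i \<in> {1..m}" for i
    proof -
      have "w i \<le> 1" using wu(1)[OF i] u(1)[OF i] by linarith
      then show ?thesis using i by (auto simp: w_def)
    qed
    then show "w \<in> {1..m} \<rightarrow>\<^sub>E {real k * \<delta> |k. real k * \<delta> \<le> 1}" by (intro PiE_I) (auto simp: w_def)
  next
    obtain j where j: "j \<in> {1..m}" "u j = 1" using u(2) by blast
    \<comment> \<open>As 1 / \<delta> is an integer, rounding down leaves this coordinate at 1, so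
      \<open>w\<close> has norm 1.\<close>
    have "w j = 1" using j d(2) dN by (simp add: w_def)
    moreover have "linf m w \<le> 1"
    proof (rule linf_le[OF m])
      fix i assume "i \<in> {1..m}"
      then show "\<bar>w i\<bar> \<le> 1" using wu(1,3)[of i] u(1)[of i] by linarith
    qed
    ultimately show "linf m w = 1" using abs_le_linf[OF j(1), of w] by simp
  qed
  then have "linf m (\<lambda>i. v i - u i) \<le> linf m (\<lambda>i. w i - u i)"
    using v by (simp add: closest_in_grid_def)
  also have "\<dots> \<le> \<delta>"
  proof (rule linf_le[OF m])
    fix i assume "i \<in> {1..m}"
    then show "\<bar>w i - u i\<bar> \<le> \<delta>" using wu(1,2)[of i] d by linarith
  qed
  finally show ?thesis using abs_le_linf[OF i, of "\<lambda>i. v i - u i"] by simp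
qed

section \<open>The LP with rounded columns\<close>

locale rounded_lp =
  fixes m n :: nat and B \<epsilon> :: real and \<pi> :: "nat \<Rightarrow> real" and a q :: "nat \<Rightarrow> nat \<Rightarrow> real"
  assumes lp: "packing_lp m n B \<pi> a"
    and eps: "0 < \<epsilon>" "\<epsilon> < 1 / 100"
    and integral: "(real m + 1) / \<epsilon> \<in> \<int>"
    and rnd: "rounding m n \<epsilon> a q"
begin

definition "\<delta> = \<epsilon> / (real m + 1)"
definition "N = nat \<lfloor>(real m + 1) / \<epsilon>\<rfloor>"
definition "w t = linf m (a t)"
definition "c = rounded m a q"

lemma m: "0 < m" and n: "0 < n" and B: "0 < B"
  and \<pi>_nonneg: "\<And>t. t \<in> {1..n} \<Longrightarrow> 0 \<le> \<pi> t"
  and a_bounds: "\<And>t i. t \<in> {1..n} \<Longrightarrow> i \<in> {1..m} \<Longrightarrow> 0 \<le> a t i \<and> a t i \<le> 1"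
  using lp by (auto simp: packing_lp_def)

lemma \<delta>_pos: "0 < \<delta>" and \<delta>_N: "1 / \<delta> = real N"
proof -
  show "0 < \<delta>" using eps by (simp add: \<delta>_def)
  have "0 \<le> (real m + 1) / \<epsilon>" using eps by simp
  then show "1 / \<delta> = real N"
    using integral by (auto simp: \<delta>_def N_def elim!: Ints_cases)
qed

lemma c_eq: "c t i = w t * q t i" by (simp add: c_def w_def rounded_def)

lemma w_bounds:
  assumes t: "t \<in> {1..n}"
  shows "0 < w t" "w t \<le> 1"
proof -
  obtain i where "i \<in> {1..m}" "a t i \<noteq> 0" using lp t unfolding packing_lp_def by blast
  then show "0 < w t" using abs_le_linf[of i m "a t"] by (simp add: w_def)
  show "w t \<le> 1" unfolding w_def using a_bounds[OF t] by (intro linf_le m) auto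
qed

lemma a_le_w: "t \<in> {1..n} \<Longrightarrow> i \<in> {1..m} \<Longrightarrow> a t i \<le> w t"
  using abs_le_linf[of i m "a t"] by (simp add: w_def)

lemma w_attained: "t \<in> {1..n} \<Longrightarrow> \<exists>i\<in>{1..m}. a t i = w t"
  using linf_attained[OF m, of "a t"] a_bounds unfolding w_def by force

lemma q_closest: "t \<in> {1..n} \<Longrightarrow> closest_in_grid m \<delta> (\<lambda>i. a t i / w t) (q t)"
  using rnd by (simp add: rounding_def \<delta>_def w_def)

lemma q_grid: "t \<in> {1..n} \<Longrightarrow> q t \<in> grid m \<delta>"
  using q_closest by (simp add: closest_in_grid_def)

lemmas q_bounds = gridD[OF q_grid \<delta>_pos m]

lemma c_bounds:
  assumes "t \<in> {1..n}" "i \<in> {1..m}"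
  shows "0 \<le> c t i" "c t i \<le> 1"
  using w_bounds[OF assms(1)] q_bounds(1,2)[OF assms] by (auto simp: c_eq mult_le_one)

lemma c_near_a:
  assumes t: "t \<in> {1..n}" and i: "i \<in> {1..m}"
  shows "\<bar>c t i - a t i\<bar> \<le> \<delta> * w t"
proof -
  have "\<bar>q t i - a t i / w t\<bar> \<le> \<delta>"
  proof (rule closest_in_grid_dist[OF \<delta>_pos \<delta>_N m q_closest[OF t] _ _ i])
    show "0 \<le> a t i / w t \<and> a t i / w t \<le> 1" if "i \<in> {1..m}" for i
      using a_bounds[OF t that] a_le_w[OF t that] w_bounds[OF t] by simp
    show "\<exists>i\<in>{1..m}. a t i / w t = 1" using w_attained[OF t] w_bounds(1)[OF t] by (metis divide_self less_irrefl)
  qed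
  then have "w t * \<bar>q t i - a t i / w t\<bar> \<le> w t * \<delta>" using w_bounds[OF t] by (intro mult_left_mono) auto
  also have "w t * \<bar>q t i - a t i / w t\<bar> = \<bar>w t * (q t i - a t i / w t)\<bar>"
    using w_bounds[OF t] by (simp add: abs_mult)
  also have "w t * (q t i - a t i / w t) = c t i - a t i"
    using w_bounds[OF t] by (simp add: c_eq algebra_simps)
  finally show ?thesis by (simp add: mult.commute)
qed

text \<open>Before and after rounding, some coordinate of a column equals its norm. Hence bounds on
  the m resources together bound the total weight of a solution.\<close>

lemma w_le_sum:
  assumes t: "t \<in> {1..n}"
  shows "w t \<le> (\<Sum>i=1..m. c t i)" "w t \<le> (\<Sum>i=1..m. a t i)"
proof -
  obtain i where "i \<in> {1..m}" "q t i = 1" using q_bounds(3)[OF t] by blast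
  then have "w t = c t i" by (simp add: c_eq)
  also have "c t i \<le> (\<Sum>i=1..m. c t i)"
    using \<open>i \<in> {1..m}\<close> c_bounds[OF t] by (intro member_le_sum) auto
  finally show "w t \<le> (\<Sum>i=1..m. c t i)" .
  obtain j where "j \<in> {1..m}" "a t j = w t" using w_attained[OF t] by blast
  then show "w t \<le> (\<Sum>i=1..m. a t i)"
    using a_bounds[OF t] member_le_sum[of j "{1..m}" "a t"] by auto
qed

text \<open>Stated for arbitrary \<open>u\<close> and \<open>v\<close> because rounding is used in
  both directions. The error in one resource is at most \<delta> times the total weight, the total
  weight is at most m b, and \<delta> m \<le> \<epsilon> by the choice of the grid width.\<close>

lemma consumption_transfer:
  assumes x: "\<And>t. t \<in> {1..n} \<Longrightarrow> 0 \<le> x t" and i: "i \<in> {1..m}"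
    and use: "\<And>i. i \<in> {1..m} \<Longrightarrow> (\<Sum>t=1..n. u t i * x t) \<le> b"
    and uv: "\<And>t. t \<in> {1..n} \<Longrightarrow> v t i \<le> u t i + \<delta> * w t"
    and wu: "\<And>t. t \<in> {1..n} \<Longrightarrow> w t \<le> (\<Sum>i=1..m. u t i)" and b: "0 \<le> b"
  shows "(\<Sum>t=1..n. v t i * x t) \<le> (1 + \<epsilon>) * b"
proof -
  have "(\<Sum>t=1..n. w t * x t) \<le> (\<Sum>t=1..n. (\<Sum>i=1..m. u t i) * x t)"
    using x wu by (intro sum_mono mult_right_mono) auto
  also have "\<dots> = (\<Sum>i=1..m. \<Sum>t=1..n. u t i * x t)"
    by (simp add: sum_distrib_right) (rule sum.swap)
  also have "\<dots> \<le> (\<Sum>i=1..m. b)" by (intro sum_mono use)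
  finally have W: "(\<Sum>t=1..n. w t * x t) \<le> real m * b" by simp
  have "(\<Sum>t=1..n. v t i * x t) \<le> (\<Sum>t=1..n. (u t i + \<delta> * w t) * x t)"
    using x uv by (intro sum_mono mult_right_mono) auto
  also have "\<dots> = (\<Sum>t=1..n. u t i * x t) + \<delta> * (\<Sum>t=1..n. w t * x t)"
    by (simp add: distrib_right sum.distrib sum_distrib_left mult.assoc)
  also have "\<dots> \<le> b + \<delta> * (real m * b)"
    using use[OF i] W \<delta>_pos by (intro add_mono mult_left_mono) auto
  also have "\<dots> = b + (\<delta> * real m) * b" by simp
  also have "\<dots> \<le> b + \<epsilon> * b"
    using b eps by (intro add_left_mono mult_right_mono) (auto simp: \<delta>_def field_simps)
  finally show ?thesis by (simp add: algebra_simps)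
qed

text \<open>The reduced right-hand side pays for the rounding, as (1 + \<epsilon>) (1 - \<epsilon>)
  \<le> 1.\<close>

lemma feasible_of_rounded:
  assumes x: "\<And>t. t \<in> {1..n} \<Longrightarrow> 0 \<le> x t \<and> x t \<le> 1"
    and use: "\<And>i. i \<in> {1..m} \<Longrightarrow> (\<Sum>t=1..n. c t i * x t) \<le> (1 - \<epsilon>) * B"
  shows "lp_feasible m n B a x"
proof -
  have "(\<Sum>t=1..n. a t i * x t) \<le> B" if i: "i \<in> {1..m}" for i
  proof -
    have "(\<Sum>t=1..n. a t i * x t) \<le> (1 + \<epsilon>) * ((1 - \<epsilon>) * B)"
    proof (rule consumption_transfer[OF _ i use])
      show "a t i \<le> c t i + \<delta> * w t" if "t \<in> {1..n}" for t using c_near_a[OF that i] by linarith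
    qed (use x w_le_sum eps B in auto)
    also have "\<dots> \<le> B" using eps B by (simp add: algebra_simps)
    finally show ?thesis .
  qed
  then show ?thesis using x by (simp add: lp_feasible_def)
qed

text \<open>A solution of the original LP becomes feasible when scaled by (1 - \<epsilon>) / (1 +
  \<epsilon>): the numerator reflects the reduced right-hand side and the denominator the
  rounding.\<close>

lemma rounded_opt_ge: "(1 - 2 * \<epsilon>) * lp_opt m n B \<pi> a \<le> lp_opt m n ((1 - \<epsilon>) * B) \<pi> c"
proof -
  let ?r = "(1 - \<epsilon>) / (1 + \<epsilon>)" and ?O = "lp_opt m n ((1 - \<epsilon>) * B) \<pi> c"
  have r: "0 < ?r" "?r \<le> 1" "1 - 2 * \<epsilon> \<le> ?r" using eps by (auto simp: field_simps)
  have "lp_opt m n B \<pi> a \<le> ?O / ?r"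
  proof (rule lp_opt_le)
    show "0 \<le> B" using B by simp
    fix x assume x: "lp_feasible m n B a x"
    have "lp_feasible m n ((1 - \<epsilon>) * B) c (\<lambda>t. ?r * x t)"
      unfolding lp_feasible_def
    proof (intro conjI ballI)
      fix t assume "t \<in> {1..n}"
      then have "0 \<le> x t" "x t \<le> 1" using x by (auto simp: lp_feasible_def)
      then show "0 \<le> ?r * x t" "?r * x t \<le> 1"
        using r(1,2) by (auto simp only: intro: mult_nonneg_nonneg less_imp_le mult_le_one)
    next
      fix i assume i: "i \<in> {1..m}"
      have "(\<Sum>t=1..n. c t i * x t) \<le> (1 + \<epsilon>) * B"
      proof (rule consumption_transfer[OF _ i])
        show "c t i \<le> a t i + \<delta> * w t" if "t \<in> {1..n}" for t using c_near_a[OF that i] by linarith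
      qed (use x w_le_sum B in \<open>auto simp: lp_feasible_def\<close>)
      then have "?r * (\<Sum>t=1..n. c t i * x t) \<le> ?r * ((1 + \<epsilon>) * B)" using r(1) by (intro mult_left_mono) auto
      then show "(\<Sum>t=1..n. c t i * (?r * x t)) \<le> (1 - \<epsilon>) * B"
        using eps by (simp add: sum_distrib_left mult_ac)
    qed
    then have "lp_value n \<pi> (\<lambda>t. ?r * x t) \<le> ?O" by (intro lp_value_le_opt \<pi>_nonneg)
    moreover have "lp_value n \<pi> (\<lambda>t. ?r * x t) = ?r * lp_value n \<pi> x"
      unfolding lp_value_def sum_distrib_left by (intro sum.cong) auto
    ultimately show "lp_value n \<pi> x \<le> ?O / ?r" using r(1) by (simp only: pos_le_divide_eq mult.commute)
  qed
  then have "?r * lp_opt m n B \<pi> a \<le> ?O" using r(1) by (simp only: pos_le_divide_eq mult.commute)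
  moreover have "(1 - 2 * \<epsilon>) * lp_opt m n B \<pi> a \<le> ?r * lp_opt m n B \<pi> a"
    using r(3) B \<pi>_nonneg by (intro mult_right_mono lp_opt_nonneg) auto
  ultimately show ?thesis by linarith
qed

end

section \<open>Uniform concentration of the consumption\<close>

context rounded_lp
begin

definition "sel p = {t\<in>{1..n}. \<pi> t > dotp m p (c t)}"
definition "usage X i = (\<Sum>t=1..n. c t i * of_bool (t \<in> X))"
definition "load X v = (\<Sum>t | t \<in> {1..n} \<and> q t = v. w t * of_bool (t \<in> X))"

lemma primal_of_sel: "t \<in> {1..n} \<Longrightarrow> primal_of m \<pi> c p t = of_bool (t \<in> sel p)"
  by (simp add: primal_of_def sel_def)

lemma usage_sel: "usage (sel p) i = (\<Sum>t=1..n. c t i * primal_of m \<pi> c p t)"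
  unfolding usage_def by (intro sum.cong) (simp_all add: primal_of_sel)

lemma dotp_c: "dotp m p (c t) = w t * dotp m p (q t)"
  by (simp add: dotp_def c_eq sum_distrib_left mult_ac)

lemma finite_grid_\<delta>: "finite (grid m \<delta>)"
  by (rule finite_card_grid(1)[OF \<delta>_pos \<delta>_N])

text \<open>For each resource the coefficients are nonnegative, so bounds on the load of every
  direction add up to bounds on consumption.\<close>

lemma usage_load: "usage X i = (\<Sum>v\<in>grid m \<delta>. v i * load X v)"
proof -
  have "(\<Sum>v\<in>grid m \<delta>. v i * load X v)
      = (\<Sum>v\<in>grid m \<delta>. \<Sum>t | t \<in> {1..n} \<and> q t = v. c t i * of_bool (t \<in> X))"
    unfolding load_def sum_distrib_left by (intro sum.cong refl) (auto simp: c_eq)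
  also have "\<dots> = usage X i"
    unfolding usage_def using finite_grid_\<delta> q_grid by (intro sum.group) auto
  finally show ?thesis ..
qed

lemma load_mono: "X \<subseteq> Y \<Longrightarrow> load X v \<le> load Y v"
  unfolding load_def using w_bounds(1) by (intro sum_mono) (fastforce simp: of_bool_def)

lemma load_nonneg: "0 \<le> load X v"
  unfolding load_def using w_bounds(1) by (intro sum_nonneg) (fastforce simp: of_bool_def)

lemma load_cong: "X \<inter> {t. q t = v} = Y \<inter> {t. q t = v} \<Longrightarrow> load X v = load Y v"
  unfolding load_def by (intro sum.cong refl) (auto simp: of_bool_def)

lemma usage_mono: "i \<in> {1..m} \<Longrightarrow> X \<subseteq> Y \<Longrightarrow> usage X i \<le> usage Y i"
  unfolding usage_def using c_bounds(1) by (intro sum_mono) (auto simp: of_bool_def)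

section \<open>Threshold selections, load levels and brackets\<close>

definition "level_sel z v = {t\<in>{1..n}. q t = v \<and> \<pi> t > w t * z}"

text \<open>Columns of one direction compare their density \<pi> / w with the same scalar, so the
  price acts on them only through this scalar.\<close>

lemma sel_direction: "sel p \<inter> {t. q t = v} = level_sel (dotp m p v) v"
  by (auto simp: sel_def level_sel_def dotp_c)

lemma level_sel_antimono: "z \<le> z' \<Longrightarrow> level_sel z' v \<subseteq> level_sel z v"
proof
  fix t assume z: "z \<le> z'" and t: "t \<in> level_sel z' v"
  then have "w t * z \<le> w t * z'" using w_bounds(1) by (auto simp: level_sel_def intro!: mult_left_mono)
  then show "t \<in> level_sel z v" using t by (auto simp: level_sel_def)
qed

lemma load_level_sel: "load (sel p) v = load (level_sel (dotp m p v) v) v"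
  by (rule load_cong) (auto simp flip: sel_direction)

text \<open>Tells which multiples of \<eta> the load of each direction exceeds. Levels stop at
  \<open>K\<close>, which is later chosen with K \<eta> \<ge> b: beyond that, overload is
  certain.\<close>

definition "pattern \<eta> K p = {(v, k) \<in> grid m \<delta> \<times> {..K}. load (sel p) v > real k * \<eta>}"

text \<open>The load falls as the threshold of its direction rises, so each pair of direction and
  level is a lower half line in a linear functional of the price. The ground set does not grow with
  n.\<close>

lemma card_patterns: "card (range (pattern \<eta> K)) \<le> (card (grid m \<delta>) * (K + 1) + 1) ^ m"
proof -
  let ?G = "grid m \<delta> \<times> {..K}"
  have "pattern \<eta> K = (\<lambda>p. {x\<in>?G. load (level_sel (dotp m p (fst x)) (fst x)) (fst x) > real (snd x) * \<eta>})"
    by (auto simp: pattern_def load_level_sel fun_eq_iff)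
  moreover have "card (range (\<lambda>p. {x\<in>?G. load (level_sel (dotp m p (fst x)) (fst x)) (fst x) > real (snd x) * \<eta>}))
      \<le> (card ?G + 1) ^ m"
  proof (rule card_halfline_patterns_le[where f = fst and R = "\<lambda>x z. load (level_sel z (fst x)) (fst x) > real (snd x) * \<eta>"])
    fix x :: "(nat \<Rightarrow> real) \<times> nat" and y z :: real
    assume "load (level_sel z (fst x)) (fst x) > real (snd x) * \<eta>" "y \<le> z"
    then show "load (level_sel y (fst x)) (fst x) > real (snd x) * \<eta>"
      using load_mono[OF level_sel_antimono[OF \<open>y \<le> z\<close>, of "fst x"], of "fst x"] by linarith
  qed (simp add: finite_grid_\<delta>)
  ultimately show ?thesis by (simp add: card_cartesian_product)
qed

text \<open>These sets depend on the pattern alone and not on the arrival order, so tail bounds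
  apply to them although the price comes from the sample.\<close>

definition "lower \<eta> K P = \<Inter> {sel p | p. pattern \<eta> K p = P}"
definition "upper \<eta> K P = \<Union> {sel p | p. pattern \<eta> K p = P}"

text \<open>Within one direction the selected sets form a chain, so the intersection and the union over a
  pattern class are themselves selected sets of the class.\<close>

lemma lower_upper_direction:
  assumes "pattern \<eta> K p0 = P"
  shows "\<exists>p. pattern \<eta> K p = P \<and> lower \<eta> K P \<inter> {t. q t = v} = sel p \<inter> {t. q t = v}"
    and "\<exists>p. pattern \<eta> K p = P \<and> upper \<eta> K P \<inter> {t. q t = v} = sel p \<inter> {t. q t = v}"
proof -
  let ?s = "\<lambda>p. sel p \<inter> {t. q t = v}"
  have fin: "finite (?s p)" for p by (simp add: sel_def)
  have chain: "?s p \<subseteq> ?s p' \<or> ?s p' \<subseteq> ?s p" for p p'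
    unfolding sel_direction using level_sel_antimono linear by metis
  have le: "?s p \<subseteq> ?s p'" if "card (?s p) \<le> card (?s p')" for p p'
    using chain[of p p'] card_seteq[OF fin, of "?s p'" p] that by blast
  obtain p where p: "pattern \<eta> K p = P" "\<And>p'. pattern \<eta> K p' = P \<Longrightarrow> card (?s p) \<le> card (?s p')"
    using ex_has_least_nat[of "\<lambda>p. pattern \<eta> K p = P" p0 "\<lambda>p. card (?s p)"] assms by blast
  then show "\<exists>p. pattern \<eta> K p = P \<and> lower \<eta> K P \<inter> {t. q t = v} = ?s p"
    using le unfolding lower_def by (intro exI[of _ p]) blast
  have "card (?s p) < Suc n" for p
  proof -
    have "?s p \<subseteq> {1..n}" by (auto simp: sel_def)
    then have "card (?s p) \<le> card {1..n}" by (intro card_mono) auto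
    then show ?thesis by simp
  qed
  then obtain p where p: "pattern \<eta> K p = P" "\<And>p'. pattern \<eta> K p' = P \<Longrightarrow> card (?s p') \<le> card (?s p)"
    using ex_has_greatest_nat[of "\<lambda>p. pattern \<eta> K p = P" p0 "\<lambda>p. card (?s p)" "Suc n"] assms by blast
  then show "\<exists>p. pattern \<eta> K p = P \<and> upper \<eta> K P \<inter> {t. q t = v} = ?s p"
    using le unfolding upper_def by (intro exI[of _ p]) blast
qed

lemma pattern_lower_upper:
  assumes P: "pattern \<eta> K p = P" and v: "v \<in> grid m \<delta>" and k: "k \<le> K"
  shows "(v, k) \<in> P \<longleftrightarrow> load (lower \<eta> K P) v > real k * \<eta>"
    and "(v, k) \<in> P \<longleftrightarrow> load (upper \<eta> K P) v > real k * \<eta>"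
proof -
  have pat: "(v, k) \<in> P \<longleftrightarrow> load (sel p') v > real k * \<eta>" if "pattern \<eta> K p' = P" for p'
    using v k that by (auto simp: pattern_def)
  obtain p1 where p1: "pattern \<eta> K p1 = P" "lower \<eta> K P \<inter> {t. q t = v} = sel p1 \<inter> {t. q t = v}"
    using lower_upper_direction(1)[OF P] by blast
  show "(v, k) \<in> P \<longleftrightarrow> load (lower \<eta> K P) v > real k * \<eta>"
    unfolding load_cong[OF p1(2)] by (rule pat[OF p1(1)])
  obtain p2 where p2: "pattern \<eta> K p2 = P" "upper \<eta> K P \<inter> {t. q t = v} = sel p2 \<inter> {t. q t = v}"
    using lower_upper_direction(2)[OF P] by blast
  show "(v, k) \<in> P \<longleftrightarrow> load (upper \<eta> K P) v > real k * \<eta>"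
    unfolding load_cong[OF p2(2)] by (rule pat[OF p2(1)])
qed

lemma load_gap:
  assumes P: "pattern \<eta> K p = P" and v: "v \<in> grid m \<delta>" and \<eta>: "0 \<le> \<eta>" and K: "(v, K) \<notin> P"
  shows "load (upper \<eta> K P) v \<le> load (lower \<eta> K P) v + \<eta>"
proof -
  \<comment> \<open>At the first level that is not exceeded, the upper set has load at most k
    \<eta>, while the lower set still exceeds the level before it.\<close>
  define k where "k = (LEAST k. (v, k) \<notin> P)"
  have k: "(v, k) \<notin> P" "k \<le> K"
    unfolding k_def using K by (rule LeastI[of "\<lambda>k. (v, k) \<notin> P"], rule Least_le[of "\<lambda>k. (v, k) \<notin> P"])
  have up: "load (upper \<eta> K P) v \<le> real k * \<eta>"
    using pattern_lower_upper(2)[OF P v k(2)] k(1) by auto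
  show ?thesis
  proof (cases k)
    case 0
    then show ?thesis using up \<eta> load_nonneg[of "lower \<eta> K P" v] by simp
  next
    case (Suc k')
    then have "(v, k') \<in> P" using not_less_Least[of k' "\<lambda>k. (v, k) \<notin> P"] by (auto simp: k_def)
    then have "load (lower \<eta> K P) v > real k' * \<eta>"
      using pattern_lower_upper(1)[OF P v, of k'] k(2) Suc by simp
    then show ?thesis using up Suc by (simp add: algebra_simps)
  qed
qed

text \<open>The alternative is forced by the cap on levels: beyond it the bracket of a selection may
  be wide, but then already its lower set overloads some resource.\<close>

definition "bracketing b \<gamma> \<C> \<longleftrightarrow> finite \<C> \<and> (\<forall>p. \<exists>L\<in>\<C>. \<exists>U\<in>\<C>. L \<subseteq> sel p \<and> sel p \<subseteq> U \<and>
   ((\<exists>i\<in>{1..m}. usage L i > b) \<or> (\<forall>i\<in>{1..m}. usage U i \<le> usage L i + \<gamma> / 8 * b)))"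

lemma ex_bracketing:
  assumes b: "0 < b" and \<gamma>: "0 < \<gamma>"
    and K: "8 * real (card (grid m \<delta>)) / \<gamma> \<le> real K"
  shows "\<exists>\<C>. bracketing b \<gamma> \<C> \<and> card \<C> \<le> 2 * (card (grid m \<delta>) * (K + 1) + 1) ^ m"
proof -
  let ?Q = "grid m \<delta>"
  \<comment> \<open>Every direction may contribute a gap of \<eta>, which sums to \<gamma> b /
    8.\<close>
  define \<eta> where "\<eta> = \<gamma> * b / (8 * real (card ?Q))"
  define \<C> where "\<C> = lower \<eta> K ` range (pattern \<eta> K) \<union> upper \<eta> K ` range (pattern \<eta> K)"
  have "?Q \<noteq> {}" using q_grid[of 1] n by auto
  then have Q: "0 < card ?Q" using finite_grid_\<delta> by (simp add: card_gt_0_iff)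
  have \<eta>: "0 < \<eta>" using b \<gamma> Q by (simp add: \<eta>_def)
  have K\<eta>: "b \<le> real K * \<eta>"
  proof -
    have "b = 8 * real (card ?Q) / \<gamma> * \<eta>" using Q \<gamma> by (simp add: \<eta>_def)
    also have "\<dots> \<le> real K * \<eta>" using K \<eta> by (intro mult_right_mono) auto
    finally show ?thesis .
  qed
  have "range (pattern \<eta> K) \<subseteq> Pow (?Q \<times> {..K})" by (auto simp: pattern_def)
  then have fin: "finite (range (pattern \<eta> K))"
    by (rule finite_subset) (simp add: finite_grid_\<delta>)
  have "card \<C> \<le> card (lower \<eta> K ` range (pattern \<eta> K)) + card (upper \<eta> K ` range (pattern \<eta> K))"
    unfolding \<C>_def by (rule card_Un_le)
  also have "\<dots> \<le> card (range (pattern \<eta> K)) + card (range (pattern \<eta> K))"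
    using fin by (intro add_mono card_image_le)
  also have "\<dots> \<le> 2 * (card ?Q * (K + 1) + 1) ^ m" using card_patterns[of \<eta> K] by simp
  finally have "card \<C> \<le> 2 * (card ?Q * (K + 1) + 1) ^ m" .
  moreover have "bracketing b \<gamma> \<C>"
    unfolding bracketing_def
  proof (intro conjI allI)
    show "finite \<C>" using fin by (simp add: \<C>_def)
    fix p
    let ?P = "pattern \<eta> K p"
    let ?L = "lower \<eta> K ?P" and ?U = "upper \<eta> K ?P"
    have "(\<exists>i\<in>{1..m}. usage ?L i > b) \<or> (\<forall>i\<in>{1..m}. usage ?U i \<le> usage ?L i + \<gamma> / 8 * b)"
    proof (cases "\<exists>v\<in>?Q. (v, K) \<in> ?P")
      case True
      then obtain v where v: "v \<in> ?Q" "(v, K) \<in> ?P" by blast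
      then have "b < load ?L v" using pattern_lower_upper(1)[OF refl[of ?P] v(1), of K] K\<eta> by simp
      \<comment> \<open>Grid vectors have norm 1, so the load of a direction is charged in full to
        some resource.\<close>
      also obtain i where i: "i \<in> {1..m}" "v i = 1" using gridD(3)[OF v(1) \<delta>_pos m] by blast
      have "load ?L v = v i * load ?L v" using i by simp
      also have "\<dots> \<le> usage ?L i"
        unfolding usage_load using v finite_grid_\<delta> gridD(1)[OF _ \<delta>_pos m i(1)] load_nonneg
        by (intro member_le_sum) auto
      finally show ?thesis using i by blast
    next
      case False
      have "usage ?U i \<le> usage ?L i + \<gamma> / 8 * b" if i: "i \<in> {1..m}" for i
      proof -
        have "usage ?U i \<le> (\<Sum>v\<in>?Q. v i * load ?L v + \<eta>)"
          unfolding usage_load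
        proof (rule sum_mono)
          fix v assume v: "v \<in> ?Q"
          have vi: "0 \<le> v i" "v i \<le> 1" using gridD(1,2)[OF v \<delta>_pos m i] by auto
          have "v i * load ?U v \<le> v i * (load ?L v + \<eta>)"
            using load_gap[OF refl[of ?P] v] False v \<eta> vi by (intro mult_left_mono) auto
          also have "\<dots> \<le> v i * load ?L v + \<eta>"
            using vi \<eta> mult_right_mono[of "v i" 1 \<eta>] by (simp add: distrib_left)
          finally show "v i * load ?U v \<le> v i * load ?L v + \<eta>" .
        qed
        also have "\<dots> = usage ?L i + real (card ?Q) * \<eta>" by (simp add: usage_load sum.distrib)
        also have "real (card ?Q) * \<eta> = \<gamma> / 8 * b" using Q by (simp add: \<eta>_def)
        finally show ?thesis .
      qed
      then show ?thesis by blast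
    qed
    moreover have "?L \<subseteq> sel p" "sel p \<subseteq> ?U" by (auto simp: lower_def upper_def)
    moreover have "?L \<in> \<C>" "?U \<in> \<C>" by (auto simp: \<C>_def)
    ultimately show "\<exists>L\<in>\<C>. \<exists>U\<in>\<C>. L \<subseteq> sel p \<and> sel p \<subseteq> U \<and>
        ((\<exists>i\<in>{1..m}. usage L i > b) \<or> (\<forall>i\<in>{1..m}. usage U i \<le> usage L i + \<gamma> / 8 * b))" by blast
  qed
  ultimately show ?thesis by blast
qed

section \<open>Typical blocks of arrivals\<close>

definition "sample_usage J \<sigma> X i = (\<Sum>k\<in>J. c (\<sigma> k) i * of_bool (\<sigma> k \<in> X))"

text \<open>The upper bound is demanded only of totals up to \<open>b\<close>, the range of
  \<open>perm_tail_upper\<close>. The block \<open>J\<close> is a parameter because both the sample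
  and the block after it have to be typical.\<close>

definition "typical b \<gamma> \<C> J \<sigma> \<longleftrightarrow> (\<forall>X\<in>\<C>. \<forall>i\<in>{1..m}.
   sample_usage J \<sigma> X i > real (card J) / real n * (min (usage X i) b - \<gamma> / 4 * b) \<and>
   (usage X i \<le> b \<longrightarrow> sample_usage J \<sigma> X i < real (card J) / real n * (usage X i + \<gamma> / 4 * b)))"

lemma sample_usage_mono:
  assumes "J \<subseteq> {1..n}" "\<sigma> permutes {1..n}" "i \<in> {1..m}" "X \<subseteq> Y"
  shows "sample_usage J \<sigma> X i \<le> sample_usage J \<sigma> Y i"
  unfolding sample_usage_def
proof (rule sum_mono)
  fix k assume "k \<in> J"
  then have "\<sigma> k \<in> {1..n}" using assms(1,2) permutes_in_image[of \<sigma> "{1..n}" k] by blast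
  then show "c (\<sigma> k) i * of_bool (\<sigma> k \<in> X) \<le> c (\<sigma> k) i * of_bool (\<sigma> k \<in> Y)"
    using c_bounds(1) assms by (auto simp: of_bool_def)
qed

text \<open>Union bound over sets, resources and the two tails with deviation \<gamma> / 4, whence
  64 = 4 * 4^2 in the exponent.\<close>

lemma not_typical_mean:
  assumes J: "J \<subseteq> {1..n}" and \<gamma>: "0 \<le> \<gamma>" "\<gamma> \<le> 4" and C: "finite \<C>" and b: "0 \<le> b"
  shows "perm_mean {1..n} (\<lambda>\<sigma>. of_bool (\<not> typical b \<gamma> \<C> J \<sigma>))
       \<le> 2 * real m * real (card \<C>) * exp (- (real (card J) / real n * b * \<gamma>\<^sup>2 / 64))"
proof -
  let ?\<rho> = "real (card J) / real n"
  let ?lo = "\<lambda>X i \<sigma>. of_bool (sample_usage J \<sigma> X i \<le> ?\<rho> * (min (usage X i) b - \<gamma> / 4 * b)) :: real"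
  let ?up = "\<lambda>X i \<sigma>. of_bool (usage X i \<le> b \<and> sample_usage J \<sigma> X i \<ge> ?\<rho> * (usage X i + \<gamma> / 4 * b)) :: real"
  let ?e = "exp (- (?\<rho> * b * (\<gamma> / 4)\<^sup>2 / 4))"
  have ne: "{1..n} \<noteq> {}" using n by auto
  have cb: "0 \<le> c t i * of_bool (t \<in> X) \<and> c t i * of_bool (t \<in> X) \<le> 1"
    if "t \<in> {1..n}" "i \<in> {1..m}" for t i X
    using c_bounds[OF that] by (auto simp: of_bool_def)
  have lo: "perm_mean {1..n} (?lo X i) \<le> ?e" if i: "i \<in> {1..m}" for X i
    unfolding sample_usage_def usage_def
    by (rule perm_tail_lower[OF _ ne J, where c = "\<lambda>t. c t i * of_bool (t \<in> X)"])
       (use cb[OF _ i] \<gamma> in auto)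
  have up: "perm_mean {1..n} (?up X i) \<le> ?e" if i: "i \<in> {1..m}" for X i
  proof (cases "usage X i \<le> b")
    case True
    then have "perm_mean {1..n} (?up X i)
        = perm_mean {1..n} (\<lambda>\<sigma>. of_bool (sample_usage J \<sigma> X i \<ge> ?\<rho> * (usage X i + \<gamma> / 4 * b)))" by simp
    also have "\<dots> \<le> ?e"
      using True unfolding sample_usage_def usage_def
      by (intro perm_tail_upper[OF _ ne J, where c = "\<lambda>t. c t i * of_bool (t \<in> X)"])
         (use cb[OF _ i] \<gamma> in auto)
    finally show ?thesis .
  next
    case False
    then show ?thesis by (simp add: perm_mean_const)
  qed
  have "perm_mean {1..n} (\<lambda>\<sigma>. of_bool (\<not> typical b \<gamma> \<C> J \<sigma>))
      \<le> perm_mean {1..n} (\<lambda>\<sigma>. \<Sum>X\<in>\<C>. \<Sum>i=1..m. ?lo X i \<sigma> + ?up X i \<sigma>)"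
  proof (rule perm_mean_mono)
    fix \<sigma>
    have nn: "0 \<le> (\<Sum>i=1..m. ?lo X i \<sigma> + ?up X i \<sigma>)" for X by (intro sum_nonneg) auto
    show "of_bool (\<not> typical b \<gamma> \<C> J \<sigma>) \<le> (\<Sum>X\<in>\<C>. \<Sum>i=1..m. ?lo X i \<sigma> + ?up X i \<sigma>)"
    proof (cases "typical b \<gamma> \<C> J \<sigma>")
      case True
      then show ?thesis using nn by (simp add: sum_nonneg)
    next
      case False
      then obtain X i where X: "X \<in> \<C>" "i \<in> {1..m}"
        and "sample_usage J \<sigma> X i \<le> ?\<rho> * (min (usage X i) b - \<gamma> / 4 * b)
          \<or> usage X i \<le> b \<and> sample_usage J \<sigma> X i \<ge> ?\<rho> * (usage X i + \<gamma> / 4 * b)"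
        unfolding typical_def by (meson not_le)
      then have X3: "1 \<le> ?lo X i \<sigma> + ?up X i \<sigma>" by auto
      note X3
      also have "?lo X i \<sigma> + ?up X i \<sigma> \<le> (\<Sum>i=1..m. ?lo X i \<sigma> + ?up X i \<sigma>)"
        using X by (intro member_le_sum[of i "{1..m}" "\<lambda>i. ?lo X i \<sigma> + ?up X i \<sigma>"]) auto
      also have "\<dots> \<le> (\<Sum>X\<in>\<C>. \<Sum>i=1..m. ?lo X i \<sigma> + ?up X i \<sigma>)"
        using X nn C by (intro member_le_sum[of X \<C> "\<lambda>X. \<Sum>i=1..m. ?lo X i \<sigma> + ?up X i \<sigma>"]) auto
      finally show ?thesis using False by simp
    qed
  qed
  also have "\<dots> = (\<Sum>X\<in>\<C>. \<Sum>i=1..m. perm_mean {1..n} (?lo X i) + perm_mean {1..n} (?up X i))"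
    by (simp add: perm_mean_sum perm_mean_add)
  also have "\<dots> \<le> (\<Sum>X\<in>\<C>. \<Sum>i=1..m. ?e + ?e)" using lo up by (intro sum_mono add_mono) auto
  also have "\<dots> = 2 * real m * real (card \<C>) * ?e" by simp
  also have "?\<rho> * b * (\<gamma> / 4)\<^sup>2 / 4 = ?\<rho> * b * \<gamma>\<^sup>2 / 64" by (simp add: power_divide)
  finally show ?thesis .
qed

text \<open>Otherwise the lower set uses more than (1 - 5 \<gamma> / 8) b of some resource
  \<open>j\<close>, because the bracket costs \<gamma> / 8; the sample then shows more than 1 - 7
  \<gamma> / 8 of its share, against the limit 1 - \<gamma>. In the overload case \<open>j\<close>
  may differ from \<open>i\<close>, so the limit is assumed for all resources.\<close>

lemma typical_usage_le:
  assumes br: "bracketing b \<gamma> \<C>" and ty: "typical b \<gamma> \<C> J \<sigma>" and \<sigma>: "\<sigma> permutes {1..n}"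
    and J: "J \<subseteq> {1..n}" "J \<noteq> {}" and b: "0 < b" and \<gamma>: "0 < \<gamma>"
    and s: "\<And>i. i \<in> {1..m} \<Longrightarrow> sample_usage J \<sigma> (sel p) i \<le> (1 - \<gamma>) * (real (card J) / real n) * b"
    and i: "i \<in> {1..m}"
  shows "usage (sel p) i \<le> (1 - \<gamma> / 2) * b"
proof (rule ccontr)
  let ?\<rho> = "real (card J) / real n"
  assume neg: "\<not> ?thesis"
  have "finite J" using J finite_subset by blast
  then have \<rho>: "0 < ?\<rho>" using J n by (simp add: card_gt_0_iff)
  obtain L U where L: "L \<in> \<C>" "L \<subseteq> sel p" and U: "sel p \<subseteq> U"
    and or: "(\<exists>i\<in>{1..m}. usage L i > b) \<or> (\<forall>i\<in>{1..m}. usage U i \<le> usage L i + \<gamma> / 8 * b)"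
    using br unfolding bracketing_def by meson
  obtain j where j: "j \<in> {1..m}" "usage L j > (1 - 5 * \<gamma> / 8) * b"
  proof (cases "\<exists>i\<in>{1..m}. usage L i > b")
    case True
    moreover have "(1 - 5 * \<gamma> / 8) * b \<le> 1 * b" using \<gamma> b by (intro mult_right_mono) auto
    ultimately show ?thesis using that by force
  next
    case False
    then have "usage U i \<le> usage L i + \<gamma> / 8 * b" using or i by blast
    moreover have "usage (sel p) i \<le> usage U i" by (rule usage_mono[OF i U])
    ultimately show ?thesis using that[OF i] neg by (simp add: algebra_simps)
  qed
  have "(1 - 5 * \<gamma> / 8) * b \<le> min (usage L j) b"
    using j(2) \<gamma> b by (auto simp: algebra_simps)
  then have "?\<rho> * ((1 - 5 * \<gamma> / 8) * b - \<gamma> / 4 * b) \<le> ?\<rho> * (min (usage L j) b - \<gamma> / 4 * b)"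
    using \<rho> by (intro mult_left_mono) auto
  also have "\<dots> < sample_usage J \<sigma> L j" using ty L(1) j(1) unfolding typical_def by blast
  also have "\<dots> \<le> sample_usage J \<sigma> (sel p) j" by (rule sample_usage_mono[OF J(1) \<sigma> j(1) L(2)])
  also have "\<dots> \<le> (1 - \<gamma>) * ?\<rho> * b" by (rule s[OF j(1)])
  finally have "?\<rho> * b * (\<gamma> / 8) < 0" by (simp only: algebra_simps) (simp add: algebra_simps)
  moreover have "0 < ?\<rho> * b * (\<gamma> / 8)" using \<rho> b \<gamma> by (intro mult_pos_pos) auto
  ultimately show False by linarith
qed

text \<open>The assumed slack \<gamma> / 2 excludes overload and keeps the upper set below
  \<open>b\<close>, where its upper tail is available. Bracket and tail together cost \<gamma> / 8 +
  \<gamma> / 4.\<close>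

lemma typical_bracket_upper:
  assumes br: "bracketing b \<gamma> \<C>" and ty: "typical b \<gamma> \<C> J \<sigma>" and \<sigma>: "\<sigma> permutes {1..n}"
    and J: "J \<subseteq> {1..n}" and b: "0 < b" and \<gamma>: "0 < \<gamma>"
    and F: "\<And>i. i \<in> {1..m} \<Longrightarrow> usage (sel p) i \<le> (1 - \<gamma> / 2) * b" and i: "i \<in> {1..m}"
  shows "sample_usage J \<sigma> (sel p) i \<le> real (card J) / real n * (usage (sel p) i + 3 * \<gamma> / 8 * b)"
proof -
  let ?\<rho> = "real (card J) / real n"
  obtain L U where L: "L \<subseteq> sel p" and U: "U \<in> \<C>" "sel p \<subseteq> U"
    and or: "(\<exists>i\<in>{1..m}. usage L i > b) \<or> (\<forall>i\<in>{1..m}. usage U i \<le> usage L i + \<gamma> / 8 * b)"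
    using br unfolding bracketing_def by meson
  have Fb: "(1 - \<gamma> / 2) * b \<le> 1 * b" using \<gamma> b by (intro mult_right_mono) auto
  have "\<not> (\<exists>i\<in>{1..m}. usage L i > b)"
    using F Fb usage_mono[OF _ L] by force
  then have gap: "usage U i \<le> usage (sel p) i + \<gamma> / 8 * b"
    using or i usage_mono[OF i L] by fastforce
  also have "\<dots> \<le> (1 - 3 * \<gamma> / 8) * b" using F[OF i] by (simp add: algebra_simps)
  also have "\<dots> \<le> 1 * b" using \<gamma> b by (intro mult_right_mono) auto
  finally have "usage U i \<le> b" by simp
  then have "sample_usage J \<sigma> U i < ?\<rho> * (usage U i + \<gamma> / 4 * b)"
    using ty U(1) i unfolding typical_def by blast
  also have "\<dots> \<le> ?\<rho> * (usage (sel p) i + 3 * \<gamma> / 8 * b)"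
    using gap by (intro mult_left_mono) (auto simp: algebra_simps)
  finally show ?thesis using sample_usage_mono[OF J \<sigma> i U(2)] by linarith
qed

end

section \<open>A single round\<close>

text \<open>\<open>m_small\<close> lets the at most m tied columns be absorbed by a further
  \<gamma>. \<open>atypical\<close> ranges over all blocks of size \<open>s\<close>, as it is
  applied to the sample and to the block that follows it.\<close>

locale otp_round = rounded_lp +
  fixes b \<gamma> \<beta> :: real and s :: nat and D :: "nat list \<Rightarrow> (nat \<Rightarrow> real) \<times> (nat \<Rightarrow> real)"
    and \<C> :: "nat set set"
  assumes b: "0 < b" and \<gamma>: "0 < \<gamma>" "\<gamma> \<le> 1 / 10" and s: "0 < s" "2 * s \<le> n"
    and gp: "general_position m n \<pi> c"
    and opt: "\<And>\<sigma>. \<sigma> permutes {1..n} \<Longrightarrow>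
        otp_dual_optimal m n b \<pi> c s \<gamma> \<sigma> (D (map \<sigma> [1..<s+1]))"
    and m_small: "real m \<le> \<gamma> * (real s / real n) * b"
    and br: "bracketing b \<gamma> \<C>"
    and \<beta>: "0 \<le> \<beta>" "\<beta> \<le> \<gamma>"
    and atypical: "\<And>J. J \<subseteq> {1..n} \<Longrightarrow> card J = s \<Longrightarrow>
        perm_mean {1..n} (\<lambda>\<sigma>. of_bool (\<not> typical b \<gamma> \<C> J \<sigma>)) \<le> \<beta>"
begin

definition "price \<sigma> = fst (D (map \<sigma> [1..<s+1]))"
definition "opt_value = lp_opt m n b \<pi> c"
definition "pick \<sigma> j = primal_of m \<pi> c (price \<sigma>) j"
definition "gain J \<sigma> = (\<Sum>t\<in>J. \<pi> (\<sigma> t) * pick \<sigma> (\<sigma> t))"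
text \<open>A condition on the price alone, hence on the first \<open>s\<close> arrivals.
  Restricting to it does not disturb the symmetry of the later arrivals, as typicality of the whole
  order could.\<close>

definition "good \<sigma> \<longleftrightarrow> (\<forall>i\<in>{1..m}. usage (sel (price \<sigma>)) i \<le> (1 - \<gamma> / 2) * b \<and>
   (0 < price \<sigma> i \<longrightarrow> (1 - 3 * \<gamma>) * b \<le> usage (sel (price \<sigma>)) i))"

lemma opt_value_nonneg: "0 \<le> opt_value"
  unfolding opt_value_def using b \<pi>_nonneg by (intro lp_opt_nonneg) auto

lemma in_range: "\<sigma> permutes {1..n} \<Longrightarrow> t \<in> {1..n} \<Longrightarrow> \<sigma> t \<in> {1..n}"
  using permutes_in_image[of \<sigma> "{1..n}" t] by simp

lemma pick_bounds: "0 \<le> pick \<sigma> j" "pick \<sigma> j \<le> 1"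
  by (simp_all add: pick_def primal_of_bounds)

lemma gain_nonneg:
  assumes "\<sigma> permutes {1..n}" "J \<subseteq> {1..n}"
  shows "0 \<le> gain J \<sigma>"
  unfolding gain_def using \<pi>_nonneg in_range[OF assms(1)] assms(2) pick_bounds
  by (intro sum_nonneg mult_nonneg_nonneg) auto

lemma gain_mono:
  assumes "\<sigma> permutes {1..n}" "J \<subseteq> J'" "J' \<subseteq> {1..n}"
  shows "gain J \<sigma> \<le> gain J' \<sigma>"
  unfolding gain_def using \<pi>_nonneg in_range[OF assms(1)] assms(2,3) pick_bounds
  by (intro sum_mono2 mult_nonneg_nonneg) (auto intro: finite_subset)

lemma gain_total:
  assumes "\<sigma> permutes {1..n}"
  shows "gain {1..n} \<sigma> = lp_value n \<pi> (pick \<sigma>)"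
  unfolding gain_def lp_value_def
  using sum.permute[OF assms, of "\<lambda>j. \<pi> j * pick \<sigma> j"] by (simp add: o_def)

lemma sample_usage_pick:
  assumes "\<sigma> permutes {1..n}" "J \<subseteq> {1..n}"
  shows "sample_usage J \<sigma> (sel (price \<sigma>)) i = (\<Sum>t\<in>J. c (\<sigma> t) i * pick \<sigma> (\<sigma> t))"
  unfolding sample_usage_def pick_def
  by (intro sum.cong refl) (use in_range[OF assms(1)] assms(2) in \<open>auto simp: primal_of_sel\<close>)

lemma usage_pick: "usage (sel (price \<sigma>)) i = (\<Sum>t=1..n. c t i * pick \<sigma> t)"
  by (simp add: usage_sel pick_def)

lemma price_optimal:
  assumes "\<sigma> permutes {1..n}"
  shows "otp_dual_optimal m n b \<pi> c s \<gamma> \<sigma> (price \<sigma>, snd (D (map \<sigma> [1..<s+1])))"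
  using opt[OF assms] by (simp add: price_def)

lemma price_nonneg:
  assumes "\<sigma> permutes {1..n}" "i \<in> {1..m}"
  shows "0 \<le> price \<sigma> i"
  using price_optimal[OF assms(1)] assms(2) by (auto simp: otp_dual_optimal_def otp_dual_feasible_def)

lemma sample_usage_bounds:
  assumes \<sigma>: "\<sigma> permutes {1..n}" and i: "i \<in> {1..m}"
  shows "sample_usage {1..s} \<sigma> (sel (price \<sigma>)) i \<le> (1 - \<gamma>) * (real s / real n) * b"
    and "0 < price \<sigma> i \<Longrightarrow>
      (1 - 2 * \<gamma>) * (real s / real n) * b \<le> sample_usage {1..s} \<sigma> (sel (price \<sigma>)) i"
proof -
  have sub: "{1..s} \<subseteq> {1..n}" using s by auto
  have inj: "inj_on \<sigma> {1..s}" using permutes_inj_on[OF \<sigma>] .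
  have img: "\<sigma> ` {1..s} \<subseteq> {1..n}" using in_range[OF \<sigma>] sub by blast
  have cb: "0 \<le> c (\<sigma> t) i \<and> c (\<sigma> t) i \<le> 1" if "t \<in> {1..s}" for t
    using c_bounds[OF _ i] img that by blast
  show "sample_usage {1..s} \<sigma> (sel (price \<sigma>)) i \<le> (1 - \<gamma>) * (real s / real n) * b"
    using otp_sample_consumption_le[where a = c and i = i, OF price_optimal[OF \<sigma>] cb i]
    unfolding sample_usage_pick[OF \<sigma> sub] pick_def by (simp only: mult_ac)
  assume "0 < price \<sigma> i"
  from otp_sample_consumption_ge[where a = c and i = i, OF price_optimal[OF \<sigma>] inj img gp cb i this]
  have "real s / real n * (1 - \<gamma>) * b - real m \<le> sample_usage {1..s} \<sigma> (sel (price \<sigma>)) i"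
    unfolding sample_usage_pick[OF \<sigma> sub] pick_def .
  moreover have "(1 - 2 * \<gamma>) * (real s / real n) * b = real s / real n * (1 - \<gamma>) * b - \<gamma> * (real s / real n) * b"
    by (simp only: ring_distribs mult_ac) simp
  ultimately show "(1 - 2 * \<gamma>) * (real s / real n) * b \<le> sample_usage {1..s} \<sigma> (sel (price \<sigma>)) i"
    using m_small by linarith
qed

lemma \<rho>_pos: "0 < real s / real n" using s n by simp

lemma typical_good:
  assumes \<sigma>: "\<sigma> permutes {1..n}" and ty: "typical b \<gamma> \<C> {1..s} \<sigma>"
  shows "good \<sigma>"
proof -
  let ?p = "price \<sigma>"
  have J: "{1..s} \<subseteq> {1..n}" "{1..s} \<noteq> {}" using s by auto
  have up: "usage (sel ?p) i \<le> (1 - \<gamma> / 2) * b" if i: "i \<in> {1..m}" for i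
    by (rule typical_usage_le[OF br ty \<sigma> J b \<gamma>(1) _ i]) (use sample_usage_bounds(1)[OF \<sigma>] in simp)
  have "(1 - 3 * \<gamma>) * b \<le> usage (sel ?p) i" if i: "i \<in> {1..m}" "0 < ?p i" for i
  proof -
    have "real s / real n * ((1 - 2 * \<gamma>) * b) \<le> sample_usage {1..s} \<sigma> (sel ?p) i"
      using sample_usage_bounds(2)[OF \<sigma> i] by (simp only: mult_ac)
    also have "\<dots> \<le> real s / real n * (usage (sel ?p) i + 3 * \<gamma> / 8 * b)"
      using typical_bracket_upper[OF br ty \<sigma> J(1) b \<gamma>(1) up i(1)] by simp
    finally have "(1 - 2 * \<gamma>) * b \<le> usage (sel ?p) i + 3 * \<gamma> / 8 * b"
      using \<rho>_pos by (simp only: mult_le_cancel_left_pos)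
    \<comment> \<open>The loss 2 \<gamma> on the sample and the deviation 3 \<gamma> / 8 leave 5
      \<gamma> / 8 to spare.\<close>
    moreover have "(1 - 3 * \<gamma>) * b = (1 - 2 * \<gamma>) * b - 3 * \<gamma> / 8 * b - 5 / 8 * (\<gamma> * b)"
      by (simp add: algebra_simps)
    ultimately show ?thesis using mult_pos_pos[OF \<gamma>(1) b] by linarith
  qed
  then show ?thesis using up by (simp add: good_def)
qed

lemma good_gain:
  assumes \<sigma>: "\<sigma> permutes {1..n}" and g: "good \<sigma>"
  shows "(1 - 3 * \<gamma>) * opt_value \<le> gain {1..n} \<sigma>" and "gain {1..n} \<sigma> \<le> opt_value"
proof -
  have pick: "pick \<sigma> = primal_of m \<pi> c (price \<sigma>)" by (auto simp: pick_def)
  show "(1 - 3 * \<gamma>) * opt_value \<le> gain {1..n} \<sigma>"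
    unfolding gain_total[OF \<sigma>] opt_value_def pick
  proof (rule price_value_ge_opt)
    fix i assume i: "i \<in> {1..m}" "0 < price \<sigma> i"
    then show "(1 - 3 * \<gamma>) * b \<le> (\<Sum>t=1..n. c t i * primal_of m \<pi> c (price \<sigma>) t)"
      using g unfolding good_def usage_sel by blast
  qed (use b \<gamma> price_nonneg[OF \<sigma>] in auto)
  have "lp_feasible m n b c (pick \<sigma>)"
    unfolding lp_feasible_def
  proof (intro conjI ballI)
    fix i assume i: "i \<in> {1..m}"
    have "usage (sel (price \<sigma>)) i \<le> (1 - \<gamma> / 2) * b" using g i by (simp add: good_def)
    also have "\<dots> \<le> 1 * b" using b \<gamma> by (intro mult_right_mono) auto
    finally show "(\<Sum>t=1..n. c t i * pick \<sigma> t) \<le> b" by (simp add: usage_pick)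
  qed (auto simp: pick_bounds)
  then show "gain {1..n} \<sigma> \<le> opt_value"
    unfolding gain_total[OF \<sigma>] opt_value_def by (intro lp_value_le_opt \<pi>_nonneg)
qed

section \<open>Stopping time and expected value of a round\<close>

definition "stop \<sigma> = otp_stop m n b \<pi> c s (price \<sigma>) \<sigma>"

lemma stop_prop:
  shows "stop \<sigma> \<in> {s..2 * s}"
    and "i \<in> {1..m} \<Longrightarrow> (\<Sum>t=s+1..stop \<sigma>. c (\<sigma> t) i * pick \<sigma> (\<sigma> t)) \<le> real s / real n * b"
proof -
  let ?T = "{t'\<in>{s..2 * s}. \<forall>i\<in>{1..m}.
       (\<Sum>t=s+1..t'. c (\<sigma> t) i * primal_of m \<pi> c (price \<sigma>) (\<sigma> t)) \<le> real s / real n * b}"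
  have "0 \<le> real s / real n * b" using b by simp
  then have "s \<in> ?T" by simp
  then have "?T \<noteq> {}" by blast
  then have "Max ?T \<in> ?T" by (rule Max_in[rotated]) simp
  then have "stop \<sigma> \<in> ?T" by (simp add: stop_def otp_stop_def)
  then show "stop \<sigma> \<in> {s..2 * s}"
    and "i \<in> {1..m} \<Longrightarrow> (\<Sum>t=s+1..stop \<sigma>. c (\<sigma> t) i * pick \<sigma> (\<sigma> t)) \<le> real s / real n * b"
    by (auto simp: pick_def)
qed

text \<open>Since (1 - \<gamma> / 2) + 3 \<gamma> / 8 < 1, the whole block fits into its
  budget.\<close>

lemma stop_eq:
  assumes \<sigma>: "\<sigma> permutes {1..n}" and g: "good \<sigma>" and ty: "typical b \<gamma> \<C> {s+1..2 * s} \<sigma>"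
  shows "stop \<sigma> = 2 * s"
proof -
  let ?T = "{t'\<in>{s..2 * s}. \<forall>i\<in>{1..m}.
       (\<Sum>t=s+1..t'. c (\<sigma> t) i * primal_of m \<pi> c (price \<sigma>) (\<sigma> t)) \<le> real s / real n * b}"
  have J: "{s+1..2 * s} \<subseteq> {1..n}" "card {s+1..2 * s} = s" using s by auto
  have F: "usage (sel (price \<sigma>)) i \<le> (1 - \<gamma> / 2) * b" if "i \<in> {1..m}" for i
    using g that by (simp add: good_def)
  have "(\<Sum>t=s+1..2 * s. c (\<sigma> t) i * primal_of m \<pi> c (price \<sigma>) (\<sigma> t)) \<le> real s / real n * b"
    if i: "i \<in> {1..m}" for i
  proof -
    have "sample_usage {s+1..2 * s} \<sigma> (sel (price \<sigma>)) i
        \<le> real s / real n * (usage (sel (price \<sigma>)) i + 3 * \<gamma> / 8 * b)"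
      using typical_bracket_upper[OF br ty \<sigma> J(1) b \<gamma>(1) F i] unfolding J(2) .
    also have "\<dots> \<le> real s / real n * b"
      using F[OF i] \<rho>_pos mult_pos_pos[OF \<gamma>(1) b]
      by (intro mult_left_mono) (auto simp: algebra_simps)
    finally show ?thesis unfolding sample_usage_pick[OF \<sigma> J(1)] pick_def .
  qed
  then have "2 * s \<in> ?T" by simp
  then have "Max ?T = 2 * s" by (intro Max_eqI) auto
  then show ?thesis by (simp add: stop_def otp_stop_def)
qed

lemma sum_otp:
  assumes \<sigma>: "\<sigma> permutes {1..n}"
  shows "(\<Sum>j=1..n. g j * otp m n b \<pi> c D s \<sigma> j) = (\<Sum>t=s+1..stop \<sigma>. g (\<sigma> t) * pick \<sigma> (\<sigma> t))"
proof -
  have "(\<Sum>j=1..n. g j * otp m n b \<pi> c D s \<sigma> j)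
      = (\<Sum>t=1..n. g (\<sigma> t) * otp m n b \<pi> c D s \<sigma> (\<sigma> t))"
    using sum.permute[OF \<sigma>, of "\<lambda>j. g j * otp m n b \<pi> c D s \<sigma> j"] by (simp add: o_def)
  also have "\<dots> = (\<Sum>t=1..n. if t \<in> {s+1..stop \<sigma>} then g (\<sigma> t) * pick \<sigma> (\<sigma> t) else 0)"
    using permutes_inverses(2)[OF \<sigma>]
    by (intro sum.cong refl) (simp add: otp_def Let_def stop_def pick_def price_def)
  also have "\<dots> = (\<Sum>t\<in>{1..n} \<inter> {s+1..stop \<sigma>}. g (\<sigma> t) * pick \<sigma> (\<sigma> t))"
    by (simp only: sum.inter_restrict finite_atLeastAtMost)
  also have "{1..n} \<inter> {s+1..stop \<sigma>} = {s+1..stop \<sigma>}" using stop_prop(1)[of \<sigma>] s by auto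
  finally show ?thesis .
qed

lemma otp_bounds:
  shows "0 \<le> otp m n b \<pi> c D s \<sigma> j"
    and "otp m n b \<pi> c D s \<sigma> j \<le> of_bool (inv \<sigma> j \<in> {s+1..2 * s})"
  using stop_prop(1)[of \<sigma>] unfolding stop_def price_def
  by (auto simp: otp_def Let_def primal_of_def)

lemma price_cong:
  assumes "\<And>t. t \<in> {1..s} \<Longrightarrow> \<sigma> t = \<sigma>' t"
  shows "price \<sigma> = price \<sigma>'"
proof -
  have "map \<sigma> [1..<s+1] = map \<sigma>' [1..<s+1]" using assms by (intro map_cong) auto
  then show ?thesis by (simp only: price_def)
qed

text \<open>Swapping the times \<open>s+1\<close> and \<open>t\<close> leaves the sample unchanged,
  hence also the price and its goodness.\<close>

lemma mean_gain_exchangeable: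
  assumes t: "t \<in> {s+1..n}"
  shows "perm_mean {1..n} (\<lambda>\<sigma>. of_bool (good \<sigma>) * (\<pi> (\<sigma> t) * pick \<sigma> (\<sigma> t)))
       = perm_mean {1..n} (\<lambda>\<sigma>. of_bool (good \<sigma>) * (\<pi> (\<sigma> (s+1)) * pick \<sigma> (\<sigma> (s+1))))"
    (is "perm_mean _ ?f = perm_mean _ ?g")
proof -
  let ?\<tau> = "Transposition.transpose (s+1) t"
  have \<tau>: "?\<tau> permutes {1..n}" using t s by (intro permutes_swap_id) auto
  have f: "?f (\<sigma> \<circ> ?\<tau>) = ?g \<sigma>" for \<sigma>
  proof -
    have "price (\<sigma> \<circ> ?\<tau>) = price \<sigma>"
      by (rule price_cong) (use t in \<open>auto simp: transpose_def\<close>)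
    then show ?thesis by (simp add: good_def pick_def)
  qed
  show ?thesis using perm_mean_compose_right[OF \<tau>, of ?f] unfolding f by (rule sym)
qed

text \<open>The expected decisions on the sample, scaled by \<open>n / s\<close>, are feasible for the whole LP.
  This replaces LP duality.\<close>

lemma mean_sample_gain_le: "perm_mean {1..n} (gain {1..s}) \<le> real s / real n * opt_value"
proof -
  let ?\<rho> = "real s / real n"
  define y where "y j = perm_mean {1..n} (\<lambda>\<sigma>. of_bool (j \<in> \<sigma> ` {1..s}) * pick \<sigma> j)" for j
  have sub: "{1..s} \<subseteq> {1..n}" using s by auto
  have y_sum: "(\<Sum>j=1..n. g j * y j) = perm_mean {1..n} (\<lambda>\<sigma>. \<Sum>t=1..s. g (\<sigma> t) * pick \<sigma> (\<sigma> t))" for g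
  proof -
    have "(\<Sum>j=1..n. g j * y j)
        = perm_mean {1..n} (\<lambda>\<sigma>. \<Sum>j=1..n. g j * (of_bool (j \<in> \<sigma> ` {1..s}) * pick \<sigma> j))"
      unfolding y_def by (simp only: perm_mean_sum perm_mean_cmult)
    also have "\<dots> = perm_mean {1..n} (\<lambda>\<sigma>. \<Sum>t=1..s. g (\<sigma> t) * pick \<sigma> (\<sigma> t))"
    proof (rule perm_mean_cong)
      fix \<sigma> assume \<sigma>: "\<sigma> permutes {1..n}"
      have "(\<Sum>j=1..n. g j * (of_bool (j \<in> \<sigma> ` {1..s}) * pick \<sigma> j)) = (\<Sum>j\<in>\<sigma> ` {1..s}. g j * pick \<sigma> j)"
        using in_range[OF \<sigma>] sub by (intro sum.mono_neutral_cong_right) auto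
      also have "\<dots> = (\<Sum>t=1..s. g (\<sigma> t) * pick \<sigma> (\<sigma> t))"
        using permutes_inj_on[OF \<sigma>] by (simp add: sum.reindex)
      finally show "(\<Sum>j=1..n. g j * (of_bool (j \<in> \<sigma> ` {1..s}) * pick \<sigma> j))
          = (\<Sum>t=1..s. g (\<sigma> t) * pick \<sigma> (\<sigma> t))" .
    qed
    finally show ?thesis .
  qed
  have "lp_feasible m n b c (\<lambda>j. y j / ?\<rho>)"
    unfolding lp_feasible_def
  proof (intro conjI ballI)
    fix j assume j: "j \<in> {1..n}"
    have "0 \<le> y j" unfolding y_def using pick_bounds by (intro perm_mean_nonneg) auto
    then show "0 \<le> y j / ?\<rho>" by simp
    have "y j \<le> perm_mean {1..n} (\<lambda>\<sigma>. of_bool ({j} \<subseteq> \<sigma> ` {1..s}))"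
      unfolding y_def using pick_bounds by (intro perm_mean_mono) auto
    also have "\<dots> \<le> (real (card {1..s}) / real (card {1..n})) ^ card {j}"
      by (rule perm_mean_subset_image) (use j sub in auto)
    finally have "y j \<le> ?\<rho>" by simp
    then show "y j / ?\<rho> \<le> 1" using \<rho>_pos by (simp only: divide_le_eq_1_pos)
  next
    fix i assume i: "i \<in> {1..m}"
    have "(\<Sum>j=1..n. c j i * y j) \<le> perm_mean {1..n} (\<lambda>\<sigma>. ?\<rho> * b)"
      unfolding y_sum
    proof (rule perm_mean_mono)
      fix \<sigma> assume \<sigma>: "\<sigma> permutes {1..n}"
      have "(\<Sum>t=1..s. c (\<sigma> t) i * pick \<sigma> (\<sigma> t)) \<le> (1 - \<gamma>) * (?\<rho> * b)"
        using sample_usage_bounds(1)[OF \<sigma> i] unfolding sample_usage_pick[OF \<sigma> sub] by (simp only: mult_ac)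
      also have "\<dots> \<le> 1 * (?\<rho> * b)" using \<gamma> \<rho>_pos b by (intro mult_right_mono) auto
      finally show "(\<Sum>t=1..s. c (\<sigma> t) i * pick \<sigma> (\<sigma> t)) \<le> ?\<rho> * b" by simp
    qed
    then have "(\<Sum>j=1..n. c j i * y j) / ?\<rho> \<le> b"
      using \<rho>_pos by (simp only: perm_mean_const finite_atLeastAtMost pos_divide_le_eq mult.commute)
    then show "(\<Sum>j=1..n. c j i * (y j / ?\<rho>)) \<le> b"
      by (simp only: times_divide_eq_right sum_divide_distrib)
  qed
  then have "lp_value n \<pi> (\<lambda>j. y j / ?\<rho>) \<le> opt_value"
    unfolding opt_value_def by (intro lp_value_le_opt \<pi>_nonneg)
  moreover have "lp_value n \<pi> (\<lambda>j. y j / ?\<rho>) = perm_mean {1..n} (gain {1..s}) / ?\<rho>"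
    unfolding lp_value_def times_divide_eq_right sum_divide_distrib[symmetric] y_sum gain_def ..
  ultimately show ?thesis using \<rho>_pos by (simp only: pos_divide_le_eq mult.commute)
qed

text \<open>A good price collects (1 - 3 \<gamma>) of the optimum on all columns; at most s / n of
  it is expected on the sample, and the rest is spread evenly over n - s exchangeable times. The
  next \<open>s\<close> of them receive the share s / (n - s). It turns 1 - s/n into exactly s / n,
  and since s \<le> n / 2 it at most doubles the relative loss 4 \<gamma>.\<close>

lemma mean_good_gain_ge:
  "(real s / real n * (1 - 8 * \<gamma>)) * opt_value
     \<le> perm_mean {1..n} (\<lambda>\<sigma>. of_bool (good \<sigma>) * gain {s+1..2 * s} \<sigma>)"
proof -
  let ?\<rho> = "real s / real n" and ?O = opt_value
  define e where "e = perm_mean {1..n} (\<lambda>\<sigma>. of_bool (good \<sigma>) * (\<pi> (\<sigma> (s+1)) * pick \<sigma> (\<sigma> (s+1))))"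
  have tail: "perm_mean {1..n} (\<lambda>\<sigma>. of_bool (good \<sigma>) * gain T \<sigma>) = real (card T) * e"
    if "T \<subseteq> {s+1..n}" for T
  proof -
    have "perm_mean {1..n} (\<lambda>\<sigma>. of_bool (good \<sigma>) * gain T \<sigma>)
        = (\<Sum>t\<in>T. perm_mean {1..n} (\<lambda>\<sigma>. of_bool (good \<sigma>) * (\<pi> (\<sigma> t) * pick \<sigma> (\<sigma> t))))"
      unfolding gain_def sum_distrib_left by (rule perm_mean_sum)
    also have "\<dots> = (\<Sum>t\<in>T. e)"
      unfolding e_def using that by (intro sum.cong refl mean_gain_exchangeable) auto
    finally show ?thesis by simp
  qed
  have s12: "{s+1..2 * s} \<subseteq> {s+1..n}" "{1..s} \<subseteq> {1..n}" using s by auto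
  have good_mean: "1 - \<beta> \<le> perm_mean {1..n} (\<lambda>\<sigma>. of_bool (good \<sigma>))"
  proof -
    have "1 - \<beta> \<le> perm_mean {1..n} (\<lambda>\<sigma>. 1) - perm_mean {1..n} (\<lambda>\<sigma>. of_bool (\<not> typical b \<gamma> \<C> {1..s} \<sigma>))"
      using atypical[of "{1..s}"] s by (simp add: perm_mean_const)
    also have "\<dots> \<le> perm_mean {1..n} (\<lambda>\<sigma>. of_bool (good \<sigma>))"
      unfolding perm_mean_diff[symmetric] using typical_good by (intro perm_mean_mono) auto
    finally show ?thesis .
  qed
  have "(1 - 4 * \<gamma>) * ?O \<le> ((1 - 3 * \<gamma>) * (1 - \<beta>)) * ?O"
  proof (intro mult_right_mono opt_value_nonneg)
    have "0 \<le> 3 * \<gamma> * \<beta>" using \<gamma> \<beta> by simp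
    moreover have "(1 - 3 * \<gamma>) * (1 - \<beta>) = 1 - 3 * \<gamma> - \<beta> + 3 * \<gamma> * \<beta>"
      by (simp add: algebra_simps)
    ultimately show "1 - 4 * \<gamma> \<le> (1 - 3 * \<gamma>) * (1 - \<beta>)" using \<beta> by linarith
  qed
  also have "\<dots> = (1 - 3 * \<gamma>) * ?O * (1 - \<beta>)" by (simp only: mult_ac)
  also have "\<dots> \<le> (1 - 3 * \<gamma>) * ?O * perm_mean {1..n} (\<lambda>\<sigma>. of_bool (good \<sigma>))"
    using good_mean opt_value_nonneg \<gamma> by (intro mult_left_mono) auto
  also have "\<dots> \<le> perm_mean {1..n} (\<lambda>\<sigma>. gain {1..s} \<sigma> + of_bool (good \<sigma>) * gain {s+1..n} \<sigma>)"
    unfolding perm_mean_cmult[symmetric]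
  proof (rule perm_mean_mono)
    fix \<sigma> assume \<sigma>: "\<sigma> permutes {1..n}"
    have "{1..n} = {1..s} \<union> {s+1..n}" using s by auto
    then have "gain {1..n} \<sigma> = gain {1..s} \<sigma> + gain {s+1..n} \<sigma>"
      unfolding gain_def by (simp add: sum.union_disjoint)
    then show "(1 - 3 * \<gamma>) * ?O * of_bool (good \<sigma>) \<le> gain {1..s} \<sigma> + of_bool (good \<sigma>) * gain {s+1..n} \<sigma>"
      using good_gain(1)[OF \<sigma>] gain_nonneg[OF \<sigma> s12(2)] by auto
  qed
  also have "\<dots> = perm_mean {1..n} (gain {1..s}) + real (n - s) * e"
    using tail[of "{s+1..n}"] by (simp add: perm_mean_add)
  also have "\<dots> \<le> ?\<rho> * ?O + real (n - s) * e" using mean_sample_gain_le by simp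
  finally have "(1 - 4 * \<gamma> - ?\<rho>) * ?O \<le> real (n - s) * e" by (simp add: algebra_simps)
  then have "real s / real (n - s) * ((1 - 4 * \<gamma> - ?\<rho>) * ?O) \<le> real s / real (n - s) * (real (n - s) * e)"
    by (intro mult_left_mono) auto
  also have "\<dots> = real s * e" using s by simp
  also have "\<dots> = perm_mean {1..n} (\<lambda>\<sigma>. of_bool (good \<sigma>) * gain {s+1..2 * s} \<sigma>)"
    using tail[OF s12(1)] by simp
  finally have up: "real s / real (n - s) * (1 - 4 * \<gamma> - ?\<rho>) * ?O
      \<le> perm_mean {1..n} (\<lambda>\<sigma>. of_bool (good \<sigma>) * gain {s+1..2 * s} \<sigma>)" by (simp only: mult.assoc)
  have "?\<rho> * (1 - 8 * \<gamma>) \<le> real s / real (n - s) * (1 - 4 * \<gamma> - ?\<rho>)"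
  proof -
    have ns: "0 < real n - real s" "real n \<le> 2 * (real n - real s)" using s by auto
    have eq: "real s / (real n - real s) * (1 - 4 * \<gamma> - ?\<rho>)
        = ?\<rho> - 4 * \<gamma> * (real s / (real n - real s))"
    proof -
      have "1 - ?\<rho> = (real n - real s) / real n" using n by (simp add: field_simps)
      then have "real s / (real n - real s) * (1 - ?\<rho>) = ?\<rho>" using ns(1) by simp
      then show ?thesis by (simp only: ring_distribs mult_ac)
    qed
    have "real s / (real n - real s) \<le> 2 * ?\<rho>"
      using mult_left_mono[OF ns(2), of "real s"] ns(1) n
      by (simp add: divide_simps) (simp add: algebra_simps)
    then have le: "4 * \<gamma> * (real s / (real n - real s)) \<le> 4 * \<gamma> * (2 * ?\<rho>)"
      using \<gamma> by (intro mult_left_mono) auto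
    have "?\<rho> * (1 - 8 * \<gamma>) = ?\<rho> - 4 * \<gamma> * (2 * ?\<rho>)" by (simp add: algebra_simps)
    moreover have "real (n - s) = real n - real s" using s by (simp add: of_nat_diff)
    ultimately show ?thesis using le by (simp only: eq)
  qed
  then have "?\<rho> * (1 - 8 * \<gamma>) * ?O \<le> real s / real (n - s) * (1 - 4 * \<gamma> - ?\<rho>) * ?O"
    by (intro mult_right_mono opt_value_nonneg)
  then show ?thesis using up by (rule order_trans)
qed

text \<open>Early stopping under a good price requires an atypical second block. It then forfeits at
  most the optimum, because a good selection is feasible, so the expected loss is at most \<beta>
  times the optimum.\<close>

lemma mean_otp_value_ge:
  "(real s / real n * (1 - 8 * \<gamma>) - \<beta>) * opt_value
     \<le> perm_mean {1..n} (\<lambda>\<sigma>. lp_value n \<pi> (otp m n b \<pi> c D s \<sigma>))"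
proof -
  let ?T = "{s+1..2 * s}"
  have T: "?T \<subseteq> {1..n}" "card ?T = s" using s by auto
  have "perm_mean {1..n} (\<lambda>\<sigma>. of_bool (good \<sigma>) * gain ?T \<sigma> - opt_value * of_bool (\<not> typical b \<gamma> \<C> ?T \<sigma>))
      \<le> perm_mean {1..n} (\<lambda>\<sigma>. lp_value n \<pi> (otp m n b \<pi> c D s \<sigma>))"
  proof (rule perm_mean_mono)
    fix \<sigma> assume \<sigma>: "\<sigma> permutes {1..n}"
    have val: "lp_value n \<pi> (otp m n b \<pi> c D s \<sigma>) = gain {s+1..stop \<sigma>} \<sigma>"
      unfolding lp_value_def gain_def by (rule sum_otp[OF \<sigma>])
    have "{s+1..stop \<sigma>} \<subseteq> {1..n}" using stop_prop(1)[of \<sigma>] s by auto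
    then have "0 \<le> gain {s+1..stop \<sigma>} \<sigma>" by (rule gain_nonneg[OF \<sigma>])
    moreover have "gain ?T \<sigma> \<le> opt_value" if "good \<sigma>"
      using gain_mono[OF \<sigma> T(1)] good_gain(2)[OF \<sigma> that] by simp
    ultimately show "of_bool (good \<sigma>) * gain ?T \<sigma> - opt_value * of_bool (\<not> typical b \<gamma> \<C> ?T \<sigma>)
        \<le> lp_value n \<pi> (otp m n b \<pi> c D s \<sigma>)"
      using stop_eq[OF \<sigma>] opt_value_nonneg unfolding val by (auto simp: of_bool_def)
  qed
  moreover have "opt_value * perm_mean {1..n} (\<lambda>\<sigma>. of_bool (\<not> typical b \<gamma> \<C> ?T \<sigma>)) \<le> opt_value * \<beta>"
    using atypical[OF T] opt_value_nonneg by (intro mult_left_mono)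
  ultimately show ?thesis
    using mean_good_gain_ge unfolding perm_mean_diff perm_mean_cmult left_diff_distrib[of _ \<beta>]
      mult.commute[of opt_value \<beta>] by linarith
qed

end

section \<open>Combining the rounds\<close>

text \<open>Consecutive blocks tile one interval, so each column is decided in at most one
  round.\<close>

lemma sum_of_bool_intervals:
  fixes s :: "nat \<Rightarrow> nat"
  assumes "\<And>i. i < L \<Longrightarrow> s i \<le> s (Suc i)"
  shows "(\<Sum>i<L. of_bool (u \<in> {s i + 1..s (Suc i)})) = (of_bool (u \<in> {s 0 + 1..s L}) :: real)"
    and "s 0 \<le> s L"
proof -
  have "(\<Sum>i<l. of_bool (u \<in> {s i + 1..s (Suc i)})) = (of_bool (u \<in> {s 0 + 1..s l}) :: real) \<and> s 0 \<le> s l"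
    if "l \<le> L" for l
    using that
  proof (induction l)
    case (Suc l)
    then have "s l \<le> s (Suc l)" "s 0 \<le> s l" using assms by auto
    then show ?case using Suc by auto
  qed simp
  then show "(\<Sum>i<L. of_bool (u \<in> {s i + 1..s (Suc i)})) = (of_bool (u \<in> {s 0 + 1..s L}) :: real)"
    and "s 0 \<le> s L" by auto
qed

locale robust_dpa_run = rounded_lp +
  fixes D :: "nat list \<Rightarrow> (nat \<Rightarrow> real) \<times> (nat \<Rightarrow> real)"
  assumes log_int: "log 2 (1 / \<epsilon>) \<in> \<int>" and \<epsilon>n_int: "\<epsilon> * real n \<in> \<int>"
    and B_large: "B \<ge> 1536 * ((real m)\<^sup>2 / \<epsilon>\<^sup>2) * ln (real m / \<epsilon>)"
    and gp: "general_position m n \<pi> (rounded m a q)"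
    and rule: "robust_dpa_rule m n B \<epsilon> \<pi> a q D"
begin

definition "rounds = dpa_rounds \<epsilon>"
definition "sample i = dpa_sample n \<epsilon> i"
definition "gam i = sqrt (\<epsilon> / 2 ^ i)"
definition "b = (1 - \<epsilon>) * B"
text \<open>All counts are bounded by powers of this number, whose logarithm appears in the
  assumption on \<open>B\<close>.\<close>

definition "R = real m / \<epsilon>"

lemma two_pow_rounds: "2 ^ rounds = 1 / \<epsilon>"
proof -
  have "0 \<le> log 2 (1 / \<epsilon>)" using eps by (simp add: zero_le_log_cancel_iff)
  then have "real rounds = log 2 (1 / \<epsilon>)"
    using log_int by (auto simp: rounds_def dpa_rounds_def elim!: Ints_cases)
  then have "2 powr real rounds = 1 / \<epsilon>" using eps by simp
  then show ?thesis by (simp add: powr_realpow)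
qed

lemma sample_eq: "real (sample i) = \<epsilon> * 2 ^ i * real n"
proof -
  have "\<epsilon> * 2 ^ i * real n = (\<epsilon> * real n) * 2 ^ i" by simp
  also have "\<dots> \<in> \<int>" by (intro Ints_mult[OF \<epsilon>n_int] Ints_power) auto
  finally have "\<epsilon> * 2 ^ i * real n \<in> \<int>" .
  moreover have "0 \<le> \<epsilon> * 2 ^ i * real n" using eps by simp
  ultimately show ?thesis by (auto simp: sample_def dpa_sample_def elim!: Ints_cases)
qed

lemma sample_ratio: "real (sample i) / real n = \<epsilon> * 2 ^ i"
  using n by (simp add: sample_eq)

lemma sample_Suc: "sample (Suc i) = 2 * sample i"
proof -
  have "real (sample (Suc i)) = real (2 * sample i)" by (simp add: sample_eq)
  then show ?thesis by (simp only: of_nat_eq_iff)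
qed

lemma sample_pos: "0 < sample i"
proof -
  have "0 < real (sample i)" unfolding sample_eq using eps n by simp
  then show ?thesis by simp
qed

lemma pow_le_inverse_eps:
  assumes "i \<le> rounds"
  shows "\<epsilon> * 2 ^ i \<le> 1"
proof -
  have "(2::real) ^ i \<le> 2 ^ rounds" using assms by (intro power_increasing) auto
  then have "\<epsilon> * 2 ^ i \<le> \<epsilon> * (1 / \<epsilon>)" unfolding two_pow_rounds using eps by (intro mult_left_mono) auto
  then show ?thesis using eps by simp
qed

lemma two_sample_le:
  assumes "i < rounds"
  shows "2 * sample i \<le> n"
proof -
  have "real (sample (Suc i)) \<le> 1 * real n"
    unfolding sample_eq using pow_le_inverse_eps[of "Suc i"] assms by (intro mult_right_mono) auto
  then show ?thesis unfolding sample_Suc by simp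
qed

lemma gam_sq: "gam i ^ 2 = \<epsilon> / 2 ^ i" using eps by (simp add: gam_def)

lemma gam_bounds:
  assumes "i < rounds"
  shows "0 < gam i" "gam i \<le> 1 / 10" "\<epsilon> \<le> gam i"
proof -
  show "0 < gam i" using eps by (simp add: gam_def)
  have "\<epsilon> / 2 ^ i \<le> \<epsilon> / 1" using eps by (intro divide_left_mono) auto
  then have "gam i ^ 2 \<le> (1 / 10) ^ 2" unfolding gam_sq using eps by (simp only: power2_eq_square)
  then show "gam i \<le> 1 / 10" by (rule power2_le_imp_le) simp
  have "\<epsilon> * 2 ^ i * \<epsilon> \<le> 1 * \<epsilon>" using pow_le_inverse_eps[of i] assms eps by (intro mult_right_mono) auto
  then have "\<epsilon> ^ 2 \<le> gam i ^ 2" unfolding gam_sq by (simp add: field_simps power2_eq_square)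
  then show "\<epsilon> \<le> gam i" by (rule power2_le_imp_le) (use \<open>0 < gam i\<close> in simp)
qed

lemma b_pos: "0 < b" using B eps by (simp add: b_def)

section \<open>Choice of the constants\<close>

lemma R_bounds: "100 \<le> R" "1 / \<epsilon> \<le> R" "4 * real m \<le> R" "1 \<le> ln R"
proof -
  have m1: "1 \<le> real m" using m by simp
  have e: "100 \<le> 1 / \<epsilon>" using eps by (simp add: field_simps)
  show 1: "1 / \<epsilon> \<le> R" unfolding R_def using m1 eps by (intro divide_right_mono) auto
  then show 2: "100 \<le> R" using e by linarith
  have "real m * 4 \<le> real m * (1 / \<epsilon>)" using e by (intro mult_left_mono) auto
  then show "4 * real m \<le> R" by (simp add: R_def)
  have "exp 1 \<le> R" using exp_le 2 by linarith
  then show "1 \<le> ln R" using 2 by (simp add: ln_ge_iff)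
qed

text \<open>768 = 64 * 12: the 64 is the denominator in \<open>not_typical_mean\<close>, and 12 is
  the power of \<open>R\<close> needed in \<open>atypical_mean_le\<close>. The factor 2 in 1536 pays
  for b \<ge> B / 2.\<close>

lemma eps_sq_b: "768 * (real m)\<^sup>2 * ln R \<le> \<epsilon>\<^sup>2 * b"
proof -
  have "\<epsilon>\<^sup>2 * (1536 * ((real m)\<^sup>2 / \<epsilon>\<^sup>2) * ln (real m / \<epsilon>)) \<le> \<epsilon>\<^sup>2 * B"
    using B_large by (intro mult_left_mono) auto
  then have "1536 * (real m)\<^sup>2 * ln R \<le> \<epsilon>\<^sup>2 * B" using eps by (simp add: R_def)
  moreover have "\<epsilon>\<^sup>2 * (1 / 2 * B) \<le> \<epsilon>\<^sup>2 * b"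
    unfolding b_def using eps B by (intro mult_left_mono mult_right_mono) auto
  ultimately show ?thesis by simp
qed

lemma card_grid_le: "real (card (grid m \<delta>)) \<le> R ^ (2 * m)"
proof -
  have m1: "1 \<le> real m" using m by simp
  have "real N = real m / \<epsilon> + 1 / \<epsilon>" using \<delta>_N eps by (simp add: \<delta>_def add_divide_distrib)
  then have "real (N + 1) \<le> 3 * R" using R_bounds by (simp add: R_def)
  also have "\<dots> \<le> R * R" using R_bounds by (intro mult_right_mono) auto
  finally have "real (N + 1) \<le> R ^ 2" by (simp add: power2_eq_square)
  then have "real (N + 1) ^ m \<le> (R ^ 2) ^ m" by (intro power_mono) auto
  moreover have "real (card (grid m \<delta>)) \<le> real ((N + 1) ^ m)"
    using finite_card_grid(2)[OF \<delta>_pos \<delta>_N, of m] by (simp only: of_nat_le_iff)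
  ultimately show ?thesis by (simp add: power_mult)
qed

lemma card_grid_pos: "1 \<le> real (card (grid m \<delta>))"
proof -
  have "grid m \<delta> \<noteq> {}" using q_grid[of 1] n by auto
  then have "0 < card (grid m \<delta>)" using finite_card_grid(1)[OF \<delta>_pos \<delta>_N] by (simp add: card_gt_0_iff)
  then show ?thesis by simp
qed

text \<open>Numerical factors are absorbed by extra powers of R \<ge> 100. The grid has at most R^(2
  m) vectors and the levels add another such factor and R^2, which gives 4 m + 3 \<le> 7 m in the
  base of the pattern count.\<close>

lemma ex_small_bracketing:
  assumes i: "i < rounds"
  shows "\<exists>\<C>. bracketing b (gam i) \<C> \<and> real (card \<C>) \<le> 2 * R ^ (7 * m\<^sup>2)"
proof -
  let ?G = "card (grid m \<delta>)"
  define K where "K = nat \<lceil>8 * real ?G / gam i\<rceil>"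
  have R1: "1 \<le> R" using R_bounds by simp
  have q0: "0 \<le> 8 * real ?G / gam i" using gam_bounds(1)[OF i] by simp
  then have K: "8 * real ?G / gam i \<le> real K" "real K \<le> 8 * real ?G / gam i + 1"
    unfolding K_def by linarith+
  obtain \<C> where C: "bracketing b (gam i) \<C>" "card \<C> \<le> 2 * (?G * (K + 1) + 1) ^ m"
    using ex_bracketing[OF b_pos gam_bounds(1)[OF i] K(1)] by blast
  have "8 * real ?G / gam i \<le> 8 * real ?G / \<epsilon>"
    using gam_bounds[OF i] eps by (intro divide_left_mono) auto
  also have "\<dots> = 8 * real ?G * (1 / \<epsilon>)" by simp
  also have "\<dots> \<le> 8 * real ?G * R" using R_bounds by (intro mult_left_mono) auto
  finally have "real K + 1 \<le> 8 * real ?G * R + 2" using K(2) by linarith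
  also have "\<dots> \<le> 10 * (real ?G * R)"
    using mult_mono[OF card_grid_pos R1] by (simp add: mult.commute)
  also have "\<dots> \<le> R * (real ?G * R)" using R_bounds R1 by (intro mult_right_mono) auto
  finally have "real ?G * (real K + 1) \<le> real ?G * (R * (real ?G * R))" by (intro mult_left_mono) auto
  also have "\<dots> = real ?G * real ?G * R ^ 2" by (simp add: power2_eq_square)
  also have "\<dots> \<le> R ^ (2 * m) * R ^ (2 * m) * R ^ 2"
    using card_grid_le R1 by (intro mult_mono) auto
  also have "\<dots> = R ^ (4 * m + 2)" by (simp flip: power_add)
  finally have "real (?G * (K + 1) + 1) \<le> R ^ (4 * m + 2) + 1" by (simp add: algebra_simps)
  also have "\<dots> \<le> 2 * R ^ (4 * m + 2)" using one_le_power[OF R1, of "4 * m + 2"] by simp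
  also have "\<dots> \<le> R * R ^ (4 * m + 2)" using R_bounds R1 by (intro mult_right_mono) auto
  also have "\<dots> = R ^ (4 * m + 3)" by (simp add: numeral_3_eq_3)
  also have "\<dots> \<le> R ^ (7 * m)" using m R1 by (intro power_increasing) auto
  finally have "real (?G * (K + 1) + 1) ^ m \<le> (R ^ (7 * m)) ^ m" by (intro power_mono) auto
  also have "\<dots> = R ^ (7 * m\<^sup>2)" by (simp add: power2_eq_square mult.assoc flip: power_mult)
  finally have "2 * real (?G * (K + 1) + 1) ^ m \<le> 2 * R ^ (7 * m\<^sup>2)" by simp
  moreover have "real (card \<C>) \<le> real (2 * (?G * (K + 1) + 1) ^ m)" using C(2) by (simp only: of_nat_le_iff)
  ultimately have "real (card \<C>) \<le> 2 * R ^ (7 * m\<^sup>2)"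
    by (simp only: of_nat_mult of_nat_power of_nat_numeral)
  then show ?thesis using C(1) by blast
qed

text \<open>The factor 2^i in the sample size cancels against the one in \<open>gam i\<close>, so
  the exponent is \<epsilon>^2 b / 64 in every round. Of the resulting R^(-12 m^2), the number of
  sets takes R^(7 m^2) and the factor 4 m at most one more \<open>R\<close>, which leaves at most
  R^(-3).\<close>

lemma atypical_mean_le:
  assumes i: "i < rounds" and C: "bracketing b (gam i) \<C>" "real (card \<C>) \<le> 2 * R ^ (7 * m\<^sup>2)"
    and J: "J \<subseteq> {1..n}" "card J = sample i"
  shows "perm_mean {1..n} (\<lambda>\<sigma>. of_bool (\<not> typical b (gam i) \<C> J \<sigma>)) \<le> \<epsilon> ^ 3"
proof -
  let ?M = "m\<^sup>2"
  have R0: "0 < R" and R1: "1 \<le> R" using R_bounds by auto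
  have m1: "1 \<le> ?M" using m by (simp add: Suc_le_eq)
  have "real (card J) / real n * b * (gam i)\<^sup>2 = \<epsilon>\<^sup>2 * b"
    unfolding J(2) sample_ratio gam_sq by (simp add: power2_eq_square)
  then have "12 * real ?M * ln R \<le> real (card J) / real n * b * (gam i)\<^sup>2 / 64"
    using eps_sq_b by simp
  then have "exp (- (real (card J) / real n * b * (gam i)\<^sup>2 / 64)) \<le> exp (- (12 * real ?M * ln R))" by simp
  also have "\<dots> = inverse (exp (real (12 * ?M) * ln R))" by (simp add: exp_minus)
  also have "exp (real (12 * ?M) * ln R) = R ^ (12 * ?M)" using R0 by (simp only: exp_of_nat_mult exp_ln)
  finally have ex: "exp (- (real (card J) / real n * b * (gam i)\<^sup>2 / 64)) \<le> inverse (R ^ (12 * ?M))" .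
  have "perm_mean {1..n} (\<lambda>\<sigma>. of_bool (\<not> typical b (gam i) \<C> J \<sigma>))
      \<le> 2 * real m * real (card \<C>) * exp (- (real (card J) / real n * b * (gam i)\<^sup>2 / 64))"
    using gam_bounds[OF i] C(1) b_pos by (intro not_typical_mean J) (auto simp: bracketing_def)
  also have "\<dots> \<le> 2 * real m * (2 * R ^ (7 * ?M)) * inverse (R ^ (12 * ?M))"
    using C(2) ex R0 by (intro mult_mono) auto
  also have "\<dots> = 4 * real m * (R ^ (7 * ?M) * inverse (R ^ (12 * ?M)))" by simp
  also have "\<dots> \<le> R * (R ^ (7 * ?M) * inverse (R ^ (12 * ?M)))"
    using R_bounds R0 by (intro mult_right_mono) auto
  also have "\<dots> = R ^ (7 * ?M + 1) * inverse (R ^ (12 * ?M))" by simp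
  also have "\<dots> \<le> R ^ (7 * ?M + 1) * inverse (R ^ (7 * ?M + 4))"
    using R0 R1 m1 by (intro mult_left_mono le_imp_inverse_le power_increasing) auto
  also have "R ^ (7 * ?M + 4) = R ^ (7 * ?M + 1) * R ^ 3" unfolding power_add[symmetric] by (simp add: add.commute)
  also have "R ^ (7 * ?M + 1) * inverse (R ^ (7 * ?M + 1) * R ^ 3) = (inverse R) ^ 3"
    using R0 by (simp add: field_simps)
  also have "\<dots> \<le> \<epsilon> ^ 3"
  proof (rule power_mono)
    have "inverse R \<le> inverse (1 / \<epsilon>)" using R_bounds(2) eps by (intro le_imp_inverse_le) auto
    then show "inverse R \<le> \<epsilon>" by simp
  qed (use R0 in simp)
  finally show ?thesis .
qed

lemma round:
  assumes i: "i < rounds"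
  shows "\<exists>\<C>. otp_round m n B \<epsilon> \<pi> a q b (gam i) (\<epsilon> ^ 3) (sample i) D \<C>"
proof -
  obtain \<C> where C: "bracketing b (gam i) \<C>" "real (card \<C>) \<le> 2 * R ^ (7 * m\<^sup>2)"
    using ex_small_bracketing[OF i] by blast
  have "otp_round m n B \<epsilon> \<pi> a q b (gam i) (\<epsilon> ^ 3) (sample i) D \<C>"
  proof unfold_locales
    show "general_position m n \<pi> c" using gp by (simp add: c_def)
    show "otp_dual_optimal m n b \<pi> c (sample i) (gam i) \<sigma> (D (map \<sigma> [1..<sample i + 1]))"
      if "\<sigma> permutes {1..n}" for \<sigma>
      using rule i that unfolding robust_dpa_rule_def rounds_def b_def c_def sample_def gam_def by blast
    \<comment> \<open>The ties cost m \<le> \<epsilon>^2 b, which is \<open>gam i ^ 2\<close> times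
      the share of the budget; one factor \<open>gam i\<close> is given away.\<close>
    have "real m \<le> real m * real m" using m by simp
    also have "\<dots> * 1 \<le> real m * real m * ln R" using R_bounds by (intro mult_left_mono) auto
    also have "\<dots> \<le> 768 * (real m)\<^sup>2 * ln R" using R_bounds(4) by (simp add: power2_eq_square)
    also have "\<dots> \<le> \<epsilon>\<^sup>2 * b" by (rule eps_sq_b)
    also have "\<dots> = gam i ^ 2 * (\<epsilon> * 2 ^ i) * b" unfolding gam_sq by (simp add: power2_eq_square)
    also have "\<dots> \<le> gam i * (\<epsilon> * 2 ^ i) * b"
      using gam_bounds[OF i] b_pos eps
      by (intro mult_right_mono) (auto simp: power2_eq_square mult_left_le)
    finally show "real m \<le> gam i * (real (sample i) / real n) * b" by (simp add: sample_ratio)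
    show "\<epsilon> ^ 3 \<le> gam i"
    proof -
      have "\<epsilon> ^ 3 \<le> \<epsilon> ^ 1" using eps by (intro power_decreasing) auto
      then show ?thesis using gam_bounds(3)[OF i] by simp
    qed
    show "perm_mean {1..n} (\<lambda>\<sigma>. of_bool (\<not> typical b (gam i) \<C> J \<sigma>)) \<le> \<epsilon> ^ 3"
      if "J \<subseteq> {1..n}" "card J = sample i" for J
      by (rule atypical_mean_le[OF i C that])
  qed (use b_pos gam_bounds[OF i] sample_pos two_sample_le[OF i] eps C(1) in auto)
  then show ?thesis by blast
qed

abbreviation "otp_i i \<equiv> otp m n b \<pi> c D (sample i)"

lemma robust_dpa_eq: "robust_dpa m n B \<epsilon> \<pi> a q D \<sigma> j = (\<Sum>i<rounds. otp_i i \<sigma> j)"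
  by (simp add: robust_dpa_def rounds_def b_def c_def sample_def)

text \<open>The fractions double from \<epsilon> up to 1/2; the missing \<epsilon> is the initial
  sample, on which nothing is selected.\<close>

lemma sum_sample_ratio: "(\<Sum>i<rounds. \<epsilon> * 2 ^ i) = 1 - \<epsilon>"
proof -
  have "(\<Sum>i<l. \<epsilon> * 2 ^ i) = \<epsilon> * (2 ^ l - 1)" for l by (induction l) (auto simp: algebra_simps)
  then have "(\<Sum>i<rounds. \<epsilon> * 2 ^ i) = \<epsilon> * (2 ^ rounds - 1)" .
  then show ?thesis unfolding two_pow_rounds using eps by (simp add: right_diff_distrib)
qed

text \<open>No typicality enters: the stopping rule limits round i to \<epsilon> 2^i b of every
  resource, and the blocks of different rounds are disjoint.\<close>

lemma robust_dpa_feasible: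
  assumes \<sigma>: "\<sigma> permutes {1..n}"
  shows "lp_feasible m n B a (robust_dpa m n B \<epsilon> \<pi> a q D \<sigma>)"
proof (rule feasible_of_rounded)
  fix t
  have bd: "0 \<le> otp_i i \<sigma> t" "otp_i i \<sigma> t \<le> of_bool (inv \<sigma> t \<in> {sample i + 1..sample (Suc i)})"
    if i: "i < rounds" for i
  proof -
    from round[OF i] obtain \<C> where "otp_round m n B \<epsilon> \<pi> a q b (gam i) (\<epsilon> ^ 3) (sample i) D \<C>" ..
    then interpret r: otp_round m n B \<epsilon> \<pi> a q b "gam i" "\<epsilon> ^ 3" "sample i" D \<C> .
    show "0 \<le> otp_i i \<sigma> t" "otp_i i \<sigma> t \<le> of_bool (inv \<sigma> t \<in> {sample i + 1..sample (Suc i)})"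
      unfolding sample_Suc by (rule r.otp_bounds)+
  qed
  have "(\<Sum>i<rounds. otp_i i \<sigma> t) \<le> (\<Sum>i<rounds. of_bool (inv \<sigma> t \<in> {sample i + 1..sample (Suc i)}))"
    using bd by (intro sum_mono) auto
  also have "\<dots> = of_bool (inv \<sigma> t \<in> {sample 0 + 1..sample rounds})"
    by (rule sum_of_bool_intervals) (simp add: sample_Suc)
  also have "\<dots> \<le> 1" by simp
  finally show "0 \<le> robust_dpa m n B \<epsilon> \<pi> a q D \<sigma> t \<and> robust_dpa m n B \<epsilon> \<pi> a q D \<sigma> t \<le> 1"
    unfolding robust_dpa_eq using bd(1) by (auto intro: sum_nonneg)
next
  fix k assume k: "k \<in> {1..m}"
  have le: "(\<Sum>t=1..n. c t k * otp_i i \<sigma> t) \<le> \<epsilon> * 2 ^ i * b" if i: "i < rounds" for i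
  proof -
    from round[OF i] obtain \<C> where "otp_round m n B \<epsilon> \<pi> a q b (gam i) (\<epsilon> ^ 3) (sample i) D \<C>" ..
    then interpret r: otp_round m n B \<epsilon> \<pi> a q b "gam i" "\<epsilon> ^ 3" "sample i" D \<C> .
    show ?thesis unfolding r.sum_otp[OF \<sigma>] using r.stop_prop(2)[OF k, of \<sigma>] by (simp only: sample_ratio)
  qed
  have "(\<Sum>t=1..n. c t k * robust_dpa m n B \<epsilon> \<pi> a q D \<sigma> t) = (\<Sum>i<rounds. \<Sum>t=1..n. c t k * otp_i i \<sigma> t)"
    unfolding robust_dpa_eq sum_distrib_left by (rule sum.swap)
  also have "\<dots> \<le> (\<Sum>i<rounds. \<epsilon> * 2 ^ i * b)" using le by (intro sum_mono) auto
  also have "\<dots> = (1 - \<epsilon>) * b" unfolding sum_distrib_right[symmetric] sum_sample_ratio ..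
  also have "\<dots> \<le> 1 * b" using eps b_pos by (intro mult_right_mono) auto
  finally show "(\<Sum>t=1..n. c t k * robust_dpa m n B \<epsilon> \<pi> a q D \<sigma> t) \<le> (1 - \<epsilon>) * B" by (simp add: b_def)
qed

text \<open>The terms grow geometrically with ratio sqrt 2, so the last rounds dominate. The sum is
  at most \<epsilon> / (sqrt 2 - 1), and sqrt 2 - 1 \<ge> 2/5.\<close>

lemma sum_ratio_gam: "(\<Sum>i<rounds. \<epsilon> * 2 ^ i * gam i) \<le> 5 / 2 * \<epsilon>"
proof -
  let ?r = "sqrt 2"
  have r: "7 / 5 \<le> ?r" by (rule real_le_rsqrt) (simp add: power2_eq_square)
  have summand: "\<epsilon> * 2 ^ i * gam i = \<epsilon> * sqrt \<epsilon> * ?r ^ i" for i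
  proof -
    have "gam i = sqrt \<epsilon> / ?r ^ i" by (simp add: gam_def real_sqrt_divide real_sqrt_power)
    moreover have "(2::real) ^ i = ?r ^ i * ?r ^ i" by (simp flip: power_mult_distrib)
    ultimately show ?thesis by simp
  qed
  have geo: "(?r - 1) * (\<Sum>i<l. \<epsilon> * sqrt \<epsilon> * ?r ^ i) = \<epsilon> * sqrt \<epsilon> * (?r ^ l - 1)" for l
    by (induction l) (auto simp: algebra_simps)
  have "?r ^ rounds = sqrt (1 / \<epsilon>)" unfolding two_pow_rounds[symmetric] by (simp add: real_sqrt_power)
  then have "sqrt \<epsilon> * (?r ^ rounds - 1) \<le> 1"
    using eps by (simp add: right_diff_distrib real_sqrt_divide)
  then have "\<epsilon> * (sqrt \<epsilon> * (?r ^ rounds - 1)) \<le> \<epsilon> * 1" using eps by (intro mult_left_mono) auto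
  then have "(?r - 1) * (\<Sum>i<rounds. \<epsilon> * sqrt \<epsilon> * ?r ^ i) \<le> \<epsilon>" unfolding geo by (simp add: mult.assoc)
  moreover have "2 / 5 * (\<Sum>i<rounds. \<epsilon> * sqrt \<epsilon> * ?r ^ i) \<le> (?r - 1) * (\<Sum>i<rounds. \<epsilon> * sqrt \<epsilon> * ?r ^ i)"
    using r eps by (intro mult_right_mono sum_nonneg) auto
  ultimately show ?thesis unfolding summand by linarith
qed

text \<open>The losses are \<epsilon> for the initial sample, 8 * 5/2 \<epsilon> for the rounds and
  \<epsilon> for atypical orders, together 22 \<epsilon>; rounding and the reduced budget add 2
  \<epsilon>.\<close>

lemma robust_dpa_mean_value:
  "(1 - 50 * \<epsilon>) * lp_opt m n B \<pi> a
     \<le> perm_mean {1..n} (\<lambda>\<sigma>. lp_value n \<pi> (robust_dpa m n B \<epsilon> \<pi> a q D \<sigma>))"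
proof -
  let ?O = "lp_opt m n b \<pi> c" and ?O' = "lp_opt m n B \<pi> a"
  have O: "0 \<le> ?O" "0 \<le> ?O'" using b_pos B \<pi>_nonneg by (auto intro!: lp_opt_nonneg)
  have le: "(\<epsilon> * 2 ^ i * (1 - 8 * gam i) - \<epsilon> ^ 3) * ?O
      \<le> perm_mean {1..n} (\<lambda>\<sigma>. lp_value n \<pi> (otp_i i \<sigma>))" if i: "i < rounds" for i
  proof -
    from round[OF i] obtain \<C> where "otp_round m n B \<epsilon> \<pi> a q b (gam i) (\<epsilon> ^ 3) (sample i) D \<C>" ..
    then interpret r: otp_round m n B \<epsilon> \<pi> a q b "gam i" "\<epsilon> ^ 3" "sample i" D \<C> .
    show ?thesis using r.mean_otp_value_ge unfolding r.opt_value_def sample_ratio .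
  qed
  have small: "real rounds * \<epsilon> ^ 3 \<le> \<epsilon>"
  proof -
    \<comment> \<open>The number of rounds is bounded crudely by 1 / \<epsilon>, which a failure
      probability of \<epsilon>^3 per round affords.\<close>
    have "real rounds \<le> real (2 ^ rounds)" using less_exp[of rounds] by (simp only: of_nat_le_iff less_imp_le)
    then have "real rounds \<le> 1 / \<epsilon>" by (simp add: two_pow_rounds)
    then have "real rounds * \<epsilon> ^ 3 \<le> 1 / \<epsilon> * \<epsilon> ^ 3" using eps by (intro mult_right_mono) auto
    also have "\<dots> = \<epsilon> * \<epsilon>" using eps by (simp add: power3_eq_cube)
    also have "\<dots> \<le> \<epsilon>" using eps by (intro mult_left_le) auto
    finally show ?thesis .
  qed
  have "(1 - 22 * \<epsilon>) \<le> (1 - \<epsilon>) - 8 * (\<Sum>i<rounds. \<epsilon> * 2 ^ i * gam i) - real rounds * \<epsilon> ^ 3"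
    using sum_ratio_gam small by linarith
  also have "\<dots> = (\<Sum>i<rounds. \<epsilon> * 2 ^ i * (1 - 8 * gam i) - \<epsilon> ^ 3)"
  proof -
    have "(\<Sum>i<rounds. \<epsilon> * 2 ^ i * (1 - 8 * gam i) - \<epsilon> ^ 3)
        = (\<Sum>i<rounds. \<epsilon> * 2 ^ i - 8 * (\<epsilon> * 2 ^ i * gam i) - \<epsilon> ^ 3)"
      by (intro sum.cong refl) (simp add: algebra_simps)
    also have "\<dots> = (1 - \<epsilon>) - 8 * (\<Sum>i<rounds. \<epsilon> * 2 ^ i * gam i) - real rounds * \<epsilon> ^ 3"
      unfolding sum_subtractf sum_sample_ratio sum_distrib_left[symmetric, of 8] by simp
    finally show ?thesis by (rule sym)
  qed
  finally have coeff: "(1 - 22 * \<epsilon>) \<le> (\<Sum>i<rounds. \<epsilon> * 2 ^ i * (1 - 8 * gam i) - \<epsilon> ^ 3)" .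
  have "(1 - 50 * \<epsilon>) * ?O' \<le> ((1 - 22 * \<epsilon>) * (1 - 2 * \<epsilon>)) * ?O'"
  proof (rule mult_right_mono[OF _ O(2)])
    have "0 \<le> \<epsilon> * \<epsilon>" by simp
    then show "1 - 50 * \<epsilon> \<le> (1 - 22 * \<epsilon>) * (1 - 2 * \<epsilon>)" using eps by (simp add: algebra_simps)
  qed
  also have "\<dots> = (1 - 22 * \<epsilon>) * ((1 - 2 * \<epsilon>) * ?O')" by simp
  also have "\<dots> \<le> (1 - 22 * \<epsilon>) * ?O"
    using rounded_opt_ge eps unfolding b_def by (intro mult_left_mono) auto
  also have "\<dots> \<le> (\<Sum>i<rounds. \<epsilon> * 2 ^ i * (1 - 8 * gam i) - \<epsilon> ^ 3) * ?O"
    by (rule mult_right_mono[OF coeff O(1)])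
  also have "\<dots> \<le> (\<Sum>i<rounds. perm_mean {1..n} (\<lambda>\<sigma>. lp_value n \<pi> (otp_i i \<sigma>)))"
    unfolding sum_distrib_right using le by (intro sum_mono) auto
  also have "\<dots> = perm_mean {1..n} (\<lambda>\<sigma>. \<Sum>i<rounds. lp_value n \<pi> (otp_i i \<sigma>))"
    by (rule perm_mean_sum[symmetric])
  also have "\<dots> = perm_mean {1..n} (\<lambda>\<sigma>. lp_value n \<pi> (robust_dpa m n B \<epsilon> \<pi> a q D \<sigma>))"
    unfolding lp_value_def robust_dpa_eq sum_distrib_left by (intro perm_mean_cong) (rule sum.swap)
  finally show ?thesis .
qed

end

theorem theorem3:
  "\<exists>C::real. C > 0 \<and>
    (\<forall>(m::nat) (n::nat) (B::real) (\<epsilon>::real) (\<pi>::nat \<Rightarrow> real) (a::nat \<Rightarrow> nat \<Rightarrow> real)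
       (q::nat \<Rightarrow> nat \<Rightarrow> real) (D::nat list \<Rightarrow> (nat \<Rightarrow> real) \<times> (nat \<Rightarrow> real)).
      packing_lp m n B \<pi> a \<longrightarrow>
      0 < \<epsilon> \<longrightarrow> \<epsilon> < 1 / 100 \<longrightarrow>
      log 2 (1 / \<epsilon>) \<in> \<int> \<longrightarrow> \<epsilon> * real n \<in> \<int> \<longrightarrow> (real m + 1) / \<epsilon> \<in> \<int> \<longrightarrow>
      B \<ge> C * ((real m)\<^sup>2 / \<epsilon>\<^sup>2) * ln (real m / \<epsilon>) \<longrightarrow>
      rounding m n \<epsilon> a q \<longrightarrow>
      general_position m n \<pi> a \<longrightarrow>
      general_position m n \<pi> (rounded m a q) \<longrightarrow>
      robust_dpa_rule m n B \<epsilon> \<pi> a q D \<longrightarrow>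
      (\<forall>\<sigma>. \<sigma> permutes {1..n} \<longrightarrow> lp_feasible m n B a (robust_dpa m n B \<epsilon> \<pi> a q D \<sigma>)) \<and>
      measure_pmf.expectation (pmf_of_set {\<sigma>. \<sigma> permutes {1..n}})
          (\<lambda>\<sigma>. lp_value n \<pi> (robust_dpa m n B \<epsilon> \<pi> a q D \<sigma>))
        \<ge> (1 - 50 * \<epsilon>) * lp_opt m n B \<pi> a)"
proof (intro exI[of _ 1536] conjI allI impI)
  fix m n B \<epsilon> \<pi> and a q :: "nat \<Rightarrow> nat \<Rightarrow> real" and D :: "nat list \<Rightarrow> (nat \<Rightarrow> real) \<times> (nat \<Rightarrow> real)" and \<sigma>
  assume A: "packing_lp m n B \<pi> a" "0 < \<epsilon>" "\<epsilon> < 1 / 100"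
    "log 2 (1 / \<epsilon>) \<in> \<int>" "\<epsilon> * real n \<in> \<int>" "(real m + 1) / \<epsilon> \<in> \<int>"
    "B \<ge> 1536 * ((real m)\<^sup>2 / \<epsilon>\<^sup>2) * ln (real m / \<epsilon>)"
    "rounding m n \<epsilon> a q" "general_position m n \<pi> (rounded m a q)"
    "robust_dpa_rule m n B \<epsilon> \<pi> a q D"
  then interpret robust_dpa_run m n B \<epsilon> \<pi> a q D by unfold_locales
  show "lp_feasible m n B a (robust_dpa m n B \<epsilon> \<pi> a q D \<sigma>)" if "\<sigma> permutes {1..n}"
    by (rule robust_dpa_feasible[OF that])
  show "measure_pmf.expectation (pmf_of_set {\<sigma>. \<sigma> permutes {1..n}})
      (\<lambda>\<sigma>. lp_value n \<pi> (robust_dpa m n B \<epsilon> \<pi> a q D \<sigma>)) \<ge> (1 - 50 * \<epsilon>) * lp_opt m n B \<pi> a"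
    using robust_dpa_mean_value by (simp add: perm_mean_pmf)
qed simp

end
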